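(* Let $\mathbb{K}$ be a field and let $\Gamma$ be a finite, connected, simple graph with zigzag algebra $Z(\Gamma)$ over $\mathbb{K}$. Then: (1) $Z(\Gamma)$ is a cellular algebra (i.e. admits some cell datum) if and only if $\Gamma$ is a type $\mathsf{A}_n$ graph for some $n\geq 1$. (2) $Z(\Gamma)$ is a relative cellular algebra (i.e. admits some relative cell datum) if and only if $\Gamma$ is a type $\mathsf{A}_n$ graph for some $n\geq 1$ or a type $\widetilde{\mathsf{A}}_n$ graph for some $n\geq 2$.
   Context: Graphs. The type $\mathsf{A}_n$ graph ($n\geq 1$) is the path with vertices $1,\dots,n$ and edges between $i$ and $i+1$. The type $\widetilde{\mathsf{A}}_n$ graph ($n\geq 2$) is the cycle on the $n+1$ vertices $0,1,\dots,n$. Zigzag algebra. Let $\Gamma$ be a finite, connected, simple graph. Let $Q$ be the double quiver of $\Gamma$: same vertices, and for each edge between $i$ and $j$ two arrows $i\to j$ and $j\to i$. Paths are composed from left to right, so $(i\to j)\cdot(j\to k)=(i\to j\to k)$; $e_i$ denotes the length-zero path at $i$. If $\Gamma$ has at least three vertices, $Z(\Gamma)$ is the quotient of the path algebra $\mathbb{K}Q$ by the relations $i\to j\to k=0$ for $i\neq k$, and $i\to j\to i=i\to k\to i$ for all neighbors $j,k$ of $i$. If $\Gamma$ has two vertices, $Z(\Gamma)$ is $\mathbb{K}Q$ modulo all paths of length three. In these cases put $x_i=i\to j\to i$ for any neighbor $j$ of $i$. If $\Gamma$ has one vertex $i$, $Z(\Gamma)=\mathbb{K}[x_i]/(x_i^2)$.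 In all cases $Z(\Gamma)$ has $\mathbb{K}$-basis consisting of all $e_i$, all $x_i$ and all arrows $i\to j$. Relative cellular algebra. A relative cellular algebra is an associative unital $\mathbb{K}$-algebra $R$ together with a relative cell datum $(X,M,C,{}^{\star},E,O,\epsilon)$ such that: (a) $X$ is a set, $M=\{M(\lambda)\mid\lambda\in X\}$ a collection of finite sets, and $C\colon\coprod_{\lambda\in X}M(\lambda)\times M(\lambda)\to R$, $(S,T)\mapsto C^{\lambda}_{S,T}$ for $S,T\in M(\lambda)$, is an injective map whose image is a basis of $R$. (b) ${}^{\star}$ is an anti-involution of $R$ with $(C^{\lambda}_{S,T})^{\star}=C^{\lambda}_{T,S}$. (c) $E$ is a set of pairwise orthogonal, non-zero idempotents of $R$ with $\varepsilon^{\star}=\varepsilon$ for all $\varepsilon\in E$; $O=\{<_{\varepsilon}\mid\varepsilon\in E\}$ is a set of partial orders on $X$; $\epsilon\colon\coprod_{\lambda\in X}M(\lambda)\to E$, $S\mapsto\varepsilon_S$, is a map such that for all $\lambda\in X$, $S,T\in M(\lambda)$, $\varepsilon\in E$: $\varepsilon R\varepsilon\, C^{\lambda}_{S,T}\subset R(\leq_{\varepsilon}\lambda)$, and $\varepsilon C^{\lambda}_{S,T}=C^{\lambda}_{S,T}$ if $\varepsilon_S=\varepsilon$ and $\varepsilon C^{\lambda}_{S,T}=0$ if $\varepsilon_S\neq\varepsilon$. (d) For $\lambda\in X$, $S,T\in M(\lambda)$, $a\in R$: $a\,C^{\lambda}_{S,T}\in\sum_{S'\in M(\lambda)}r_a(S',S)\,C^{\lambda}_{S',T}+R(<_{\varepsilon_T}\lambda)\,\varepsilon_T$,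 with scalars $r_a(S',S)\in\mathbb{K}$ depending only on $a,S,S'$. Here $R(\leq_{\varepsilon}\lambda)$ (resp. $R(<_{\varepsilon}\lambda)$) is the span of all $C^{\mu}_{S,T}$ with $\mu\leq_{\varepsilon}\lambda$ (resp. $\mu<_{\varepsilon}\lambda$) and $S,T\in M(\mu)$. A cellular algebra is a relative cellular algebra with a datum for which $E=\{1\}$ (this is the usual Graham--Lehrer notion). *)

theory Defs
  imports
    "Jordan_Normal_Form.Missing_VectorSpace"
    "Graph_Theory.Graph_Theory"
    "HOL-Algebra.QuotRing"
    "HOL-Library.Infinite_Typeclass"
begin

hide_const (open) Multiset.mult  (* it shadows the record field of the same name *)

section \<open>Graphs\<close>

definition type_A :: "nat \<Rightarrow> nat pair_pre_digraph" where
  "type_A n = \<lparr> pverts = {1..n},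
     parcs = {(i, j). i \<in> {1..n} \<and> j \<in> {1..n} \<and> (j = i + 1 \<or> i = j + 1)} \<rparr>"

definition type_affine_A :: "nat \<Rightarrow> nat pair_pre_digraph" where
  "type_affine_A n = \<lparr> pverts = {0..n},
     parcs = {(i, j). i \<in> {0..n} \<and> j \<in> {0..n} \<and>
                (j = (i + 1) mod (n + 1) \<or> i = (j + 1) mod (n + 1))} \<rparr>"


section \<open>Path algebras and their quotients\<close>

text \<open>
  Quivers are given as pair digraphs, so arrows are determined by their endpoints. A path is
  therefore the same thing as the non-empty list of vertices it visits (\<^const>\<open>vwalk\<close>);
  its length is the length of the list minus one, and \<open>[i]\<close> is the path \<open>e\<^sub>i\<close>.
  An element of the path algebra is a finitely supported function from paths to \<open>K\<close>. The ways to
  write a path \<open>p\<close> as a composite (from left to right) of two paths are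
  \<open>take (Suc m) p \<cdot> drop m p\<close> for \<open>m < length p\<close>.
\<close>

definition path_algebra ::
  "('k, 'm) ring_scheme \<Rightarrow> 'v pair_pre_digraph \<Rightarrow> ('k, 'v list \<Rightarrow> 'k) module" where
  "path_algebra K Q = \<lparr>
     carrier = {f. (\<forall>p. f p \<in> carrier K) \<and> (\<forall>p. \<not> vwalk p Q \<longrightarrow> f p = \<zero>\<^bsub>K\<^esub>) \<and>
                   finite {p. f p \<noteq> \<zero>\<^bsub>K\<^esub>}},
     mult = (\<lambda>f g p. \<Oplus>\<^bsub>K\<^esub>m\<in>{..<length p}. f (take (Suc m) p) \<otimes>\<^bsub>K\<^esub> g (drop m p)),
     one = (\<lambda>p. if vwalk p Q \<and> length p = 1 then \<one>\<^bsub>K\<^esub> else \<zero>\<^bsub>K\<^esub>),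
     zero = (\<lambda>p. \<zero>\<^bsub>K\<^esub>),
     add = (\<lambda>f g p. f p \<oplus>\<^bsub>K\<^esub> g p),
     smult = (\<lambda>k f p. k \<otimes>\<^bsub>K\<^esub> f p) \<rparr>"

definition path_elem :: "('k, 'm) ring_scheme \<Rightarrow> 'v list \<Rightarrow> 'v list \<Rightarrow> 'k" where
  "path_elem K p = (\<lambda>q. if q = p then \<one>\<^bsub>K\<^esub> else \<zero>\<^bsub>K\<^esub>)"

definition quotient_algebra ::
  "('k, 'a, 'm) module_scheme \<Rightarrow> 'a set \<Rightarrow> ('k, 'a set) module" where
  "quotient_algebra A I = ring.extend (A Quot I)
     (module.fields (\<lambda>k B. \<Union>b\<in>B. I +>\<^bsub>A\<^esub> (k \<odot>\<^bsub>A\<^esub> b)))"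

definition quiver_algebra_mod ::
  "('k, 'm) ring_scheme \<Rightarrow> 'v pair_pre_digraph \<Rightarrow> ('v list \<Rightarrow> 'k) set \<Rightarrow>
   ('k, ('v list \<Rightarrow> 'k) set) module" where
  "quiver_algebra_mod K Q rels =
     quotient_algebra (path_algebra K Q) (genideal (path_algebra K Q) rels)"


section \<open>Zigzag algebras\<close>

definition double_quiver :: "('v, 'b) pre_digraph \<Rightarrow> 'v pair_pre_digraph" where
  "double_quiver G = \<lparr> pverts = verts G, parcs = arcs_ends G \<rparr>"

definition loop_quiver :: "('v, 'b) pre_digraph \<Rightarrow> 'v pair_pre_digraph" where
  "loop_quiver G = \<lparr> pverts = verts G, parcs = Id_on (verts G) \<rparr>"

text \<open>
  If the only vertex is \<open>i\<close>, then \<open>K[x\<^sub>i]\<close> is realized as the path algebra of the quiver with one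
  vertex and one loop: the loop \<open>[i, i]\<close> is \<open>x\<^sub>i\<close>, and the path of length \<open>n\<close> is \<open>x\<^sub>i\<close> to the
  power \<open>n\<close>. In particular, \<open>[i, i, i]\<close> is the square of \<open>x\<^sub>i\<close>.
\<close>

definition zigzag_algebra ::
  "('k, 'm) ring_scheme \<Rightarrow> ('v, 'b) pre_digraph \<Rightarrow> ('k, ('v list \<Rightarrow> 'k) set) module" where
  "zigzag_algebra K G =
     (let Q = double_quiver G; A = path_algebra K Q in
      if card (verts G) = 1 then
        quiver_algebra_mod K (loop_quiver G) {path_elem K [i, i, i] | i. i \<in> verts G}
      else if card (verts G) = 2 then
        quiver_algebra_mod K Q {path_elem K p | p. vwalk p Q \<and> length p = 4}
      else
        quiver_algebra_mod K Q
          ({path_elem K [i, j, k] | i j k. vwalk [i, j, k] Q \<and> i \<noteq> k} \<union>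
           {path_elem K [i, j, i] \<ominus>\<^bsub>A\<^esub> path_elem K [i, k, i] | i j k.
              vwalk [i, j, i] Q \<and> vwalk [i, k, i] Q}))"


section \<open>Relative cellular algebras\<close>

locale assoc_algebra = vectorspace K R + ring R for K and R (structure) +
  assumes smult_mult_left:
      "\<lbrakk>k \<in> carrier K; x \<in> carrier R; y \<in> carrier R\<rbrakk> \<Longrightarrow> (k \<odot> x) \<otimes> y = k \<odot> (x \<otimes> y)"
    and smult_mult_right:
      "\<lbrakk>k \<in> carrier K; x \<in> carrier R; y \<in> carrier R\<rbrakk> \<Longrightarrow> x \<otimes> (k \<odot> y) = k \<odot> (x \<otimes> y)"

definition anti_involution ::
  "('k, 'm) ring_scheme \<Rightarrow> ('k, 'a, 'n) module_scheme \<Rightarrow> ('a \<Rightarrow> 'a) \<Rightarrow> bool" where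
  "anti_involution K R star \<longleftrightarrow>
     star \<in> LinearCombinations.module_hom K R R \<and>
     (\<forall>x\<in>carrier R. \<forall>y\<in>carrier R. star (x \<otimes>\<^bsub>R\<^esub> y) = star y \<otimes>\<^bsub>R\<^esub> star x) \<and>
     (\<forall>x\<in>carrier R. star (star x) = x)"

definition cell_span ::
  "('k, 'm) ring_scheme \<Rightarrow> ('k, 'a, 'n) module_scheme \<Rightarrow> ('x \<Rightarrow> 's set) \<Rightarrow>
   ('x \<Rightarrow> 's \<Rightarrow> 's \<Rightarrow> 'a) \<Rightarrow> 'x set \<Rightarrow> 'a set" where
  "cell_span K R M C Y =
     LinearCombinations.module.span K R {C \<mu> S T | \<mu> S T. \<mu> \<in> Y \<and> S \<in> M \<mu> \<and> T \<in> M \<mu>}"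

text \<open>
  The orders are given by their reflexive versions: \<open>(\<mu>, \<nu>) \<in> leq \<epsilon>\<close> means that \<open>\<mu>\<close> is smaller
  than or equal to \<open>\<nu>\<close> in the order attached to the idempotent \<open>\<epsilon>\<close>. Since the sets
  \<open>M \<nu>\<close> are only combined in a disjoint union, the idempotent attached to \<open>S \<in> M \<nu>\<close> and the
  scalars \<open>r\<close> may depend on \<open>\<nu>\<close> in addition to \<open>S\<close>.
\<close>

locale relative_cell_datum = assoc_algebra K R
  for K :: "('k, 'm) ring_scheme" and R :: "('k, 'a, 'n) module_scheme" (structure) +
  fixes X :: "'x set"
    and M :: "'x \<Rightarrow> 's set"
    and C :: "'x \<Rightarrow> 's \<Rightarrow> 's \<Rightarrow> 'a"
    and star :: "'a \<Rightarrow> 'a"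
    and E :: "'a set"
    and leq :: "'a \<Rightarrow> ('x \<times> 'x) set"
    and eps :: "'x \<Rightarrow> 's \<Rightarrow> 'a"
  assumes finite_M: "\<nu> \<in> X \<Longrightarrow> finite (M \<nu>)"
    and inj_C: "inj_on (\<lambda>(\<nu>, S, T). C \<nu> S T) (SIGMA \<nu>:X. M \<nu> \<times> M \<nu>)"
    and basis_C: "vectorspace.basis K R ((\<lambda>(\<nu>, S, T). C \<nu> S T) ` (SIGMA \<nu>:X. M \<nu> \<times> M \<nu>))"
    and anti_involution_star: "anti_involution K R star"
    and star_C: "\<lbrakk>\<nu> \<in> X; S \<in> M \<nu>; T \<in> M \<nu>\<rbrakk> \<Longrightarrow> star (C \<nu> S T) = C \<nu> T S"
    and E_closed: "E \<subseteq> carrier R"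
    and E_nonzero: "\<zero> \<notin> E"
    and E_idem: "\<epsilon> \<in> E \<Longrightarrow> \<epsilon> \<otimes> \<epsilon> = \<epsilon>"
    and E_orthogonal: "\<lbrakk>\<epsilon> \<in> E; \<epsilon>' \<in> E; \<epsilon> \<noteq> \<epsilon>'\<rbrakk> \<Longrightarrow> \<epsilon> \<otimes> \<epsilon>' = \<zero>"
    and star_E: "\<epsilon> \<in> E \<Longrightarrow> star \<epsilon> = \<epsilon>"
    and order_leq: "\<epsilon> \<in> E \<Longrightarrow> partial_order_on X (leq \<epsilon>)"
    and eps_in_E: "\<lbrakk>\<nu> \<in> X; S \<in> M \<nu>\<rbrakk> \<Longrightarrow> eps \<nu> S \<in> E"
    and E_corner:
      "\<lbrakk>\<nu> \<in> X; S \<in> M \<nu>; T \<in> M \<nu>; \<epsilon> \<in> E; a \<in> carrier R\<rbrakk>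
       \<Longrightarrow> (\<epsilon> \<otimes> a \<otimes> \<epsilon>) \<otimes> C \<nu> S T \<in> cell_span K R M C {\<mu>. (\<mu>, \<nu>) \<in> leq \<epsilon>}"
    and E_C:
      "\<lbrakk>\<nu> \<in> X; S \<in> M \<nu>; T \<in> M \<nu>; \<epsilon> \<in> E\<rbrakk>
       \<Longrightarrow> \<epsilon> \<otimes> C \<nu> S T = (if eps \<nu> S = \<epsilon> then C \<nu> S T else \<zero>)"
    and mult_C:
      "\<lbrakk>\<nu> \<in> X; S \<in> M \<nu>; a \<in> carrier R\<rbrakk>
       \<Longrightarrow> \<exists>r. (\<forall>S' \<in> M \<nu>. r S' \<in> carrier K) \<and> (\<forall>T \<in> M \<nu>.
             \<exists>u \<in> cell_span K R M C {\<mu>. (\<mu>, \<nu>) \<in> leq (eps \<nu> T) \<and> \<mu> \<noteq> \<nu>}.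
               a \<otimes> C \<nu> S T = (\<Oplus>S'\<in>M \<nu>. r S' \<odot> C \<nu> S' T) \<oplus>\<^bsub>R\<^esub> u \<otimes> eps \<nu> T)"

text \<open>
  HOL cannot quantify existentially over the types \<open>'x\<close> and \<open>'s\<close> in which the index sets live, so
  they are parameters of the following two predicates.
\<close>

definition relative_cellular_algebra ::
  "'x itself \<Rightarrow> 's itself \<Rightarrow> ('k, 'm) ring_scheme \<Rightarrow> ('k, 'a, 'n) module_scheme \<Rightarrow> bool" where
  "relative_cellular_algebra _ _ K R \<longleftrightarrow>
     (\<exists>(X :: 'x set) (M :: 'x \<Rightarrow> 's set) C star E leq eps.
        relative_cell_datum K R X M C star E leq eps)"

definition cellular_algebra ::
  "'x itself \<Rightarrow> 's itself \<Rightarrow> ('k, 'm) ring_scheme \<Rightarrow> ('k, 'a, 'n) module_scheme \<Rightarrow> bool" where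
  "cellular_algebra _ _ K R \<longleftrightarrow>
     (\<exists>(X :: 'x set) (M :: 'x \<Rightarrow> 's set) C star leq eps.
        relative_cell_datum K R X M C star {\<one>\<^bsub>R\<^esub>} leq eps)"

end

theory Submission
  imports Defs
begin

text \<open>
  Let \<open>\<chi>\<^sub>i\<close> be the character of \<open>Z(\<Gamma>)\<close> reading off the coefficient of \<open>e\<^sub>i\<close>, and let \<open>\<epsilon>\<close> be the
  idempotent of the cell datum with \<open>\<chi>\<^sub>i(\<epsilon>) = 1\<close>. Then \<open>\<chi>\<^sub>i\<close> has a head cell \<open>\<lambda>\<^sub>i\<close>: it is non-zero on
  this cell and zero on the cells below it for the order of \<open>\<epsilon>\<close>; distinct vertices have distinct
  head cells. Lift \<open>e\<^sub>i\<close> to a \<open>\<star>\<close>-fixed idempotent \<open>f\<^sub>i\<close> in the corner of \<open>\<epsilon>\<close>. As \<open>f\<^sub>i Z(\<Gamma>) f\<^sub>i\<close> is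
  spanned by \<open>f\<^sub>i\<close> and \<open>x\<^sub>i\<close>, the simple module at \<open>i\<close> occurs in at most one cell module besides that
  of \<open>\<lambda>\<^sub>i\<close>. A cell in which two vertices occurred without being heads would have a bilinear form
  that vanishes and yet produces \<open>x\<^sub>i = (i \<rightarrow> j)(j \<rightarrow> i)\<close>, so a cell has at most one such vertex.
  Adjacent vertices occur in a common cell; hence adjacency is given by a partial injection and
  the connected graph \<open>\<Gamma>\<close> is a path or a cycle. If \<open>E = {1}\<close>, there is a single order, for which
  heads decrease strictly along the partial injection, and cycles are excluded.

  Conversely, on an oriented path or cycle the cell of \<open>v\<close> consists of \<open>e\<^sub>v\<close>, of \<open>x\<^sub>w\<close> for the
  successor \<open>w\<close> of \<open>v\<close>, and of the two arrows between \<open>v\<close> and \<open>w\<close>; the source of a path contributes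
  a further cell \<open>{x\<^sub>v}\<close>. On a cycle the orders are taken with respect to \<open>E = {e\<^sub>i}\<close>, where only
  neighbouring cells need to be compared.
\<close>

section \<open>Linear algebra\<close>

text \<open>The idempotents in \<open>E\<close> are given independently of the vertices: e_i need be
  neither fixed by the anti-involution nor contained in a corner \<epsilon>R\<epsilon>, and each
  \<epsilon> brings its own order. Two compatibilities are available: elements of
  \<epsilon>R\<epsilon> act from the left compatibly with the order of \<epsilon>, and arbitrary
  elements act compatibly with the order of the column idempotent. Symmetrizing before lifting
  yields idempotents to which both of them, and their mirror images, apply for the same order. The
  price is that the lifted idempotents need not be orthogonal and have unknown arrow coordinates, so
  the components f_i R f_j are studied through coordinates, using that the radical has cube zero.
  All that is used of Z(\<Gamma>) is a multiplication table for coordinate forms. The path algebra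
  satisfies it before any relation is imposed, and the zigzag relations generate precisely the
  common kernel of the forms. This treats the presentations for one, two and more vertices
  alike.\<close>

context vectorspace
begin

text \<open>\<open>K\<close> is a ring record without a scalar multiplication of its own, so
  linearity of a form into it is spelled out rather than expressed by
  \<open>module_hom\<close>.\<close>

definition lin_form :: "('c \<Rightarrow> 'a) \<Rightarrow> bool" where
  "lin_form \<phi> \<longleftrightarrow> (\<forall>x\<in>carrier V. \<phi> x \<in> carrier K) \<and>
     (\<forall>x\<in>carrier V. \<forall>y\<in>carrier V. \<phi> (x \<oplus>\<^bsub>V\<^esub> y) = \<phi> x \<oplus>\<^bsub>K\<^esub> \<phi> y) \<and>
     (\<forall>c\<in>carrier K. \<forall>x\<in>carrier V. \<phi> (c \<odot>\<^bsub>V\<^esub> x) = c \<otimes>\<^bsub>K\<^esub> \<phi> x)"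

lemma lin_formD:
  assumes "lin_form \<phi>"
  shows "x \<in> carrier V \<Longrightarrow> \<phi> x \<in> carrier K"
    and "x \<in> carrier V \<Longrightarrow> y \<in> carrier V \<Longrightarrow> \<phi> (x \<oplus>\<^bsub>V\<^esub> y) = \<phi> x \<oplus>\<^bsub>K\<^esub> \<phi> y"
    and "c \<in> carrier K \<Longrightarrow> x \<in> carrier V \<Longrightarrow> \<phi> (c \<odot>\<^bsub>V\<^esub> x) = c \<otimes>\<^bsub>K\<^esub> \<phi> x"
  using assms by (auto simp: lin_form_def)

lemma lin_form_zero:
  assumes "lin_form \<phi>"
  shows "\<phi> \<zero>\<^bsub>V\<^esub> = \<zero>\<^bsub>K\<^esub>"
proof -
  have "\<phi> (\<zero>\<^bsub>K\<^esub> \<odot>\<^bsub>V\<^esub> \<zero>\<^bsub>V\<^esub>) = \<zero>\<^bsub>K\<^esub> \<otimes>\<^bsub>K\<^esub> \<phi> \<zero>\<^bsub>V\<^esub>"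
    by (rule lin_formD(3)[OF assms]) auto
  then show ?thesis
    using lin_formD(1)[OF assms, of "\<zero>\<^bsub>V\<^esub>"] by simp
qed

lemma lin_form_uminus:
  assumes "lin_form \<phi>" "x \<in> carrier V"
  shows "\<phi> (\<ominus>\<^bsub>V\<^esub> x) = \<ominus>\<^bsub>K\<^esub> \<phi> x"
proof -
  have x: "\<phi> x \<in> carrier K" "\<phi> (\<ominus>\<^bsub>V\<^esub> x) \<in> carrier K"
    using lin_formD(1)[OF assms(1)] assms(2) by auto
  have "\<phi> (\<ominus>\<^bsub>V\<^esub> x) \<oplus>\<^bsub>K\<^esub> \<phi> x = \<zero>\<^bsub>K\<^esub>"
    using lin_formD(2)[OF assms(1), of "\<ominus>\<^bsub>V\<^esub> x" x] assms lin_form_zero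
    by (simp add: M.l_neg)
  then show ?thesis using x by (metis R.minus_equality)
qed

lemma lin_form_minus:
  assumes "lin_form \<phi>" "x \<in> carrier V" "y \<in> carrier V"
  shows "\<phi> (x \<ominus>\<^bsub>V\<^esub> y) = \<phi> x \<ominus>\<^bsub>K\<^esub> \<phi> y"
  using assms by (simp add: a_minus_def lin_formD(2) lin_form_uminus)

lemma lin_form_finsum:
  assumes "lin_form \<phi>" "finite A" "f \<in> A \<rightarrow> carrier V"
  shows "\<phi> (finsum V f A) = finsum K (\<lambda>i. \<phi> (f i)) A"
  using assms(2,3)
proof (induction A)
  case empty
  then show ?case by (simp add: lin_form_zero[OF assms(1)])
next
  case (insert a A)
  then have "finsum V f (insert a A) = f a \<oplus>\<^bsub>V\<^esub> finsum V f A"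
    by (intro M.finsum_insert) auto
  moreover have "finsum K (\<lambda>i. \<phi> (f i)) (insert a A) = \<phi> (f a) \<oplus>\<^bsub>K\<^esub> finsum K (\<lambda>i. \<phi> (f i)) A"
    using insert by (intro R.finsum_insert) (auto intro!: lin_formD(1)[OF assms(1)])
  ultimately show ?case
    using insert lin_formD(2)[OF assms(1), of "f a" "finsum V f A"] by auto
qed

lemma submodule_finsum:
  assumes "submodule K N V" "finite A" "f \<in> A \<rightarrow> N"
  shows "finsum V f A \<in> N"
  using assms(2,3)
proof (induction A)
  case empty
  then show ?case using submodule.zero_closed[OF assms(1)] by simp
next
  case (insert a A)
  have sub: "N \<subseteq> carrier V" by (rule submodule.subset[OF assms(1)])
  have "finsum V f (insert a A) = f a \<oplus>\<^bsub>V\<^esub> finsum V f A"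
    using insert sub by (intro M.finsum_insert) auto
  then show ?case using insert submodule.m_closed[OF assms(1)] by auto
qed

text \<open>The vectors satisfying \<open>P\<close> form a submodule, and the span lies in every
  submodule containing \<open>S\<close>. Closure properties of cell spans reduce in this way to
  single basis elements.\<close>

lemma span_induct [consumes 2, case_names zero base add smult]:
  assumes "v \<in> span S" "S \<subseteq> carrier V"
    and "P \<zero>\<^bsub>V\<^esub>" "\<And>s. s \<in> S \<Longrightarrow> P s"
    and "\<And>x y. x \<in> carrier V \<Longrightarrow> y \<in> carrier V \<Longrightarrow> P x \<Longrightarrow> P y \<Longrightarrow> P (x \<oplus>\<^bsub>V\<^esub> y)"
    and "\<And>c x. c \<in> carrier K \<Longrightarrow> x \<in> carrier V \<Longrightarrow> P x \<Longrightarrow> P (c \<odot>\<^bsub>V\<^esub> x)"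
  shows "P v"
proof -
  have "submodule K {x \<in> carrier V. P x} V"
    using assms by unfold_locales auto
  from span_is_subset[OF _ this, of S] show ?thesis using assms by auto
qed

text \<open>Unique coefficients depend linearly on the vector, which yields the dual basis.\<close>

lemma finite_basis_coordinates:
  assumes "finite B" "basis B"
  shows "\<exists>\<phi>. (\<forall>b\<in>B. lin_form (\<phi> b)) \<and>
     (\<forall>b\<in>B. \<forall>c\<in>B. \<phi> b c = (if b = c then \<one>\<^bsub>K\<^esub> else \<zero>\<^bsub>K\<^esub>)) \<and>
     (\<forall>v\<in>carrier V. v = (\<Oplus>\<^bsub>V\<^esub>b\<in>B. \<phi> b v \<odot>\<^bsub>V\<^esub> b))"
proof -
  have Bc: "B \<subseteq> carrier V" using assms by (auto simp: basis_def)
  have ex1: "\<exists>! a. a \<in> B \<rightarrow>\<^sub>E carrier K \<and> lincomb a B = v" if "v \<in> carrier V" for v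
    using basis_criterion[OF assms(1) Bc] assms(2) that by blast
  define f where "f v = (THE a. a \<in> B \<rightarrow>\<^sub>E carrier K \<and> lincomb a B = v)" for v
  have f: "f v \<in> B \<rightarrow>\<^sub>E carrier K" "lincomb (f v) B = v" if "v \<in> carrier V" for v
    using theI'[OF ex1[OF that]] unfolding f_def by auto
  have funi: "f v b = a b" if "a \<in> B \<rightarrow> carrier K" "lincomb a B = v" "b \<in> B" for a v b
  proof -
    have v: "v \<in> carrier V" using that Bc by auto
    \<comment> \<open>Uniqueness is stated for extensional coefficient functions, hence the
      restriction to \<open>B\<close>.\<close>
    have "restrict a B \<in> B \<rightarrow>\<^sub>E carrier K" using that by auto
    moreover have "lincomb (restrict a B) B = v"
      unfolding that(2)[symmetric] using Bc that(1) by (intro lincomb_cong) auto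
    ultimately have "f v = restrict a B" using ex1[OF v] f[OF v] by blast
    then show ?thesis using that by simp
  qed
  have fc: "f v \<in> B \<rightarrow> carrier K" if "v \<in> carrier V" for v using f(1)[OF that] by auto
  have add: "f (x \<oplus>\<^bsub>V\<^esub> y) b = f x b \<oplus>\<^bsub>K\<^esub> f y b" if "x \<in> carrier V" "y \<in> carrier V" "b \<in> B" for x y b
  proof -
    have l: "lincomb (\<lambda>v. f x v \<oplus>\<^bsub>K\<^esub> f y v) B = x \<oplus>\<^bsub>V\<^esub> y"
      using lincomb_sum[OF assms(1) Bc fc fc] f that by simp
    have h: "(\<lambda>v. f x v \<oplus>\<^bsub>K\<^esub> f y v) \<in> B \<rightarrow> carrier K"
      using fc[OF that(1)] fc[OF that(2)] by (auto simp: Pi_iff)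
    show ?thesis using funi[OF h l that(3)] .
  qed
  have smult: "f (c \<odot>\<^bsub>V\<^esub> x) b = c \<otimes>\<^bsub>K\<^esub> f x b" if "x \<in> carrier V" "c \<in> carrier K" "b \<in> B" for x c b
  proof -
    have l: "lincomb (\<lambda>v. c \<otimes>\<^bsub>K\<^esub> f x v) B = c \<odot>\<^bsub>V\<^esub> x"
      using lincomb_smult[OF Bc fc] f that by simp
    have h: "(\<lambda>v. c \<otimes>\<^bsub>K\<^esub> f x v) \<in> B \<rightarrow> carrier K"
      using fc[OF that(1)] that(2) by (auto simp: Pi_iff)
    show ?thesis using funi[OF h l that(3)] .
  qed
  have delta: "f c b = (if b = c then \<one>\<^bsub>K\<^esub> else \<zero>\<^bsub>K\<^esub>)" if "b \<in> B" "c \<in> B" for b c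
  proof (rule funi)
    have "lincomb (\<lambda>b. if b = c then \<one>\<^bsub>K\<^esub> else \<zero>\<^bsub>K\<^esub>) B
        = (\<Oplus>\<^bsub>V\<^esub>b\<in>B. if c = b then b else \<zero>\<^bsub>V\<^esub>)"
      unfolding lincomb_def using Bc by (intro M.finsum_cong') auto
    also have "\<dots> = c"
      using Bc that assms(1) by (subst M.finsum_singleton[where f = "\<lambda>b. b"]) auto
    finally show "lincomb (\<lambda>b. if b = c then \<one>\<^bsub>K\<^esub> else \<zero>\<^bsub>K\<^esub>) B = c" .
  qed (use that in auto)
  have "lin_form (\<lambda>v. f v b)" if "b \<in> B" for b
    unfolding lin_form_def using fc that add[OF _ _ that] smult[OF _ _ that] by blast
  moreover have "v = (\<Oplus>\<^bsub>V\<^esub>b\<in>B. f v b \<odot>\<^bsub>V\<^esub> b)" if "v \<in> carrier V" for v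
    using f(2)[OF that] by (simp add: lincomb_def)
  ultimately show ?thesis
    using delta by (intro exI[of _ "\<lambda>b v. f v b"]) blast
qed

end

section \<open>Coordinates with respect to a cell basis\<close>

text \<open>Finite dimension makes the cell basis finite, so coordinates are finite sums. Only
  finitely many cells are then non-empty, although \<open>X\<close> itself may be infinite.\<close>

locale finite_relative_cell_datum = relative_cell_datum K R X M C star E leq eps
  for K :: "('k, 'm) ring_scheme" and R :: "('k, 'a, 'n) module_scheme" (structure)
    and X :: "'x set" and M :: "'x \<Rightarrow> 's set" and C :: "'x \<Rightarrow> 's \<Rightarrow> 's \<Rightarrow> 'a"
    and star :: "'a \<Rightarrow> 'a" and E :: "'a set" and leq :: "'a \<Rightarrow> ('x \<times> 'x) set"
    and eps :: "'x \<Rightarrow> 's \<Rightarrow> 'a" +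
  assumes fin_dim: "vectorspace.fin_dim K R"
begin

definition Cidx :: "('x \<times> 's \<times> 's) set" where
  "Cidx = (SIGMA \<nu>:X. M \<nu> \<times> M \<nu>)"

definition Cof :: "'x \<times> 's \<times> 's \<Rightarrow> 'a" where
  "Cof = (\<lambda>(\<nu>, S, T). C \<nu> S T)"

lemma Cof_simp [simp]: "Cof (\<nu>, S, T) = C \<nu> S T"
  by (simp add: Cof_def)

lemma Cidx_iff [simp]: "(\<nu>, S, T) \<in> Cidx \<longleftrightarrow> \<nu> \<in> X \<and> S \<in> M \<nu> \<and> T \<in> M \<nu>"
  by (auto simp: Cidx_def)

lemma inj_Cof: "inj_on Cof Cidx"
  using inj_C by (simp add: Cof_def Cidx_def)

lemma basis_Cof: "basis (Cof ` Cidx)"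
  using basis_C by (simp add: Cof_def Cidx_def)

lemma Cof_closed: "Cof ` Cidx \<subseteq> carrier R"
  using basis_Cof by (simp add: basis_def)

lemma C_closed [simp]: "\<lbrakk>\<nu> \<in> X; S \<in> M \<nu>; T \<in> M \<nu>\<rbrakk> \<Longrightarrow> C \<nu> S T \<in> carrier R"
  using Cof_closed Cof_simp[of \<nu> S T] by (metis Cidx_iff image_subset_iff)

lemma finite_Cidx: "finite Cidx"
  using fin_dim_li_fin[OF fin_dim, of "Cof ` Cidx"] basis_Cof inj_Cof
  by (simp add: basis_def finite_image_iff)

lemma cell_coordinates:
  "\<exists>\<phi>. (\<forall>b\<in>Cidx. lin_form (\<phi> b)) \<and>
     (\<forall>b\<in>Cidx. \<forall>c\<in>Cidx. \<phi> b (Cof c) = (if b = c then \<one>\<^bsub>K\<^esub> else \<zero>\<^bsub>K\<^esub>)) \<and>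
     (\<forall>v\<in>carrier R. v = (\<Oplus>b\<in>Cidx. \<phi> b v \<odot> Cof b))"
proof -
  obtain \<phi> where \<phi>: "\<forall>b\<in>Cof ` Cidx. lin_form (\<phi> b)"
     "\<forall>b\<in>Cof ` Cidx. \<forall>c\<in>Cof ` Cidx. \<phi> b c = (if b = c then \<one>\<^bsub>K\<^esub> else \<zero>\<^bsub>K\<^esub>)"
     "\<forall>v\<in>carrier R. v = (\<Oplus>b\<in>Cof ` Cidx. \<phi> b v \<odot> b)"
    using finite_basis_coordinates[OF _ basis_Cof] finite_Cidx by auto
  have "v = (\<Oplus>b\<in>Cidx. \<phi> (Cof b) v \<odot> Cof b)" if "v \<in> carrier R" for v
  proof -
    have "(\<lambda>b. \<phi> b v \<odot> b) \<in> Cof ` Cidx \<rightarrow> carrier R"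
      using \<phi>(1) Cof_closed lin_formD(1) that by auto
    with \<phi>(3) that show ?thesis
      using M.finsum_reindex[OF _ inj_Cof, of "\<lambda>b. \<phi> b v \<odot> b"] by simp
  qed
  with \<phi> inj_Cof show ?thesis
    by (intro exI[of _ "\<lambda>b. \<phi> (Cof b)"]) (auto simp: inj_on_eq_iff)
qed

definition ccoord :: "'x \<times> 's \<times> 's \<Rightarrow> 'a \<Rightarrow> 'k" where
  "ccoord = (SOME \<phi>. (\<forall>b\<in>Cidx. lin_form (\<phi> b)) \<and>
     (\<forall>b\<in>Cidx. \<forall>c\<in>Cidx. \<phi> b (Cof c) = (if b = c then \<one>\<^bsub>K\<^esub> else \<zero>\<^bsub>K\<^esub>)) \<and>
     (\<forall>v\<in>carrier R. v = (\<Oplus>b\<in>Cidx. \<phi> b v \<odot> Cof b)))"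

lemma ccoord_lin: "b \<in> Cidx \<Longrightarrow> lin_form (ccoord b)"
  and ccoord_Cof: "\<lbrakk>b \<in> Cidx; c \<in> Cidx\<rbrakk> \<Longrightarrow> ccoord b (Cof c) = (if b = c then \<one>\<^bsub>K\<^esub> else \<zero>\<^bsub>K\<^esub>)"
  and ccoord_expand: "v \<in> carrier R \<Longrightarrow> v = (\<Oplus>b\<in>Cidx. ccoord b v \<odot> Cof b)"
  using someI_ex[OF cell_coordinates] unfolding ccoord_def[symmetric] by auto

lemmas ccoord_closed = lin_formD(1)[OF ccoord_lin]
  and ccoord_add = lin_formD(2)[OF ccoord_lin]
  and ccoord_smult = lin_formD(3)[OF ccoord_lin]
  and ccoord_zero = lin_form_zero[OF ccoord_lin]

abbreviation cspan :: "'x set \<Rightarrow> 'a set" where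
  "cspan \<equiv> cell_span K R M C"

lemma cspan_alt: "Y \<subseteq> X \<Longrightarrow> cspan Y = span (Cof ` {c \<in> Cidx. fst c \<in> Y})"
  unfolding cell_span_def by (rule arg_cong[of _ _ span]) (force simp: image_iff)

lemma cspan_submodule: "Y \<subseteq> X \<Longrightarrow> submodule K (cspan Y) R"
  unfolding cspan_alt by (rule span_is_submodule) (use Cof_closed in auto)

lemma cspan_closed: "Y \<subseteq> X \<Longrightarrow> x \<in> cspan Y \<Longrightarrow> x \<in> carrier R"
  using submodule.subset[OF cspan_submodule] by auto

lemma cspan_zero: "Y \<subseteq> X \<Longrightarrow> \<zero> \<in> cspan Y"
  and cspan_add: "\<lbrakk>Y \<subseteq> X; x \<in> cspan Y; y \<in> cspan Y\<rbrakk> \<Longrightarrow> x \<oplus> y \<in> cspan Y"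
  and cspan_smult: "\<lbrakk>Y \<subseteq> X; k \<in> carrier K; x \<in> cspan Y\<rbrakk> \<Longrightarrow> k \<odot> x \<in> cspan Y"
  using submodule.zero_closed[OF cspan_submodule] submodule.m_closed[OF cspan_submodule]
    submodule.smult_closed[OF cspan_submodule] by auto

lemma C_in_cspan: "\<lbrakk>Y \<subseteq> X; \<mu> \<in> Y; S \<in> M \<mu>; T \<in> M \<mu>\<rbrakk> \<Longrightarrow> C \<mu> S T \<in> cspan Y"
  unfolding cspan_alt using in_own_span[of "Cof ` {c \<in> Cidx. fst c \<in> Y}"] Cof_closed
  by (force simp: image_subset_iff)

lemma cspan_induct [consumes 2, case_names zero base add smult]:
  assumes "x \<in> cspan Y" "Y \<subseteq> X"
    and "P \<zero>" "\<And>\<mu> S T. \<mu> \<in> Y \<Longrightarrow> \<mu> \<in> X \<Longrightarrow> S \<in> M \<mu> \<Longrightarrow> T \<in> M \<mu> \<Longrightarrow> P (C \<mu> S T)"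
    and "\<And>x y. x \<in> carrier R \<Longrightarrow> y \<in> carrier R \<Longrightarrow> P x \<Longrightarrow> P y \<Longrightarrow> P (x \<oplus> y)"
    and "\<And>c x. c \<in> carrier K \<Longrightarrow> x \<in> carrier R \<Longrightarrow> P x \<Longrightarrow> P (c \<odot> x)"
  shows "P x"
proof -
  have "Cof ` {c \<in> Cidx. fst c \<in> Y} \<subseteq> carrier R" using Cof_closed by auto
  with assms(1) show ?thesis unfolding cspan_alt[OF assms(2)]
    by (induction rule: span_induct) (use assms in \<open>auto\<close>)
qed

lemma cspan_mono: "Y \<subseteq> Z \<Longrightarrow> cspan Y \<subseteq> cspan Z"
  unfolding cell_span_def by (rule span_is_monotone) auto

lemma cspan_all: "cspan X = carrier R"
proof -
  have "{c \<in> Cidx. fst c \<in> X} = Cidx" by auto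
  then show ?thesis using basis_Cof by (simp add: cspan_alt basis_def)
qed

lemma ccoord_cspan:
  assumes "Y \<subseteq> X" "x \<in> cspan Y" "c \<in> Cidx" "fst c \<notin> Y"
  shows "ccoord c x = \<zero>\<^bsub>K\<^esub>"
  using assms(2,1)
proof (induction rule: cspan_induct)
  case (base \<mu> S T)
  then have "c \<noteq> (\<mu>, S, T)" using assms by auto
  then show ?case using ccoord_Cof[OF assms(3), of "(\<mu>, S, T)"] base by simp
qed (use assms in \<open>auto simp: ccoord_zero ccoord_add ccoord_smult\<close>)

lemma in_cspan_iff:
  assumes "Y \<subseteq> X" "x \<in> carrier R"
  shows "x \<in> cspan Y \<longleftrightarrow> (\<forall>c\<in>Cidx. fst c \<notin> Y \<longrightarrow> ccoord c x = \<zero>\<^bsub>K\<^esub>)"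
proof
  assume *: "\<forall>c\<in>Cidx. fst c \<notin> Y \<longrightarrow> ccoord c x = \<zero>\<^bsub>K\<^esub>"
  have "(\<Oplus>b\<in>Cidx. ccoord b x \<odot> Cof b) \<in> cspan Y"
  proof (rule submodule_finsum[OF cspan_submodule[OF assms(1)] finite_Cidx], intro funcsetI)
    fix b assume b: "b \<in> Cidx"
    obtain \<mu> S T where [simp]: "b = (\<mu>, S, T)" by (cases b)
    show "ccoord b x \<odot> Cof b \<in> cspan Y"
    proof (cases "\<mu> \<in> Y")
      case True
      then show ?thesis
        using b C_in_cspan[OF assms(1)] cspan_smult[OF assms(1)] ccoord_closed[OF b assms(2)] by simp
    next
      case False
      then have "ccoord b x = \<zero>\<^bsub>K\<^esub>" using * b by auto
      then show ?thesis using b cspan_zero[OF assms(1)] by (simp add: smult_l_null)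
    qed
  qed
  then show "x \<in> cspan Y" using ccoord_expand[OF assms(2)] by simp
qed (use ccoord_cspan[OF assms(1)] in auto)

end


section \<open>Ideals spanned by cells\<close>

context finite_relative_cell_datum
begin

lemma star_hom: "star \<in> LinearCombinations.module_hom K R R"
  and star_mult: "\<lbrakk>x \<in> carrier R; y \<in> carrier R\<rbrakk> \<Longrightarrow> star (x \<otimes> y) = star y \<otimes> star x"
  and star_star [simp]: "x \<in> carrier R \<Longrightarrow> star (star x) = x"
  using anti_involution_star by (auto simp: anti_involution_def)

lemma star_closed [simp]: "x \<in> carrier R \<Longrightarrow> star x \<in> carrier R"
  using LinearCombinations.module_hom_closed[OF star_hom] by auto

lemma star_add: "\<lbrakk>x \<in> carrier R; y \<in> carrier R\<rbrakk> \<Longrightarrow> star (x \<oplus> y) = star x \<oplus> star y"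
  and star_smult: "\<lbrakk>k \<in> carrier K; x \<in> carrier R\<rbrakk> \<Longrightarrow> star (k \<odot> x) = k \<odot> star x"
  using LinearCombinations.module_hom_add[OF star_hom] LinearCombinations.module_hom_smult[OF star_hom] by auto

lemma star_zero [simp]: "star \<zero> = \<zero>"
  using star_smult[of "\<zero>\<^bsub>K\<^esub>" "\<zero>"] by (simp add: smult_l_null)

lemma star_one [simp]: "star \<one> = \<one>"
proof -
  have "star (star \<one> \<otimes> \<one>) = star \<one> \<otimes> star (star \<one>)"
    by (rule star_mult) auto
  then show ?thesis by simp
qed

lemma E_carrier [simp]: "\<epsilon> \<in> E \<Longrightarrow> \<epsilon> \<in> carrier R"
  using E_closed by auto

text \<open>Mirror image of \<open>E_C\<close>: the anti-involution fixes the idempotents of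
  \<open>E\<close> and exchanges the two indices of a cell element.\<close>

lemma C_E:
  assumes "\<nu> \<in> X" "S \<in> M \<nu>" "T \<in> M \<nu>" "\<epsilon> \<in> E"
  shows "C \<nu> S T \<otimes> \<epsilon> = (if eps \<nu> T = \<epsilon> then C \<nu> S T else \<zero>)"
proof -
  have "C \<nu> S T \<otimes> \<epsilon> = star (\<epsilon> \<otimes> C \<nu> T S)"
    using assms by (simp add: star_mult star_C star_E)
  also have "\<dots> = (if eps \<nu> T = \<epsilon> then C \<nu> S T else \<zero>)"
    using assms by (simp add: E_C star_C)
  finally show ?thesis .
qed

lemma leq_in_X: "\<lbrakk>\<epsilon> \<in> E; (\<mu>, \<nu>) \<in> leq \<epsilon>\<rbrakk> \<Longrightarrow> \<mu> \<in> X \<and> \<nu> \<in> X"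
  using order_leq[of \<epsilon>] by (auto simp: partial_order_on_def preorder_on_def refl_on_def)

lemma leq_trans: "\<lbrakk>\<epsilon> \<in> E; (\<mu>, \<nu>) \<in> leq \<epsilon>; (\<nu>, \<kappa>) \<in> leq \<epsilon>\<rbrakk> \<Longrightarrow> (\<mu>, \<kappa>) \<in> leq \<epsilon>"
  and leq_antisym: "\<lbrakk>\<epsilon> \<in> E; (\<mu>, \<nu>) \<in> leq \<epsilon>; (\<nu>, \<mu>) \<in> leq \<epsilon>\<rbrakk> \<Longrightarrow> \<mu> = \<nu>"
  using order_leq[of \<epsilon>]
  by (auto simp: partial_order_on_def preorder_on_def refl_on_def trans_def antisym_def)

definition below :: "'a \<Rightarrow> 'x \<Rightarrow> 'x set" where
  "below \<epsilon> \<nu> = {\<mu>. (\<mu>, \<nu>) \<in> leq \<epsilon> \<and> \<mu> \<noteq> \<nu>}"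

abbreviation low :: "'a \<Rightarrow> 'x \<Rightarrow> 'a set" where
  "low \<epsilon> \<nu> \<equiv> cspan (below \<epsilon> \<nu>)"

lemma below_subset: "\<epsilon> \<in> E \<Longrightarrow> below \<epsilon> \<nu> \<subseteq> X"
  using leq_in_X by (auto simp: below_def)

lemma upto_subset: "\<epsilon> \<in> E \<Longrightarrow> {\<mu>. (\<mu>, \<nu>) \<in> leq \<epsilon>} \<subseteq> X"
  using leq_in_X by auto

lemma upto_subset_below: "\<lbrakk>\<epsilon> \<in> E; \<mu> \<in> below \<epsilon> \<nu>\<rbrakk> \<Longrightarrow> {\<kappa>. (\<kappa>, \<mu>) \<in> leq \<epsilon>} \<subseteq> below \<epsilon> \<nu>"
  using leq_trans leq_antisym unfolding below_def by blast

lemma below_mono: "\<lbrakk>\<epsilon> \<in> E; \<mu> \<in> below \<epsilon> \<nu>\<rbrakk> \<Longrightarrow> below \<epsilon> \<mu> \<subseteq> below \<epsilon> \<nu>"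
  using upto_subset_below[of \<epsilon> \<mu> \<nu>] by (auto simp: below_def)

lemma star_cspan:
  assumes "Y \<subseteq> X" "x \<in> cspan Y"
  shows "star x \<in> cspan Y"
proof -
  have "x \<in> carrier R \<and> star x \<in> cspan Y"
    using assms(2,1)
  proof (induction rule: cspan_induct)
    case zero
    then show ?case using cspan_zero[OF assms(1)] by simp
  next
    case (base \<mu> S T)
    then show ?case using C_in_cspan[OF assms(1)] by (simp add: star_C)
  next
    case (add x y)
    then show ?case using cspan_add[OF assms(1)] by (simp add: star_add)
  next
    case (smult c x)
    then show ?case using cspan_smult[OF assms(1)] by (simp add: star_smult)
  qed
  then show ?thesis by simp
qed

lemma cspan_mult_E:
  assumes "Y \<subseteq> X" "x \<in> cspan Y" "\<epsilon> \<in> E"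
  shows "x \<otimes> \<epsilon> \<in> cspan Y"
  using assms(2,1)
proof (induction rule: cspan_induct)
  case zero
  then show ?case using cspan_zero[OF assms(1)] assms by simp
next
  case (base \<mu> S T)
  then show ?case using C_in_cspan[OF assms(1)] cspan_zero[OF assms(1)] assms by (simp add: C_E)
next
  case (add x y)
  then show ?case using cspan_add[OF assms(1)] assms by (simp add: l_distr)
next
  case (smult c x)
  then show ?case using cspan_smult[OF assms(1)] assms by (simp add: smult_mult_left)
qed

text \<open>Membership in \<epsilon>R\<epsilon>. By \<open>E_corner\<close> such elements act from
  the left compatibly with the order of \<epsilon>, whatever the idempotent of the column.\<close>

definition corner :: "'a \<Rightarrow> 'a \<Rightarrow> bool" where
  "corner \<epsilon> a \<longleftrightarrow> a \<in> carrier R \<and> \<epsilon> \<otimes> a = a \<and> a \<otimes> \<epsilon> = a"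

lemma cornerD:
  assumes "corner \<epsilon> a"
  shows "a \<in> carrier R" "\<epsilon> \<otimes> a = a" "a \<otimes> \<epsilon> = a"
  using assms by (auto simp: corner_def)

lemma corner_star: "\<lbrakk>\<epsilon> \<in> E; corner \<epsilon> a\<rbrakk> \<Longrightarrow> corner \<epsilon> (star a)"
  unfolding corner_def by (metis E_carrier star_E star_closed star_mult)

lemma corner_C_upto:
  assumes "\<nu> \<in> X" "S \<in> M \<nu>" "T \<in> M \<nu>" "\<epsilon> \<in> E" "corner \<epsilon> a"
  shows "a \<otimes> C \<nu> S T \<in> cspan {\<mu>. (\<mu>, \<nu>) \<in> leq \<epsilon>}"
proof -
  have "\<epsilon> \<otimes> a \<otimes> \<epsilon> = a" using cornerD[OF assms(5)] by simp
  then show ?thesis using E_corner[OF assms(1-4) cornerD(1)[OF assms(5)]] by simp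
qed

text \<open>A cell that is at most \<open>\<mu>\<close>, with \<open>\<mu>\<close> strictly below
  \<open>\<nu>\<close>, is again strictly below \<open>\<nu>\<close>; so the bound of
  \<open>E_corner\<close> never reaches back up to \<open>\<nu>\<close>.\<close>

lemma corner_low:
  assumes "\<epsilon> \<in> E" "corner \<epsilon> a" "x \<in> low \<epsilon> \<nu>"
  shows "a \<otimes> x \<in> low \<epsilon> \<nu>"
  using assms(3) below_subset[OF assms(1)]
proof (induction rule: cspan_induct)
  case zero
  then show ?case using cspan_zero[OF below_subset[OF assms(1)]] assms by (simp add: corner_def)
next
  case (base \<mu> S T)
  then show ?case using corner_C_upto[OF _ _ _ assms(1,2)]
      cspan_mono[OF upto_subset_below[OF assms(1) base(1)]] by auto
next
  case (add x y)
  then show ?case using cspan_add[OF below_subset[OF assms(1)]] assms by (simp add: r_distr corner_def)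
next
  case (smult c x)
  then show ?case using cspan_smult[OF below_subset[OF assms(1)]] assms
    by (simp add: smult_mult_right corner_def)
qed

lemma low_corner:
  assumes "\<epsilon> \<in> E" "corner \<epsilon> a" "x \<in> low \<epsilon> \<nu>"
  shows "x \<otimes> a \<in> low \<epsilon> \<nu>"
proof -
  have x: "x \<in> carrier R" "a \<in> carrier R"
    using cspan_closed[OF below_subset[OF assms(1)] assms(3)] assms(2) by (auto simp: corner_def)
  have "star (star a \<otimes> star x) \<in> low \<epsilon> \<nu>"
    using assms by (intro star_cspan below_subset corner_low corner_star) auto
  then show ?thesis using x by (simp add: star_mult)
qed

lemma ccoord_C:
  assumes "b \<in> Cidx" "\<nu> \<in> X" "S \<in> M \<nu>" "T \<in> M \<nu>"
  shows "ccoord b (C \<nu> S T) = (if b = (\<nu>, S, T) then \<one>\<^bsub>K\<^esub> else \<zero>\<^bsub>K\<^esub>)"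
  using ccoord_Cof[of b "(\<nu>, S, T)"] assms by simp

lemma ccoord_star:
  assumes "(\<nu>, S, T) \<in> Cidx" "x \<in> carrier R"
  shows "ccoord (\<nu>, S, T) (star x) = ccoord (\<nu>, T, S) x"
proof -
  have "x \<in> cspan X" using assms(2) cspan_all by simp
  then show ?thesis using subset_refl[of X]
  proof (induction rule: cspan_induct)
    case zero
    then show ?case using assms by (simp add: ccoord_zero)
  next
    case (base \<mu> S T)
    then show ?case using assms by (auto simp: star_C ccoord_C)
  next
    case (add x y)
    then show ?case using assms by (simp add: star_add ccoord_add)
  next
    case (smult c x)
    then show ?case using assms by (simp add: star_smult ccoord_smult)
  qed
qed

lemma row_closed:
  assumes "\<nu> \<in> X" "T \<in> M \<nu>" "r \<in> M \<nu> \<rightarrow> carrier K"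
  shows "(\<Oplus>S'\<in>M \<nu>. r S' \<odot> C \<nu> S' T) \<in> carrier R"
  using assms by (intro M.finsum_closed) auto

lemma ccoord_row:
  assumes "\<nu> \<in> X" "T \<in> M \<nu>" "r \<in> M \<nu> \<rightarrow> carrier K" "S \<in> M \<nu>" "T' \<in> M \<nu>"
  shows "ccoord (\<nu>, S, T') (\<Oplus>S'\<in>M \<nu>. r S' \<odot> C \<nu> S' T) = (if T' = T then r S else \<zero>\<^bsub>K\<^esub>)"
proof -
  have "ccoord (\<nu>, S, T') (\<Oplus>S'\<in>M \<nu>. r S' \<odot> C \<nu> S' T)
      = (\<Oplus>\<^bsub>K\<^esub>S'\<in>M \<nu>. ccoord (\<nu>, S, T') (r S' \<odot> C \<nu> S' T))"
    using assms by (intro lin_form_finsum ccoord_lin finite_M) auto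
  also have "\<dots> = (\<Oplus>\<^bsub>K\<^esub>S'\<in>M \<nu>. if S = S' then (if T' = T then r S' else \<zero>\<^bsub>K\<^esub>) else \<zero>\<^bsub>K\<^esub>)"
    using assms by (intro R.finsum_cong') (auto simp: ccoord_smult ccoord_C Pi_iff)
  also have "\<dots> = (if T' = T then r S else \<zero>\<^bsub>K\<^esub>)"
    using assms finite_M by (subst R.finsum_singleton[where f = "\<lambda>S'. if T' = T then r S' else \<zero>\<^bsub>K\<^esub>"]) auto
  finally show ?thesis .
qed

text \<open>The matrix of \<open>a\<close> acting on the cell module of \<open>\<nu>\<close>.\<close>

definition act :: "'a \<Rightarrow> 'x \<Rightarrow> 's \<Rightarrow> 's \<Rightarrow> 'k" where
  "act a \<nu> S' S = ccoord (\<nu>, S', S) (a \<otimes> C \<nu> S S)"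

lemma act_closed:
  "\<lbrakk>\<nu> \<in> X; S \<in> M \<nu>; S' \<in> M \<nu>; a \<in> carrier R\<rbrakk> \<Longrightarrow> act a \<nu> S' S \<in> carrier K"
  unfolding act_def by (rule ccoord_closed) auto

text \<open>The scalars in \<open>mult_C\<close> do not depend on \<open>T\<close>, so they can be
  read off in the column \<open>T = S\<close>, where they are the entries of \<open>act\<close>. The
  factor \<open>eps \<nu> T\<close> on the remainder is absorbed by
  \<open>cspan_mult_E\<close>.\<close>

lemma mult_C_act:
  assumes "\<nu> \<in> X" "S \<in> M \<nu>" "T \<in> M \<nu>" "a \<in> carrier R"
  obtains u where "u \<in> low (eps \<nu> T) \<nu>"
    "a \<otimes> C \<nu> S T = (\<Oplus>S'\<in>M \<nu>. act a \<nu> S' S \<odot> C \<nu> S' T) \<oplus> u"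
proof -
  obtain r where r: "\<forall>S'\<in>M \<nu>. r S' \<in> carrier K"
    and u: "\<forall>T\<in>M \<nu>. \<exists>u\<in>low (eps \<nu> T) \<nu>. a \<otimes> C \<nu> S T = (\<Oplus>S'\<in>M \<nu>. r S' \<odot> C \<nu> S' T) \<oplus> u \<otimes> eps \<nu> T"
    using mult_C[OF assms(1,2,4)] unfolding below_def by blast
  have u': "\<exists>u\<in>low (eps \<nu> T) \<nu>. a \<otimes> C \<nu> S T = (\<Oplus>S'\<in>M \<nu>. r S' \<odot> C \<nu> S' T) \<oplus> u" if "T \<in> M \<nu>" for T
    using u that cspan_mult_E[OF below_subset _ ] eps_in_E[OF assms(1) that] by blast
  have eq: "act a \<nu> S' S = r S'" if "S' \<in> M \<nu>" for S'
  proof -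
    obtain v where v: "v \<in> low (eps \<nu> S) \<nu>" "a \<otimes> C \<nu> S S = (\<Oplus>S'\<in>M \<nu>. r S' \<odot> C \<nu> S' S) \<oplus> v"
      using u' assms by blast
    have sub: "below (eps \<nu> S) \<nu> \<subseteq> X" using below_subset eps_in_E assms by blast
    have "ccoord (\<nu>, S', S) v = \<zero>\<^bsub>K\<^esub>"
      using assms that by (intro ccoord_cspan[OF sub v(1)]) (auto simp: below_def)
    moreover have "ccoord (\<nu>, S', S) ((\<Oplus>S'\<in>M \<nu>. r S' \<odot> C \<nu> S' S) \<oplus> v)
        = ccoord (\<nu>, S', S) (\<Oplus>S'\<in>M \<nu>. r S' \<odot> C \<nu> S' S) \<oplus>\<^bsub>K\<^esub> ccoord (\<nu>, S', S) v"
      using assms that r cspan_closed[OF sub v(1)] by (intro ccoord_add row_closed) auto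
    ultimately show ?thesis
      using r that assms v(2) ccoord_row[of \<nu> S r S' S] by (auto simp: act_def)
  qed
  obtain v where v: "v \<in> low (eps \<nu> T) \<nu>" "a \<otimes> C \<nu> S T = (\<Oplus>S'\<in>M \<nu>. r S' \<odot> C \<nu> S' T) \<oplus> v"
    using u' assms by blast
  have "(\<Oplus>S'\<in>M \<nu>. r S' \<odot> C \<nu> S' T) = (\<Oplus>S'\<in>M \<nu>. act a \<nu> S' S \<odot> C \<nu> S' T)"
    using assms eq r by (intro M.finsum_cong') auto
  then show ?thesis using that[OF v(1)] v(2) by simp
qed

lemma ccoord_mult_C:
  assumes "\<nu> \<in> X" "S \<in> M \<nu>" "T \<in> M \<nu>" "S' \<in> M \<nu>" "T' \<in> M \<nu>" "a \<in> carrier R"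
  shows "ccoord (\<nu>, S', T') (a \<otimes> C \<nu> S T) = (if T' = T then act a \<nu> S' S else \<zero>\<^bsub>K\<^esub>)"
proof -
  obtain u where u: "u \<in> low (eps \<nu> T) \<nu>"
    "a \<otimes> C \<nu> S T = (\<Oplus>S'\<in>M \<nu>. act a \<nu> S' S \<odot> C \<nu> S' T) \<oplus> u"
    using mult_C_act[OF assms(1-3,6)] .
  have sub: "below (eps \<nu> T) \<nu> \<subseteq> X" using below_subset eps_in_E assms by blast
  have "ccoord (\<nu>, S', T') u = \<zero>\<^bsub>K\<^esub>"
    using assms by (intro ccoord_cspan[OF sub u(1)]) (auto simp: below_def)
  moreover have "ccoord (\<nu>, S', T') ((\<Oplus>S'\<in>M \<nu>. act a \<nu> S' S \<odot> C \<nu> S' T) \<oplus> u)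
      = ccoord (\<nu>, S', T') (\<Oplus>S'\<in>M \<nu>. act a \<nu> S' S \<odot> C \<nu> S' T) \<oplus>\<^bsub>K\<^esub> ccoord (\<nu>, S', T') u"
    using assms cspan_closed[OF sub u(1)] by (intro ccoord_add row_closed) (auto simp: act_closed)
  ultimately show ?thesis
    using assms u(2) ccoord_row[of \<nu> T "\<lambda>S'. act a \<nu> S' S" S' T'] by (auto simp: act_closed)
qed

text \<open>The bilinear form of a cell module, twisted by \<open>a\<close>.\<close>

definition form :: "'a \<Rightarrow> 'x \<Rightarrow> 's \<Rightarrow> 's \<Rightarrow> 'k" where
  "form a \<nu> T T' = ccoord (\<nu>, T, T') (C \<nu> T T \<otimes> a \<otimes> C \<nu> T' T')"

lemma form_closed:
  "\<lbrakk>\<nu> \<in> X; T \<in> M \<nu>; T' \<in> M \<nu>; a \<in> carrier R\<rbrakk> \<Longrightarrow> form a \<nu> T T' \<in> carrier K"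
  unfolding form_def by (rule ccoord_closed) auto

text \<open>The Graham-Lehrer argument: computed from the left, the product keeps its last index
  \<open>U\<close> and its coefficients do not depend on it; after applying the anti-involution the
  same holds for the first index \<open>S\<close>. What survives depends only on \<open>T\<close>
  and \<open>T'\<close>, and the choice \<open>S = T\<close> gives \<open>form\<close>.\<close>

lemma act_C_form:
  assumes "\<nu> \<in> X" "S \<in> M \<nu>" "T \<in> M \<nu>" "S' \<in> M \<nu>" "T' \<in> M \<nu>" "a \<in> carrier R"
  shows "act (C \<nu> S T \<otimes> a) \<nu> S' T' = (if S' = S then form a \<nu> T T' else \<zero>\<^bsub>K\<^esub>)"
proof -
  have flip: "ccoord (\<nu>, S', U) (C \<nu> S T \<otimes> a \<otimes> C \<nu> T' U)
      = (if S' = S then act (C \<nu> U T' \<otimes> star a) \<nu> U T else \<zero>\<^bsub>K\<^esub>)"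
    if "S \<in> M \<nu>" "S' \<in> M \<nu>" "U \<in> M \<nu>" for S S' U
  proof -
    have "ccoord (\<nu>, S', U) (C \<nu> S T \<otimes> a \<otimes> C \<nu> T' U)
        = ccoord (\<nu>, U, S') (star (C \<nu> S T \<otimes> a \<otimes> C \<nu> T' U))"
      using that assms by (simp add: ccoord_star)
    also have "star (C \<nu> S T \<otimes> a \<otimes> C \<nu> T' U) = (C \<nu> U T' \<otimes> star a) \<otimes> C \<nu> T S"
      using that assms by (simp add: star_mult star_C m_assoc)
    also have "ccoord (\<nu>, U, S') \<dots> = (if S' = S then act (C \<nu> U T' \<otimes> star a) \<nu> U T else \<zero>\<^bsub>K\<^esub>)"
      using that assms by (simp add: ccoord_mult_C)
    finally show ?thesis .
  qed
  have nonflip: "ccoord (\<nu>, S', U) (C \<nu> S T \<otimes> a \<otimes> C \<nu> T' U) = act (C \<nu> S T \<otimes> a) \<nu> S' T'"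
    if "S \<in> M \<nu>" "S' \<in> M \<nu>" "U \<in> M \<nu>" for S S' U
    using that assms by (simp add: ccoord_mult_C)
  show ?thesis
    using flip[OF assms(2,4,5)] nonflip[OF assms(2,4,5)] flip[OF assms(3,3,5)]
    by (simp add: form_def)
qed

lemma sandwich:
  assumes "\<nu> \<in> X" "S \<in> M \<nu>" "T \<in> M \<nu>" "T' \<in> M \<nu>" "U \<in> M \<nu>" "a \<in> carrier R"
  obtains u where "u \<in> low (eps \<nu> U) \<nu>"
    "C \<nu> S T \<otimes> a \<otimes> C \<nu> T' U = form a \<nu> T T' \<odot> C \<nu> S U \<oplus> u"
proof -
  have "C \<nu> S T \<otimes> a \<in> carrier R" using assms by simp
  then obtain u where u: "u \<in> low (eps \<nu> U) \<nu>" "(C \<nu> S T \<otimes> a) \<otimes> C \<nu> T' U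
      = (\<Oplus>S'\<in>M \<nu>. act (C \<nu> S T \<otimes> a) \<nu> S' T' \<odot> C \<nu> S' U) \<oplus> u"
    using mult_C_act[OF assms(1,4,5)] by blast
  have "(\<Oplus>S'\<in>M \<nu>. act (C \<nu> S T \<otimes> a) \<nu> S' T' \<odot> C \<nu> S' U)
      = (\<Oplus>S'\<in>M \<nu>. if S = S' then form a \<nu> T T' \<odot> C \<nu> S' U else \<zero>)"
    using assms act_C_form by (intro M.finsum_cong') (auto simp: form_closed smult_l_null)
  also have "\<dots> = form a \<nu> T T' \<odot> C \<nu> S U"
    using assms finite_M
    by (subst M.finsum_singleton[where f = "\<lambda>S'. form a \<nu> T T' \<odot> C \<nu> S' U"]) (auto simp: form_closed)
  finally show ?thesis using that[OF u(1)] u(2) by simp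
qed

lemma form_star:
  assumes "\<nu> \<in> X" "T \<in> M \<nu>" "T' \<in> M \<nu>" "a \<in> carrier R"
  shows "form (star a) \<nu> T T' = form a \<nu> T' T"
proof -
  have "star (C \<nu> T T \<otimes> star a \<otimes> C \<nu> T' T') = C \<nu> T' T' \<otimes> a \<otimes> C \<nu> T T"
    using assms by (simp add: star_mult star_C m_assoc)
  then show ?thesis
    using assms ccoord_star[of \<nu> T' T "C \<nu> T T \<otimes> star a \<otimes> C \<nu> T' T'"] by (simp add: form_def)
qed

end


section \<open>Characters and their head cells\<close>

context finite_relative_cell_datum
begin

definition is_char :: "('a \<Rightarrow> 'k) \<Rightarrow> bool" where
  "is_char \<chi> \<longleftrightarrow> lin_form \<chi> \<and> \<chi> \<one> = \<one>\<^bsub>K\<^esub> \<and>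
     (\<forall>x\<in>carrier R. \<forall>y\<in>carrier R. \<chi> (x \<otimes> y) = \<chi> x \<otimes>\<^bsub>K\<^esub> \<chi> y)"

lemma is_charD:
  assumes "is_char \<chi>"
  shows "lin_form \<chi>" "\<chi> \<one> = \<one>\<^bsub>K\<^esub>"
    and "x \<in> carrier R \<Longrightarrow> y \<in> carrier R \<Longrightarrow> \<chi> (x \<otimes> y) = \<chi> x \<otimes>\<^bsub>K\<^esub> \<chi> y"
    and "x \<in> carrier R \<Longrightarrow> \<chi> x \<in> carrier K"
    and "x \<in> carrier R \<Longrightarrow> y \<in> carrier R \<Longrightarrow> \<chi> (x \<oplus> y) = \<chi> x \<oplus>\<^bsub>K\<^esub> \<chi> y"
    and "c \<in> carrier K \<Longrightarrow> x \<in> carrier R \<Longrightarrow> \<chi> (c \<odot> x) = c \<otimes>\<^bsub>K\<^esub> \<chi> x"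
    and "\<chi> \<zero> = \<zero>\<^bsub>K\<^esub>"
  using assms lin_formD lin_form_zero by (auto simp: is_char_def)

lemma K_domain: "domain K"
proof -
  have "field K" by unfold_locales
  then show ?thesis by (rule field.axioms)
qed

lemma K_cancel:
  assumes "a \<in> carrier K" "b \<in> carrier K" "c \<in> carrier K" "c \<noteq> \<zero>\<^bsub>K\<^esub>"
    and "a \<otimes>\<^bsub>K\<^esub> c = b \<otimes>\<^bsub>K\<^esub> c"
  shows "a = b"
  using domain.m_rcancel[OF K_domain assms(4,3,1,2)] assms(5) by simp

lemma char_eq_zero_on_cspan:
  assumes "is_char \<chi>" "Y \<subseteq> X" "x \<in> cspan Y"
    and "\<And>\<mu> S T. \<mu> \<in> Y \<Longrightarrow> S \<in> M \<mu> \<Longrightarrow> T \<in> M \<mu> \<Longrightarrow> \<chi> (C \<mu> S T) = \<zero>\<^bsub>K\<^esub>"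
  shows "\<chi> x = \<zero>\<^bsub>K\<^esub>"
  using assms(3,2)
proof (induction rule: cspan_induct)
  case (add x y)
  then show ?case using is_charD(5)[OF assms(1)] by simp
next
  case (smult c x)
  then show ?case using is_charD(6)[OF assms(1)] by simp
qed (use is_charD(7)[OF assms(1)] assms(4) in auto)

text \<open>Since \<chi>(\<epsilon>) = 1, multiplication by \<epsilon> on either side does not
  change the value of \<chi>, so a cell element seen by \<chi> is not annihilated by \<epsilon>. All
  rows and columns relevant to \<chi> are thus attached to one idempotent.\<close>

lemma char_C_nonzero_eps:
  assumes "is_char \<chi>" "\<epsilon> \<in> E" "\<chi> \<epsilon> = \<one>\<^bsub>K\<^esub>" "\<nu> \<in> X" "S \<in> M \<nu>" "T \<in> M \<nu>"
    and "\<chi> (C \<nu> S T) \<noteq> \<zero>\<^bsub>K\<^esub>"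
  shows "eps \<nu> S = \<epsilon>" "eps \<nu> T = \<epsilon>"
proof -
  have c: "\<chi> (C \<nu> S T) \<in> carrier K" using is_charD(4)[OF assms(1)] assms by simp
  have "\<chi> (\<epsilon> \<otimes> C \<nu> S T) = \<chi> (C \<nu> S T)" "\<chi> (C \<nu> S T \<otimes> \<epsilon>) = \<chi> (C \<nu> S T)"
    using is_charD(3)[OF assms(1)] assms c by simp_all
  then have "\<epsilon> \<otimes> C \<nu> S T \<noteq> \<zero>" "C \<nu> S T \<otimes> \<epsilon> \<noteq> \<zero>"
    using is_charD(7)[OF assms(1)] assms(7) by auto
  then show "eps \<nu> S = \<epsilon>" "eps \<nu> T = \<epsilon>"
    using assms by (auto simp: E_C C_E split: if_splits)
qed

lemma char_some_C_nonzero: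
  assumes "is_char \<chi>"
  obtains \<nu> S T where "\<nu> \<in> X" "S \<in> M \<nu>" "T \<in> M \<nu>" "\<chi> (C \<nu> S T) \<noteq> \<zero>\<^bsub>K\<^esub>"
proof -
  have "\<one> \<in> cspan X" using cspan_all by simp
  moreover have "\<chi> \<one> \<noteq> \<zero>\<^bsub>K\<^esub>" using is_charD(2)[OF assms] by simp
  ultimately show ?thesis using char_eq_zero_on_cspan[OF assms subset_refl] that by blast
qed

text \<open>A cell element with non-zero value absorbs its row idempotent; cancelling that value
  gives \<chi> = 1 on the idempotent.\<close>

lemma char_eps_exists:
  assumes "is_char \<chi>"
  obtains \<epsilon> where "\<epsilon> \<in> E" "\<chi> \<epsilon> = \<one>\<^bsub>K\<^esub>"
proof -
  obtain \<nu> S T where c: "\<nu> \<in> X" "S \<in> M \<nu>" "T \<in> M \<nu>" "\<chi> (C \<nu> S T) \<noteq> \<zero>\<^bsub>K\<^esub>"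
    using char_some_C_nonzero[OF assms] .
  have e: "eps \<nu> S \<in> E" using eps_in_E c by blast
  have "eps \<nu> S \<otimes> C \<nu> S T = C \<nu> S T" using c e by (simp add: E_C)
  then have "\<chi> (eps \<nu> S) \<otimes>\<^bsub>K\<^esub> \<chi> (C \<nu> S T) = \<one>\<^bsub>K\<^esub> \<otimes>\<^bsub>K\<^esub> \<chi> (C \<nu> S T)"
    using is_charD[OF assms] c e by (metis C_closed E_carrier R.l_one)
  then have "\<chi> (eps \<nu> S) = \<one>\<^bsub>K\<^esub>"
    using is_charD(4)[OF assms] c e by (intro K_cancel[of "\<chi> (eps \<nu> S)" "\<one>\<^bsub>K\<^esub>" "\<chi> (C \<nu> S T)"]) auto
  then show ?thesis using that e by blast
qed

lemma finite_cells: "finite {\<nu> \<in> X. M \<nu> \<noteq> {}}"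
proof -
  have "{\<nu> \<in> X. M \<nu> \<noteq> {}} \<subseteq> fst ` Cidx"
  proof
    fix \<nu> assume "\<nu> \<in> {\<nu> \<in> X. M \<nu> \<noteq> {}}"
    then obtain S where "(\<nu>, S, S) \<in> Cidx" by auto
    then show "\<nu> \<in> fst ` Cidx" by (metis fst_conv image_eqI)
  qed
  then show ?thesis using finite_Cidx finite_surj by blast
qed

text \<open>The measure is the number of non-empty cells below: it is finite by
  \<open>finite_cells\<close> and drops strictly on passing to a lower non-empty cell. The full set
  \<open>below\<close> may be infinite.\<close>

lemma minimal_cell:
  assumes "\<epsilon> \<in> E" "P \<nu>" "\<And>\<nu>. P \<nu> \<Longrightarrow> \<nu> \<in> X \<and> M \<nu> \<noteq> {}"
  obtains \<kappa> where "P \<kappa>" "\<And>\<mu>. \<mu> \<in> below \<epsilon> \<kappa> \<Longrightarrow> \<not> P \<mu>"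
proof -
  define f where "f \<kappa> = card (below \<epsilon> \<kappa> \<inter> {\<nu> \<in> X. M \<nu> \<noteq> {}})" for \<kappa>
  obtain \<kappa> where \<kappa>: "P \<kappa>" "\<And>\<mu>. P \<mu> \<Longrightarrow> f \<kappa> \<le> f \<mu>"
    using ex_has_least_nat[of P \<nu> f] assms(2) by blast
  have "\<not> P \<mu>" if \<mu>: "\<mu> \<in> below \<epsilon> \<kappa>" for \<mu>
  proof
    assume "P \<mu>"
    have "\<mu> \<notin> below \<epsilon> \<mu>" by (simp add: below_def)
    then have "below \<epsilon> \<mu> \<inter> {\<nu> \<in> X. M \<nu> \<noteq> {}} \<subset> below \<epsilon> \<kappa> \<inter> {\<nu> \<in> X. M \<nu> \<noteq> {}}"
      using below_mono[OF assms(1) \<mu>] \<mu> assms(3)[OF \<open>P \<mu>\<close>] by blast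
    then have "f \<mu> < f \<kappa>" unfolding f_def using finite_cells by (intro psubset_card_mono) auto
    then show False using \<kappa>(2)[OF \<open>P \<mu>\<close>] by simp
  qed
  then show ?thesis using that \<kappa>(1) by blast
qed

definition head :: "('a \<Rightarrow> 'k) \<Rightarrow> 'a \<Rightarrow> 'x \<Rightarrow> bool" where
  "head \<chi> \<epsilon> \<nu> \<longleftrightarrow> \<epsilon> \<in> E \<and> \<chi> \<epsilon> = \<one>\<^bsub>K\<^esub> \<and> \<nu> \<in> X \<and>
     (\<forall>\<mu>\<in>below \<epsilon> \<nu>. \<forall>S\<in>M \<mu>. \<forall>T\<in>M \<mu>. \<chi> (C \<mu> S T) = \<zero>\<^bsub>K\<^esub>) \<and>
     (\<exists>S\<in>M \<nu>. \<exists>T\<in>M \<nu>. \<chi> (C \<nu> S T) \<noteq> \<zero>\<^bsub>K\<^esub>)"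

lemma head_exists:
  assumes "is_char \<chi>"
  obtains \<epsilon> \<nu> where "head \<chi> \<epsilon> \<nu>"
proof -
  obtain \<epsilon> where e: "\<epsilon> \<in> E" "\<chi> \<epsilon> = \<one>\<^bsub>K\<^esub>" using char_eps_exists[OF assms] .
  obtain \<nu> S T where c: "\<nu> \<in> X" "S \<in> M \<nu>" "T \<in> M \<nu>" "\<chi> (C \<nu> S T) \<noteq> \<zero>\<^bsub>K\<^esub>"
    using char_some_C_nonzero[OF assms] .
  define P where "P \<mu> \<longleftrightarrow> \<mu> \<in> X \<and> (\<exists>S\<in>M \<mu>. \<exists>T\<in>M \<mu>. \<chi> (C \<mu> S T) \<noteq> \<zero>\<^bsub>K\<^esub>)" for \<mu>
  have "P \<nu>" using c by (auto simp: P_def)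
  moreover have "\<And>\<mu>. P \<mu> \<Longrightarrow> \<mu> \<in> X \<and> M \<mu> \<noteq> {}" by (auto simp: P_def)
  ultimately obtain \<kappa> where "P \<kappa>" "\<And>\<mu>. \<mu> \<in> below \<epsilon> \<kappa> \<Longrightarrow> \<not> P \<mu>"
    using minimal_cell[OF e(1)] by blast
  then have "head \<chi> \<epsilon> \<kappa>" using e below_subset[OF e(1)] by (auto simp: head_def P_def)
  then show ?thesis using that by blast
qed

lemma head_low:
  assumes "is_char \<chi>" "head \<chi> \<epsilon> \<nu>" "x \<in> low \<epsilon> \<nu>"
  shows "\<chi> x = \<zero>\<^bsub>K\<^esub>"
proof -
  have "\<epsilon> \<in> E" using assms(2) by (simp add: head_def)
  then show ?thesis
    using assms(2) char_eq_zero_on_cspan[OF assms(1) below_subset assms(3)] by (simp add: head_def)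
qed

text \<open>The remainder in \<open>sandwich\<close> is low for the idempotent of the column
  \<open>U\<close>, while \<chi> is known to vanish on what is low for \<epsilon>. If the two
  idempotents differ, both sides are zero by \<open>char_C_nonzero_eps\<close>.\<close>

lemma head_sandwich:
  assumes "is_char \<chi>" "head \<chi> \<epsilon> \<nu>" "S \<in> M \<nu>" "T \<in> M \<nu>" "T' \<in> M \<nu>" "U \<in> M \<nu>" "a \<in> carrier R"
  shows "\<chi> (C \<nu> S T) \<otimes>\<^bsub>K\<^esub> \<chi> a \<otimes>\<^bsub>K\<^esub> \<chi> (C \<nu> T' U) = form a \<nu> T T' \<otimes>\<^bsub>K\<^esub> \<chi> (C \<nu> S U)"
proof -
  have n: "\<nu> \<in> X" "\<epsilon> \<in> E" "\<chi> \<epsilon> = \<one>\<^bsub>K\<^esub>" using assms by (auto simp: head_def)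
  note ch = is_charD[OF assms(1)]
  show ?thesis
  proof (cases "eps \<nu> U = \<epsilon>")
    case True
    obtain u where u: "u \<in> low (eps \<nu> U) \<nu>"
      "C \<nu> S T \<otimes> a \<otimes> C \<nu> T' U = form a \<nu> T T' \<odot> C \<nu> S U \<oplus> u"
      using sandwich[OF n(1) assms(3-7)] .
    have "u \<in> carrier R" using u(1) cspan_closed[OF below_subset[OF n(2)]] True by blast
    moreover have "\<chi> u = \<zero>\<^bsub>K\<^esub>" using head_low[OF assms(1,2)] u(1) True by simp
    moreover have "\<chi> (C \<nu> S T \<otimes> a \<otimes> C \<nu> T' U) = \<chi> (C \<nu> S T) \<otimes>\<^bsub>K\<^esub> \<chi> a \<otimes>\<^bsub>K\<^esub> \<chi> (C \<nu> T' U)"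
      using assms n ch by simp
    ultimately show ?thesis
      using u(2) assms n ch by (simp add: form_closed)
  next
    case False
    then have "\<chi> (C \<nu> S U) = \<zero>\<^bsub>K\<^esub>" "\<chi> (C \<nu> T' U) = \<zero>\<^bsub>K\<^esub>"
      using char_C_nonzero_eps[OF assms(1) n(2,3,1)] assms by blast+
    then show ?thesis using assms n ch by (simp add: form_closed)
  qed
qed

text \<open>The Gram matrix \<open>\<chi>(C\<^sub>U\<^sub>V)\<close> has rank one and satisfies
  \<open>\<chi>(C\<^sub>S\<^sub>T) \<chi>(C\<^sub>T\<^sub>'\<^sub>U) = form \<one> T T' \<chi>(C\<^sub>S\<^sub>U)\<close> with a symmetric form; this forces both
  matrices to agree and to have a non-zero diagonal entry.\<close>

lemma head_form:
  assumes "is_char \<chi>" "head \<chi> \<epsilon> \<nu>"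
  shows "\<exists>S\<in>M \<nu>. \<chi> (C \<nu> S S) \<noteq> \<zero>\<^bsub>K\<^esub>"
    and "U \<in> M \<nu> \<Longrightarrow> V \<in> M \<nu> \<Longrightarrow> \<chi> (C \<nu> U V) = form \<one> \<nu> U V"
proof -
  define m where "m = (\<lambda>S T. \<chi> (C \<nu> S T))"
  define t where "t = form \<one> \<nu>"
  have n: "\<nu> \<in> X" using assms by (auto simp: head_def)
  note ch = is_charD[OF assms(1)]
  have mc: "m S T \<in> carrier K" if "S \<in> M \<nu>" "T \<in> M \<nu>" for S T
    using that n ch by (simp add: m_def)
  have tc: "t S T \<in> carrier K" if "S \<in> M \<nu>" "T \<in> M \<nu>" for S T
    using that n by (simp add: t_def form_closed)
  have tsym: "t S T = t T S" if "S \<in> M \<nu>" "T \<in> M \<nu>" for S T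
    using form_star[OF n that, of \<one>] by (simp add: t_def)
  have mt: "m S T \<otimes>\<^bsub>K\<^esub> m T' U = t T T' \<otimes>\<^bsub>K\<^esub> m S U"
    if "S \<in> M \<nu>" "T \<in> M \<nu>" "T' \<in> M \<nu>" "U \<in> M \<nu>" for S T T' U
    using head_sandwich[OF assms that, of \<one>] mc[OF that(1,2)] ch by (simp add: t_def m_def)
  obtain U0 V0 where 0: "U0 \<in> M \<nu>" "V0 \<in> M \<nu>" "m U0 V0 \<noteq> \<zero>\<^bsub>K\<^esub>"
    using assms(2) by (auto simp: head_def m_def)
  have "t V0 U0 = m U0 V0"
    using K_cancel[OF tc mc mc 0(3) mt[OF 0(1,2,1,2), symmetric]] 0 by blast
  \<comment> \<open>Symmetry of the form moves the non-zero entry at \<open>(U0, V0)\<close> to the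
    diagonal: the product of the two diagonal entries is its square.\<close>
  then have "m U0 U0 \<otimes>\<^bsub>K\<^esub> m V0 V0 = m U0 V0 \<otimes>\<^bsub>K\<^esub> m U0 V0"
    using mt[OF 0(1,1,2,2)] tsym[OF 0(1,2)] by simp
  moreover have "m U0 V0 \<otimes>\<^bsub>K\<^esub> m U0 V0 \<noteq> \<zero>\<^bsub>K\<^esub>"
    using 0 mc domain.integral[OF K_domain] by blast
  ultimately have d: "m U0 U0 \<noteq> \<zero>\<^bsub>K\<^esub>" using mc 0 by (metis R.l_null)
  then show "\<exists>S\<in>M \<nu>. \<chi> (C \<nu> S S) \<noteq> \<zero>\<^bsub>K\<^esub>" using 0 by (auto simp: m_def)
  fix U V assume UV: "U \<in> M \<nu>" "V \<in> M \<nu>"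
  have t1: "t V U0 = m U0 V" if "V \<in> M \<nu>" for V
    using K_cancel[OF tc mc mc d mt[OF 0(1) that 0(1,1), symmetric]] 0 that by blast
  have t2: "t U0 V = m V U0" if "V \<in> M \<nu>" for V
  proof -
    have "t U0 V \<otimes>\<^bsub>K\<^esub> m U0 U0 = m V U0 \<otimes>\<^bsub>K\<^esub> m U0 U0"
      using mt[OF 0(1,1) that 0(1)] mc[OF 0(1,1)] mc[OF that 0(1)] R.m_comm by simp
    then show ?thesis using K_cancel[OF tc mc mc d] 0 that by blast
  qed
  have sym: "m U0 V = m V U0" if "V \<in> M \<nu>" for V
    using t1[OF that] t2[OF that] tsym[OF 0(1) that] by simp
  have "m U V \<otimes>\<^bsub>K\<^esub> m U0 U0 = m U0 V \<otimes>\<^bsub>K\<^esub> m U U0"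
    using mt[OF UV 0(1,1)] t1[OF UV(2)] by simp
  moreover have "m U0 U \<otimes>\<^bsub>K\<^esub> m V U0 = t U V \<otimes>\<^bsub>K\<^esub> m U0 U0"
    using mt[OF 0(1) UV 0(1)] .
  ultimately have "m U V \<otimes>\<^bsub>K\<^esub> m U0 U0 = t U V \<otimes>\<^bsub>K\<^esub> m U0 U0"
    using sym UV mc 0 R.m_comm by metis
  then show "\<chi> (C \<nu> U V) = form \<one> \<nu> U V"
    using K_cancel[OF mc tc mc d] UV 0 by (simp add: m_def t_def)
qed

text \<open>Up to the non-zero scalar \<open>form \<one> \<nu> S S\<close>, a character is a
  diagonal value of the twisted form. Its invariance under the anti-involution and its dependence on
  the head cell alone are read off from this.\<close>

lemma head_char:
  assumes "is_char \<chi>" "head \<chi> \<epsilon> \<nu>" "S \<in> M \<nu>" "\<chi> (C \<nu> S S) \<noteq> \<zero>\<^bsub>K\<^esub>" "a \<in> carrier R"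
  shows "\<chi> a \<otimes>\<^bsub>K\<^esub> form \<one> \<nu> S S = form a \<nu> S S"
proof -
  have n: "\<nu> \<in> X" using assms by (auto simp: head_def)
  note ch = is_charD[OF assms(1)]
  have c: "\<chi> (C \<nu> S S) \<in> carrier K" "\<chi> a \<in> carrier K" using n assms ch by auto
  have eq: "(\<chi> a \<otimes>\<^bsub>K\<^esub> \<chi> (C \<nu> S S)) \<otimes>\<^bsub>K\<^esub> \<chi> (C \<nu> S S) = form a \<nu> S S \<otimes>\<^bsub>K\<^esub> \<chi> (C \<nu> S S)"
    using head_sandwich[OF assms(1,2,3,3,3,3,5)] c by (simp add: R.m_comm)
  have "\<chi> a \<otimes>\<^bsub>K\<^esub> \<chi> (C \<nu> S S) = form a \<nu> S S"
    by (rule K_cancel[OF R.m_closed[OF c(2,1)] form_closed[OF n assms(3,3,5)] c(1) assms(4) eq])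
  then show ?thesis using head_form(2)[OF assms(1,2,3,3)] by simp
qed

text \<open>By \<open>form_star\<close>, diagonal values of the form do not distinguish
  \<open>a\<close> from \<open>star a\<close>.\<close>

lemma char_star:
  assumes "is_char \<chi>" "a \<in> carrier R"
  shows "\<chi> (star a) = \<chi> a"
proof -
  obtain \<epsilon> \<nu> where h: "head \<chi> \<epsilon> \<nu>" using head_exists[OF assms(1)] .
  obtain S where S: "S \<in> M \<nu>" "\<chi> (C \<nu> S S) \<noteq> \<zero>\<^bsub>K\<^esub>" using head_form(1)[OF assms(1) h] by blast
  have n: "\<nu> \<in> X" using h by (auto simp: head_def)
  note ch = is_charD[OF assms(1)]
  have "\<chi> (star a) \<otimes>\<^bsub>K\<^esub> form \<one> \<nu> S S = \<chi> a \<otimes>\<^bsub>K\<^esub> form \<one> \<nu> S S"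
    using head_char[OF assms(1) h S] assms form_star[OF n S(1,1)] by simp
  then show ?thesis
    using K_cancel[of "\<chi> (star a)" "\<chi> a" "form \<one> \<nu> S S"] assms n S ch
      head_form(2)[OF assms(1) h S(1,1)] by (simp add: form_closed)
qed

text \<open>Both characters take the value \<open>form \<one> \<nu> S S\<close> on
  \<open>C \<nu> S S\<close>, so the same diagonal index \<open>S\<close> computes either of them
  through \<open>head_char\<close>.\<close>

lemma head_determines_char:
  assumes "is_char \<chi>" "is_char \<chi>'" "head \<chi> \<epsilon> \<nu>" "head \<chi>' \<epsilon>' \<nu>" "a \<in> carrier R"
  shows "\<chi> a = \<chi>' a"
proof -
  obtain S where S: "S \<in> M \<nu>" "\<chi> (C \<nu> S S) \<noteq> \<zero>\<^bsub>K\<^esub>" using head_form(1)[OF assms(1,3)] by blast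
  have n: "\<nu> \<in> X" using assms by (auto simp: head_def)
  have f: "form \<one> \<nu> S S \<noteq> \<zero>\<^bsub>K\<^esub>" using head_form(2)[OF assms(1,3) S(1,1)] S by simp
  then have S': "\<chi>' (C \<nu> S S) \<noteq> \<zero>\<^bsub>K\<^esub>" using head_form(2)[OF assms(2,4) S(1,1)] by simp
  have "\<chi> a \<otimes>\<^bsub>K\<^esub> form \<one> \<nu> S S = \<chi>' a \<otimes>\<^bsub>K\<^esub> form \<one> \<nu> S S"
    using head_char[OF assms(1,3) S assms(5)] head_char[OF assms(2,4) S(1) S' assms(5)] by simp
  then show ?thesis
    using K_cancel[of "\<chi> a" "\<chi>' a" "form \<one> \<nu> S S"] f n S assms is_charD(4) by (simp add: form_closed)
qed

end


section \<open>Lifting idempotents\<close>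

lemma (in ring) one_minus_cube:
  assumes t: "t \<in> carrier R"
  shows "\<one> \<ominus> t \<otimes> t \<otimes> t = (\<one> \<ominus> t) \<otimes> (\<one> \<oplus> t \<oplus> t \<otimes> t)"
    and "\<one> \<ominus> t \<otimes> t \<otimes> t = (\<one> \<oplus> t \<oplus> t \<otimes> t) \<otimes> (\<one> \<ominus> t)"
proof -
  have cancel: "(x \<oplus> p) \<ominus> (p \<oplus> q) = x \<ominus> q" if "x \<in> carrier R" "p \<in> carrier R" "q \<in> carrier R" for x p q
    using that by (simp add: minus_eq minus_add a_assoc r_neg2)
  let ?p = "t \<oplus> t \<otimes> t"
  have p: "\<one> \<oplus> t \<oplus> t \<otimes> t = \<one> \<oplus> ?p" "?p \<oplus> t \<otimes> t \<otimes> t = t \<otimes> (\<one> \<oplus> ?p)" "?p \<oplus> t \<otimes> t \<otimes> t = (\<one> \<oplus> ?p) \<otimes> t"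
    using t by (simp_all add: a_assoc r_distr l_distr m_assoc)
  have "(\<one> \<ominus> t) \<otimes> (\<one> \<oplus> ?p) = (\<one> \<oplus> ?p) \<ominus> t \<otimes> (\<one> \<oplus> ?p)"
    using t by (simp add: minus_eq l_distr l_minus)
  then show "\<one> \<ominus> t \<otimes> t \<otimes> t = (\<one> \<ominus> t) \<otimes> (\<one> \<oplus> t \<oplus> t \<otimes> t)"
    unfolding p(1) p(2)[symmetric] using t by (simp only: cancel m_closed a_closed one_closed)
  have "(\<one> \<oplus> ?p) \<otimes> (\<one> \<ominus> t) = (\<one> \<oplus> ?p) \<ominus> (\<one> \<oplus> ?p) \<otimes> t"
    using t by (simp add: minus_eq r_distr r_minus)
  then show "\<one> \<ominus> t \<otimes> t \<otimes> t = (\<one> \<oplus> t \<oplus> t \<otimes> t) \<otimes> (\<one> \<ominus> t)"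
    unfolding p(1) p(3)[symmetric] using t by (simp only: cancel m_closed a_closed one_closed)
qed

text \<open>With n = a(1 - a) and n^3 = 0, put c = a^3 and d = 1 - c. As d is a multiple of 1 - a,
  the product c d^3 is a multiple of n^3, hence zero; as f = 1 - d^3 is a multiple of c, also f(1 -
  f) = 0. The exponent 3 matches the vanishing cube of the radical, and the factorizations through c
  on both sides serve to place f in a corner.\<close>

lemma (in ring) lift_idempotent:
  assumes a: "a \<in> carrier R"
    and nil: "(a \<ominus> a \<otimes> a) \<otimes> (a \<ominus> a \<otimes> a) \<otimes> (a \<ominus> a \<otimes> a) = \<zero>"
  defines "c \<equiv> a \<otimes> a \<otimes> a"
  defines "d \<equiv> \<one> \<ominus> c"
  defines "f \<equiv> \<one> \<ominus> d \<otimes> d \<otimes> d"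
  shows "f \<otimes> f = f" "f = c \<otimes> (\<one> \<oplus> d \<oplus> d \<otimes> d)" "f = (\<one> \<oplus> d \<oplus> d \<otimes> d) \<otimes> c"
proof -
  define b where "b = \<one> \<ominus> a"
  define s where "s = \<one> \<oplus> a \<oplus> a \<otimes> a"
  have cl: "b \<in> carrier R" "s \<in> carrier R" "c \<in> carrier R" "d \<in> carrier R" "f \<in> carrier R"
    using a by (auto simp: b_def s_def c_def d_def f_def)
  have ab: "a \<otimes> b = b \<otimes> a" using a unfolding b_def by (simp add: ring_simprules m_assoc)
  have bs: "b \<otimes> s = s \<otimes> b" unfolding s_def b_def using one_minus_cube[OF a] by simp
  have n: "a \<otimes> b = a \<ominus> a \<otimes> a" using a unfolding b_def by (simp add: ring_simprules m_assoc)
  have d: "d = b \<otimes> s" unfolding d_def c_def b_def s_def by (rule one_minus_cube(1)[OF a])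
  have ab': "b \<otimes> (a \<otimes> x) = a \<otimes> (b \<otimes> x)" if "x \<in> carrier R" for x
    using ab a cl that by (metis m_assoc)
  have bs': "s \<otimes> (b \<otimes> x) = b \<otimes> (s \<otimes> x)" if "x \<in> carrier R" for x
    using bs a cl that by (metis m_assoc)
  have "a \<otimes> (b \<otimes> (a \<otimes> (b \<otimes> (a \<otimes> b)))) = \<zero>"
    using nil a cl by (simp add: n[symmetric] m_assoc)
  then have nil': "a \<otimes> (a \<otimes> (a \<otimes> (b \<otimes> (b \<otimes> b)))) = \<zero>"
    using a cl by (simp add: ab' ab[symmetric])
  have "c \<otimes> (d \<otimes> d \<otimes> d) = (a \<otimes> (a \<otimes> (a \<otimes> (b \<otimes> (b \<otimes> b))))) \<otimes> (s \<otimes> (s \<otimes> s))"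
    using a cl by (simp add: d c_def m_assoc bs')
  then have cg: "c \<otimes> (d \<otimes> d \<otimes> d) = \<zero>" using nil' cl by simp
  have cd: "\<one> \<ominus> d = c" using cl(3) unfolding d_def by (simp add: minus_eq minus_add r_neg2)
  show f1: "f = c \<otimes> (\<one> \<oplus> d \<oplus> d \<otimes> d)" using one_minus_cube(1)[OF cl(4)] unfolding f_def cd .
  show f2: "f = (\<one> \<oplus> d \<oplus> d \<otimes> d) \<otimes> c" using one_minus_cube(2)[OF cl(4)] unfolding f_def cd .
  have "f \<otimes> (d \<otimes> d \<otimes> d) = (\<one> \<oplus> d \<oplus> d \<otimes> d) \<otimes> (c \<otimes> (d \<otimes> d \<otimes> d))"
    unfolding f2 using cl by (intro m_assoc) auto
  then have "f \<otimes> (d \<otimes> d \<otimes> d) = \<zero>" using cg cl by simp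
  moreover have "f \<otimes> f = f \<otimes> \<one> \<ominus> f \<otimes> (d \<otimes> d \<otimes> d)"
    using cl by (subst (2) f_def) (simp add: a_minus_def r_distr r_minus)
  ultimately show "f \<otimes> f = f" using cl by (simp add: a_minus_def)
qed

section \<open>Algebras with the multiplication table of a zigzag algebra\<close>

text \<open>Labels of the standard basis: e_i, x_i and the arrow from i to j.\<close>

datatype 'v zz = Ev 'v | Xv 'v | Ar 'v 'v

definition zz_index :: "'v set \<Rightarrow> ('v \<Rightarrow> 'v \<Rightarrow> bool) \<Rightarrow> 'v zz set" where
  "zz_index V adj = Ev ` V \<union> Xv ` V \<union> {Ar i j | i j. adj i j}"

lemma zz_index_simps [simp]:
  "Ev i \<in> zz_index V adj \<longleftrightarrow> i \<in> V" "Xv i \<in> zz_index V adj \<longleftrightarrow> i \<in> V"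
  "Ar i j \<in> zz_index V adj \<longleftrightarrow> adj i j"
  by (auto simp: zz_index_def)

text \<open>The multiplication table is stated dually, as a formula for the coordinates of a
  product. In this form the path algebra satisfies it as well; joint injectivity of the forms, added
  in \<open>zigzag_coordinates\<close>, is what singles out the quotient.\<close>

locale zigzag_forms = assoc_algebra K R
  for K :: "('k, 'm) ring_scheme" and R :: "('k, 'a, 'n) module_scheme" (structure) +
  fixes V :: "'v set" and adj :: "'v \<Rightarrow> 'v \<Rightarrow> bool"
    and co :: "'v zz \<Rightarrow> 'a \<Rightarrow> 'k" and bas :: "'v zz \<Rightarrow> 'a"
  assumes finite_V: "finite V"
    and adj_V: "adj i j \<Longrightarrow> i \<in> V \<and> j \<in> V"
    and adj_sym: "adj i j \<Longrightarrow> adj j i"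
    and adj_irrefl: "\<not> adj i i"
    and co_lin: "c \<in> zz_index V adj \<Longrightarrow> lin_form (co c)"
    and bas_closed [simp]: "c \<in> zz_index V adj \<Longrightarrow> bas c \<in> carrier R"
    and co_bas: "\<lbrakk>c \<in> zz_index V adj; d \<in> zz_index V adj\<rbrakk>
        \<Longrightarrow> co c (bas d) = (if c = d then \<one>\<^bsub>K\<^esub> else \<zero>\<^bsub>K\<^esub>)"
    and co_one_E: "i \<in> V \<Longrightarrow> co (Ev i) \<one> = \<one>\<^bsub>K\<^esub>"
    and co_mult_E: "\<lbrakk>i \<in> V; x \<in> carrier R; y \<in> carrier R\<rbrakk>
        \<Longrightarrow> co (Ev i) (x \<otimes> y) = co (Ev i) x \<otimes>\<^bsub>K\<^esub> co (Ev i) y"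
    and co_mult_A: "\<lbrakk>adj i j; x \<in> carrier R; y \<in> carrier R\<rbrakk>
        \<Longrightarrow> co (Ar i j) (x \<otimes> y) = co (Ev i) x \<otimes>\<^bsub>K\<^esub> co (Ar i j) y \<oplus>\<^bsub>K\<^esub> co (Ar i j) x \<otimes>\<^bsub>K\<^esub> co (Ev j) y"
    and co_mult_X: "\<lbrakk>i \<in> V; x \<in> carrier R; y \<in> carrier R\<rbrakk>
        \<Longrightarrow> co (Xv i) (x \<otimes> y) = co (Ev i) x \<otimes>\<^bsub>K\<^esub> co (Xv i) y \<oplus>\<^bsub>K\<^esub> co (Xv i) x \<otimes>\<^bsub>K\<^esub> co (Ev i) y
            \<oplus>\<^bsub>K\<^esub> (\<Oplus>\<^bsub>K\<^esub>j\<in>{j. adj i j}. co (Ar i j) x \<otimes>\<^bsub>K\<^esub> co (Ar j i) y)"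
begin

lemmas co_closed = lin_formD(1)[OF co_lin]
  and co_add = lin_formD(2)[OF co_lin]
  and co_smult = lin_formD(3)[OF co_lin]
  and co_zero = lin_form_zero[OF co_lin]
  and co_minus = lin_form_minus[OF co_lin]

lemma finite_adj: "finite {j. adj i j}"
  using finite_V by (rule rev_finite_subset) (auto dest: adj_V)

lemma finite_zz_index: "finite (zz_index V adj)"
proof -
  have "zz_index V adj \<subseteq> Ev ` V \<union> Xv ` V \<union> (\<lambda>(i, j). Ar i j) ` (V \<times> V)"
    by (auto simp: zz_index_def dest: adj_V)
  then show ?thesis using finite_V by (meson finite_SigmaI finite_UnI finite_imageI finite_subset)
qed

lemma co_finsum_bas:
  assumes "D \<subseteq> zz_index V adj" "g \<in> D \<rightarrow> carrier K" "c \<in> zz_index V adj"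
  shows "co c (\<Oplus>d\<in>D. g d \<odot> bas d) = (if c \<in> D then g c else \<zero>\<^bsub>K\<^esub>)"
proof -
  have fin: "finite D" using assms(1) finite_zz_index finite_subset by blast
  have dI: "d \<in> zz_index V adj" if "d \<in> D" for d using that assms(1) by blast
  have "co c (\<Oplus>d\<in>D. g d \<odot> bas d) = (\<Oplus>\<^bsub>K\<^esub>d\<in>D. co c (g d \<odot> bas d))"
    using assms fin dI by (intro lin_form_finsum co_lin) auto
  also have "\<dots> = (\<Oplus>\<^bsub>K\<^esub>d\<in>D. if c = d then g d else \<zero>\<^bsub>K\<^esub>)"
    using assms dI by (intro R.finsum_cong') (auto simp: co_smult co_bas Pi_iff)
  also have "\<dots> = (if c \<in> D then g c else \<zero>\<^bsub>K\<^esub>)"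
  proof (cases "c \<in> D")
    case True
    then show ?thesis using assms fin by (subst R.finsum_singleton) auto
  next
    case False
    then have "(\<Oplus>\<^bsub>K\<^esub>d\<in>D. if c = d then g d else \<zero>\<^bsub>K\<^esub>) = (\<Oplus>\<^bsub>K\<^esub>d\<in>D. \<zero>\<^bsub>K\<^esub>)"
      by (intro R.finsum_cong') auto
    then show ?thesis using False by simp
  qed
  finally show ?thesis .
qed

end

locale zigzag_coordinates = zigzag_forms K R V adj co bas
  for K :: "('k, 'm) ring_scheme" and R :: "('k, 'a, 'n) module_scheme" (structure)
    and V :: "'v set" and adj :: "'v \<Rightarrow> 'v \<Rightarrow> bool"
    and co :: "'v zz \<Rightarrow> 'a \<Rightarrow> 'k" and bas :: "'v zz \<Rightarrow> 'a" +
  assumes co_inject: "\<lbrakk>x \<in> carrier R; \<And>c. c \<in> zz_index V adj \<Longrightarrow> co c x = \<zero>\<^bsub>K\<^esub>\<rbrakk> \<Longrightarrow> x = \<zero>"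
begin

lemma co_eqI:
  assumes "x \<in> carrier R" "y \<in> carrier R" "\<And>c. c \<in> zz_index V adj \<Longrightarrow> co c x = co c y"
  shows "x = y"
proof -
  have "x \<ominus> y = \<zero>"
    using assms by (intro co_inject) (auto simp: co_minus co_closed R.r_neg R.minus_eq simp del: M.minus_eq)
  then have "x \<oplus> \<ominus> y = \<zero>" by (simp add: minus_eq)
  then show ?thesis using assms by (metis a_inv_closed l_neg minus_equality minus_minus)
qed

lemma co_expand:
  assumes "x \<in> carrier R"
  shows "x = (\<Oplus>d\<in>zz_index V adj. co d x \<odot> bas d)"
proof (rule co_eqI)
  show cl: "(\<Oplus>d\<in>zz_index V adj. co d x \<odot> bas d) \<in> carrier R"
    using assms by (intro M.finsum_closed) (auto simp: co_closed)
  fix c assume c: "c \<in> zz_index V adj"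
  then show "co c x = co c (\<Oplus>d\<in>zz_index V adj. co d x \<odot> bas d)"
    using assms by (subst co_finsum_bas[where g = "\<lambda>d. co d x"]) (auto simp: co_closed)
qed fact

lemma fin_dim_zigzag: "fin_dim"
proof -
  have sub: "bas ` zz_index V adj \<subseteq> carrier R" by auto
  have "x \<in> span (bas ` zz_index V adj)" if x: "x \<in> carrier R" for x
  proof -
    have "(\<Oplus>d\<in>zz_index V adj. co d x \<odot> bas d) \<in> span (bas ` zz_index V adj)"
      using span_is_submodule[OF sub] in_own_span[OF sub] x
      by (intro submodule_finsum finite_zz_index) (auto intro!: submodule.smult_closed simp: co_closed)
    then show ?thesis using co_expand[OF x] by simp
  qed
  then have "gen_set (bas ` zz_index V adj)" using span_is_subset2[OF sub] by auto
  then show ?thesis using finite_zz_index sub unfolding fin_dim_def by blast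
qed

lemma co_X_plain:
  assumes "i \<in> V" "x \<in> carrier R" "y \<in> carrier R"
    and "\<And>j. adj i j \<Longrightarrow> co (Ar i j) x = \<zero>\<^bsub>K\<^esub> \<or> co (Ar j i) y = \<zero>\<^bsub>K\<^esub>"
  shows "co (Xv i) (x \<otimes> y) = co (Ev i) x \<otimes>\<^bsub>K\<^esub> co (Xv i) y \<oplus>\<^bsub>K\<^esub> co (Xv i) x \<otimes>\<^bsub>K\<^esub> co (Ev i) y"
proof -
  have "(\<Oplus>\<^bsub>K\<^esub>j\<in>{j. adj i j}. co (Ar i j) x \<otimes>\<^bsub>K\<^esub> co (Ar j i) y) = (\<Oplus>\<^bsub>K\<^esub>j\<in>{j. adj i j}. \<zero>\<^bsub>K\<^esub>)"
  proof (rule R.finsum_cong')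
    fix j assume "j \<in> {j. adj i j}"
    then have j: "adj i j" "adj j i" using adj_sym by auto
    then show "co (Ar i j) x \<otimes>\<^bsub>K\<^esub> co (Ar j i) y = \<zero>\<^bsub>K\<^esub>"
      using assms(4)[OF j(1)] co_closed[of "Ar i j" x] co_closed[of "Ar j i" y] assms(2,3) by auto
  qed auto
  then show ?thesis using co_mult_X[OF assms(1-3)] assms by (simp add: co_closed)
qed

definition rad :: "'a \<Rightarrow> bool" where
  "rad x \<longleftrightarrow> x \<in> carrier R \<and> (\<forall>i\<in>V. co (Ev i) x = \<zero>\<^bsub>K\<^esub>)"

text \<open>A product of two elements without \<open>Ev\<close> coordinates has only
  \<open>Xv\<close> coordinates left, and a third such factor kills these.\<close>

lemma rad_cube:
  assumes "rad x" "rad y" "rad z"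
  shows "x \<otimes> y \<otimes> z = \<zero>"
proof (rule co_inject)
  have cl: "x \<in> carrier R" "y \<in> carrier R" "z \<in> carrier R"
    and E: "\<And>i. i \<in> V \<Longrightarrow> co (Ev i) x = \<zero>\<^bsub>K\<^esub>" "\<And>i. i \<in> V \<Longrightarrow> co (Ev i) y = \<zero>\<^bsub>K\<^esub>"
      "\<And>i. i \<in> V \<Longrightarrow> co (Ev i) z = \<zero>\<^bsub>K\<^esub>"
    using assms by (auto simp: rad_def)
  show "x \<otimes> y \<otimes> z \<in> carrier R" using cl by simp
  have xyE: "co (Ev i) (x \<otimes> y) = \<zero>\<^bsub>K\<^esub>" if "i \<in> V" for i
    using that cl by (simp add: co_mult_E E)
  have xyA: "co (Ar i j) (x \<otimes> y) = \<zero>\<^bsub>K\<^esub>" if "adj i j" for i j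
    using that cl adj_V[OF that] by (simp add: co_mult_A E co_closed)
  fix c assume c: "c \<in> zz_index V adj"
  show "co c (x \<otimes> y \<otimes> z) = \<zero>\<^bsub>K\<^esub>"
  proof (cases c)
    case (Ev i)
    then show ?thesis using c cl by (simp add: co_mult_E E)
  next
    case (Xv i)
    then have "co c (x \<otimes> y \<otimes> z) = co (Ev i) (x \<otimes> y) \<otimes>\<^bsub>K\<^esub> co (Xv i) z \<oplus>\<^bsub>K\<^esub> co (Xv i) (x \<otimes> y) \<otimes>\<^bsub>K\<^esub> co (Ev i) z"
      using c cl xyA by (simp add: co_X_plain)
    then show ?thesis using Xv c cl xyE[of i] E(3)[of i] by (simp add: co_closed)
  next
    case (Ar i j)
    then show ?thesis using c cl adj_V[of i j] xyA xyE E by (simp add: co_mult_A co_closed)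
  qed
qed

section \<open>Peirce components of lifted idempotents\<close>

definition peirce :: "('v \<Rightarrow> 'a) \<Rightarrow> 'v \<Rightarrow> 'v \<Rightarrow> 'a \<Rightarrow> bool" where
  "peirce f i j x \<longleftrightarrow> x \<in> carrier R \<and> f i \<otimes> x = x \<and> x \<otimes> f j = x"

text \<open>The idempotents are lifted one vertex at a time and need not be orthogonal; beyond
  idempotency only their values under the characters are prescribed.\<close>

definition primitive_lift :: "('v \<Rightarrow> 'a) \<Rightarrow> bool" where
  "primitive_lift f \<longleftrightarrow> (\<forall>i\<in>V. f i \<in> carrier R \<and> f i \<otimes> f i = f i \<and>
     (\<forall>j\<in>V. co (Ev j) (f i) = (if j = i then \<one>\<^bsub>K\<^esub> else \<zero>\<^bsub>K\<^esub>)))"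

context
  fixes f
  assumes f: "primitive_lift f"
begin

lemma f_closed: "i \<in> V \<Longrightarrow> f i \<in> carrier R"
  and f_idem: "i \<in> V \<Longrightarrow> f i \<otimes> f i = f i"
  and f_co_E: "i \<in> V \<Longrightarrow> j \<in> V \<Longrightarrow> co (Ev j) (f i) = (if j = i then \<one>\<^bsub>K\<^esub> else \<zero>\<^bsub>K\<^esub>)"
  using f by (auto simp: primitive_lift_def)

lemma peirceI:
  assumes "i \<in> V" "j \<in> V" "x \<in> carrier R"
  shows "peirce f i j (f i \<otimes> x \<otimes> f j)"
proof -
  note c = f_closed[OF assms(1)] f_closed[OF assms(2)] assms(3)
  have "f i \<otimes> (f i \<otimes> x \<otimes> f j) = (f i \<otimes> f i) \<otimes> x \<otimes> f j"
    using c by (simp add: m_assoc)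
  moreover have "f i \<otimes> x \<otimes> f j \<otimes> f j = f i \<otimes> x \<otimes> (f j \<otimes> f j)"
    using c by (simp add: m_assoc)
  ultimately show ?thesis
    using c f_idem assms by (simp add: peirce_def)
qed

lemma peirce_E:
  assumes "i \<in> V" "j \<in> V" "peirce f i j x" "k \<in> V" "\<not> (k = i \<and> k = j)"
  shows "co (Ev k) x = \<zero>\<^bsub>K\<^esub>"
proof -
  have x: "x \<in> carrier R" "f i \<otimes> x = x" "x \<otimes> f j = x" using assms by (auto simp: peirce_def)
  have "co (Ev k) x = co (Ev k) (f i) \<otimes>\<^bsub>K\<^esub> co (Ev k) x" "co (Ev k) x = co (Ev k) x \<otimes>\<^bsub>K\<^esub> co (Ev k) (f j)"
    using co_mult_E[OF assms(4) f_closed[OF assms(1)] x(1)]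
      co_mult_E[OF assms(4) x(1) f_closed[OF assms(2)]] x by auto
  then show ?thesis
    using assms(4,5) x(1) f_co_E[OF assms(1,4)] f_co_E[OF assms(2,4)] co_closed[of "Ev k" x]
    by (auto split: if_splits)
qed

text \<open>For \<open>i = j\<close> the last assumption excludes multiples of \<open>f i\<close>
  itself, whose arrow coordinates are unrestricted.\<close>

lemma peirce_A:
  assumes "i \<in> V" "j \<in> V" "peirce f i j x" "adj k l" "\<not> (k = i \<and> l = j)"
    and "i = j \<Longrightarrow> co (Ev i) x = \<zero>\<^bsub>K\<^esub>"
  shows "co (Ar k l) x = \<zero>\<^bsub>K\<^esub>"
proof -
  have x: "x \<in> carrier R" "f i \<otimes> x = x" "x \<otimes> f j = x" using assms by (auto simp: peirce_def)
  have kl: "k \<in> V" "l \<in> V" using adj_V[OF assms(4)] by auto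
  have E: "co (Ev k) x = \<zero>\<^bsub>K\<^esub>" "co (Ev l) x = \<zero>\<^bsub>K\<^esub>"
    using peirce_E[OF assms(1-3)] kl assms(6) by blast+
  have "co (Ar k l) x = co (Ev k) (f i) \<otimes>\<^bsub>K\<^esub> co (Ar k l) x"
    using co_mult_A[OF assms(4) f_closed[OF assms(1)] x(1)] x E assms kl f_closed
    by (simp add: co_closed)
  moreover have "co (Ar k l) x = co (Ar k l) x \<otimes>\<^bsub>K\<^esub> co (Ev l) (f j)"
    using co_mult_A[OF assms(4) x(1) f_closed[OF assms(2)]] x E assms kl f_closed
    by (simp add: co_closed)
  ultimately show ?thesis
    using assms(4,5) x(1) f_co_E[OF assms(1) kl(1)] f_co_E[OF assms(2) kl(2)] co_closed[of "Ar k l" x]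
    by (auto split: if_splits)
qed

lemma peirce_X:
  assumes "i \<in> V" "j \<in> V" "peirce f i j x" "k \<in> V" "\<not> (k = i \<and> k = j)"
    and "\<And>k l. adj k l \<Longrightarrow> co (Ar k l) x = \<zero>\<^bsub>K\<^esub>" and "i = j \<Longrightarrow> co (Ev i) x = \<zero>\<^bsub>K\<^esub>"
  shows "co (Xv k) x = \<zero>\<^bsub>K\<^esub>"
proof -
  have x: "x \<in> carrier R" "f i \<otimes> x = x" "x \<otimes> f j = x" using assms by (auto simp: peirce_def)
  have E: "co (Ev k) x = \<zero>\<^bsub>K\<^esub>"
    using peirce_E[OF assms(1-3)] assms(4,7) by blast
  have "co (Xv k) x = co (Ev k) (f i) \<otimes>\<^bsub>K\<^esub> co (Xv k) x"
    using co_X_plain[OF assms(4) f_closed[OF assms(1)] x(1)] x E assms(1,4,6) adj_sym f_closed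
    by (simp add: co_closed)
  moreover have "co (Xv k) x = co (Xv k) x \<otimes>\<^bsub>K\<^esub> co (Ev k) (f j)"
    using co_X_plain[OF assms(4) x(1) f_closed[OF assms(2)]] x E assms(2,4,6) f_closed
    by (simp add: co_closed)
  ultimately show ?thesis
    using assms(4,5) x(1) f_co_E[OF assms(1,4)] f_co_E[OF assms(2,4)] co_closed[of "Xv k" x]
    by (auto split: if_splits)
qed

text \<open>Coordinates are eliminated in the order \<open>Ev\<close>, \<open>Ar\<close>,
  \<open>Xv\<close>, each kind vanishing once the earlier ones do. A non-zero component must
  therefore show up at the arrow \<open>Ar i j\<close> itself.\<close>

lemma peirce_off_diag:
  assumes "i \<in> V" "j \<in> V" "i \<noteq> j" "peirce f i j x" "x \<noteq> \<zero>"
  shows "adj i j" "co (Ar i j) x \<noteq> \<zero>\<^bsub>K\<^esub>"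
proof -
  have x: "x \<in> carrier R" using assms by (auto simp: peirce_def)
  have "adj i j \<and> co (Ar i j) x \<noteq> \<zero>\<^bsub>K\<^esub>"
  proof (rule ccontr)
    assume neg: "\<not> (adj i j \<and> co (Ar i j) x \<noteq> \<zero>\<^bsub>K\<^esub>)"
    have A: "co (Ar k l) x = \<zero>\<^bsub>K\<^esub>" if "adj k l" for k l
      using peirce_A[OF assms(1,2,4) that] assms(3) neg that by blast
    have "x = \<zero>"
    proof (rule co_inject[OF x])
      fix c assume "c \<in> zz_index V adj"
      then show "co c x = \<zero>\<^bsub>K\<^esub>"
        using A peirce_E[OF assms(1,2,4)] peirce_X[OF assms(1,2,4) _ _ A] assms(3) by (cases c) auto
    qed
    then show False using assms(5) by simp
  qed
  then show "adj i j" "co (Ar i j) x \<noteq> \<zero>\<^bsub>K\<^esub>" by auto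
qed

text \<open>The nilpotent part of the local algebra f_i R f_i is at most a line, seen by the single
  coordinate \<open>Xv i\<close>. That it squares to zero and that any two of its elements are
  proportional follow from this.\<close>

lemma peirce_diag:
  assumes "i \<in> V" "peirce f i i x" "co (Ev i) x = \<zero>\<^bsub>K\<^esub>" "d \<in> zz_index V adj" "d \<noteq> Xv i"
  shows "co d x = \<zero>\<^bsub>K\<^esub>"
proof -
  have A: "co (Ar k l) x = \<zero>\<^bsub>K\<^esub>" if "adj k l" for k l
    using peirce_A[OF assms(1,1,2) that] assms(3) that adj_irrefl by blast
  show ?thesis using assms(3-5) A peirce_E[OF assms(1,1,2)] peirce_X[OF assms(1,1,2) _ _ A]
    by (cases d) auto
qed

lemma peirce_diag_square:
  assumes "i \<in> V" "peirce f i i x" "co (Ev i) x = \<zero>\<^bsub>K\<^esub>"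
  shows "x \<otimes> x = \<zero>"
proof (rule co_inject)
  have x: "x \<in> carrier R" using assms by (auto simp: peirce_def)
  have A: "co (Ar k l) x = \<zero>\<^bsub>K\<^esub>" if "adj k l" for k l
    using peirce_diag[OF assms, of "Ar k l"] that by simp
  have E: "co (Ev k) x = \<zero>\<^bsub>K\<^esub>" if "k \<in> V" for k
    using peirce_diag[OF assms, of "Ev k"] that by simp
  show "x \<otimes> x \<in> carrier R" using x by simp
  fix c assume "c \<in> zz_index V adj"
  then show "co c (x \<otimes> x) = \<zero>\<^bsub>K\<^esub>"
    using x A E by (cases c) (auto simp: co_mult_E co_mult_A co_X_plain co_closed dest: adj_V)
qed

lemma peirce_diag_dependent:
  assumes "i \<in> V" "peirce f i i x" "co (Ev i) x = \<zero>\<^bsub>K\<^esub>" "peirce f i i y" "co (Ev i) y = \<zero>\<^bsub>K\<^esub>"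
  shows "co (Xv i) y \<odot> x = co (Xv i) x \<odot> y"
proof (rule co_eqI)
  have x: "x \<in> carrier R" "y \<in> carrier R" using assms by (auto simp: peirce_def)
  have X: "co (Xv i) x \<in> carrier K" "co (Xv i) y \<in> carrier K" using x assms by (auto simp: co_closed)
  show "co (Xv i) y \<odot> x \<in> carrier R" "co (Xv i) x \<odot> y \<in> carrier R" using x X by auto
  fix c assume c: "c \<in> zz_index V adj"
  then show "co c (co (Xv i) y \<odot> x) = co c (co (Xv i) x \<odot> y)"
    using x X peirce_diag[OF assms(1-3) c] peirce_diag[OF assms(1,4,5) c]
    by (cases "c = Xv i") (auto simp: co_smult R.m_comm)
qed

lemma peirce_diag_zero:
  assumes "i \<in> V" "peirce f i i x" "co (Ev i) x = \<zero>\<^bsub>K\<^esub>" "co (Xv i) x = \<zero>\<^bsub>K\<^esub>"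
  shows "x = \<zero>"
proof (rule co_inject)
  show "x \<in> carrier R" using assms by (auto simp: peirce_def)
qed (use peirce_diag[OF assms(1-3)] assms(4) in blast)

lemma peirce_mult_X:
  assumes "adj i j" "peirce f i j x" "peirce f j i y"
  shows "co (Xv i) (x \<otimes> y) = co (Ar i j) x \<otimes>\<^bsub>K\<^esub> co (Ar j i) y"
proof -
  have ij: "i \<in> V" "j \<in> V" "i \<noteq> j" "adj j i" using assms adj_V adj_irrefl adj_sym by blast+
  have x: "x \<in> carrier R" "y \<in> carrier R" using assms by (auto simp: peirce_def)
  have E: "co (Ev i) x = \<zero>\<^bsub>K\<^esub>" "co (Ev i) y = \<zero>\<^bsub>K\<^esub>"
    using peirce_E[OF ij(1,2) assms(2)] peirce_E[OF ij(2,1) assms(3)] ij by auto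
  have "(\<Oplus>\<^bsub>K\<^esub>k\<in>{k. adj i k}. co (Ar i k) x \<otimes>\<^bsub>K\<^esub> co (Ar k i) y)
      = (\<Oplus>\<^bsub>K\<^esub>k\<in>{k. adj i k}. if j = k then co (Ar i k) x \<otimes>\<^bsub>K\<^esub> co (Ar k i) y else \<zero>\<^bsub>K\<^esub>)"
  proof (rule R.finsum_cong')
    fix k assume k: "k \<in> {k. adj i k}"
    then have "adj k i" using adj_sym by blast
    then show "co (Ar i k) x \<otimes>\<^bsub>K\<^esub> co (Ar k i) y
        = (if j = k then co (Ar i k) x \<otimes>\<^bsub>K\<^esub> co (Ar k i) y else \<zero>\<^bsub>K\<^esub>)"
      using peirce_A[OF ij(1,2) assms(2), of i k] ij x k by (auto simp: co_closed)
  qed (use x adj_sym in \<open>auto simp: co_closed\<close>)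
  also have "\<dots> = co (Ar i j) x \<otimes>\<^bsub>K\<^esub> co (Ar j i) y"
    using assms x finite_adj adj_sym
    by (subst R.finsum_singleton[where f = "\<lambda>k. co (Ar i k) x \<otimes>\<^bsub>K\<^esub> co (Ar k i) y"]) (auto simp: co_closed)
  finally show ?thesis using co_mult_X[OF ij(1) x] E x ij assms by (simp add: co_closed)
qed

text \<open>The outer factors contribute \<chi>_i(f_i) = \<chi>_j(f_j) = 1, so the coordinate at the
  arrow survives unchanged.\<close>

lemma peirce_arrow:
  assumes "adj i j"
  shows "f i \<otimes> bas (Ar i j) \<otimes> f j \<noteq> \<zero>"
proof -
  have ij: "i \<in> V" "j \<in> V" "i \<noteq> j" using assms adj_V adj_irrefl by blast+
  note c = f_closed[OF ij(1)] f_closed[OF ij(2)]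
  have "co (Ar i j) (f i \<otimes> bas (Ar i j) \<otimes> f j) = \<one>\<^bsub>K\<^esub>"
    using c ij assms by (simp add: co_mult_A co_mult_E f_co_E co_bas co_closed)
  then show ?thesis using co_zero[of "Ar i j"] assms by auto
qed

end

end


section \<open>Relative cell data on zigzag algebras\<close>

locale zigzag_cell_datum = relative_cell_datum K R X M C star E leq eps +
  zigzag_coordinates K R V adj co bas
  for K :: "('k, 'm) ring_scheme" and R :: "('k, 'a, 'n) module_scheme" (structure)
    and X :: "'x set" and M :: "'x \<Rightarrow> 's set" and C :: "'x \<Rightarrow> 's \<Rightarrow> 's \<Rightarrow> 'a"
    and star :: "'a \<Rightarrow> 'a" and E :: "'a set" and leq :: "'a \<Rightarrow> ('x \<times> 'x) set"
    and eps :: "'x \<Rightarrow> 's \<Rightarrow> 'a"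
    and V :: "'v set" and adj :: "'v \<Rightarrow> 'v \<Rightarrow> bool"
    and co :: "'v zz \<Rightarrow> 'a \<Rightarrow> 'k" and bas :: "'v zz \<Rightarrow> 'a"

sublocale zigzag_cell_datum \<subseteq> finite_relative_cell_datum
  by unfold_locales (rule fin_dim_zigzag)

section \<open>Head cells of the vertices\<close>

context zigzag_cell_datum
begin

lemma star_minus: "\<lbrakk>x \<in> carrier R; y \<in> carrier R\<rbrakk> \<Longrightarrow> star (x \<ominus> y) = star x \<ominus> star y"
proof -
  assume x: "x \<in> carrier R" and y: "y \<in> carrier R"
  have "star (\<ominus> y) \<oplus> star y = \<zero>"
    using y by (simp add: star_add[symmetric] l_neg)
  then have "star (\<ominus> y) = \<ominus> star y" using y by (simp add: minus_equality)
  then show "star (x \<ominus> y) = star x \<ominus> star y" using x y by (simp add: minus_eq star_add)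
qed

lemma char_Ev: "i \<in> V \<Longrightarrow> is_char (co (Ev i))"
  by (simp add: is_char_def co_lin co_one_E co_mult_E)

definition lam :: "'v \<Rightarrow> 'x" where
  "lam i = (SOME \<nu>. \<exists>\<epsilon>. head (co (Ev i)) \<epsilon> \<nu>)"

text \<open>Despite its name this is an element of \<open>E\<close> and not the vertex idempotent
  e_i; several vertices may share it, as they do for \<open>E = {\<one>}\<close>.\<close>

definition ei :: "'v \<Rightarrow> 'a" where
  "ei i = (SOME \<epsilon>. head (co (Ev i)) \<epsilon> (lam i))"

lemma head_lam: "i \<in> V \<Longrightarrow> head (co (Ev i)) (ei i) (lam i)"
proof -
  assume "i \<in> V"
  then have "\<exists>\<nu>. \<exists>\<epsilon>. head (co (Ev i)) \<epsilon> \<nu>" using head_exists[OF char_Ev] by blast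
  from someI_ex[OF this] have "\<exists>\<epsilon>. head (co (Ev i)) \<epsilon> (lam i)" by (simp add: lam_def)
  from someI_ex[OF this] show ?thesis by (simp add: ei_def)
qed

lemma ei_E: "i \<in> V \<Longrightarrow> ei i \<in> E"
  and ei_co: "i \<in> V \<Longrightarrow> co (Ev i) (ei i) = \<one>\<^bsub>K\<^esub>"
  and lam_X: "i \<in> V \<Longrightarrow> lam i \<in> X"
  using head_lam by (auto simp: head_def)

lemma lam_inj:
  assumes "i \<in> V" "j \<in> V" "lam i = lam j"
  shows "i = j"
proof (rule ccontr)
  assume "i \<noteq> j"
  moreover have "co (Ev i) (bas (Ev i)) = co (Ev j) (bas (Ev i))"
    using head_determines_char[OF char_Ev char_Ev head_lam, of i j "ei j" "bas (Ev i)"]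
      head_lam[of j] assms by simp
  ultimately show False using assms by (simp add: co_bas)
qed

text \<open>Lifting \<open>e\<^sub>i\<close> along the radical after symmetrizing: \<open>b b\<^sup>\<star>\<close> with
  \<open>b = \<epsilon> e\<^sub>i \<epsilon>\<close> is fixed by the anti-involution, and so are polynomials in it.\<close>

lemma lift_exists:
  assumes "i \<in> V"
  shows "\<exists>f. f \<in> carrier R \<and> f \<otimes> f = f \<and> star f = f \<and> corner (ei i) f \<and>
    (\<forall>j\<in>V. co (Ev j) f = (if j = i then \<one>\<^bsub>K\<^esub> else \<zero>\<^bsub>K\<^esub>))"
proof -
  define e where "e = ei i"
  define b where "b = e \<otimes> bas (Ev i) \<otimes> e"
  define a where "a = b \<otimes> star b"
  have e: "e \<in> carrier R" "star e = e" "e \<otimes> e = e" "co (Ev i) e = \<one>\<^bsub>K\<^esub>"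
    using ei_E[OF assms] ei_co[OF assms] by (auto simp: e_def star_E E_idem)
  have bc: "b \<in> carrier R" "a \<in> carrier R" using e assms by (auto simp: b_def a_def)
  have eb: "e \<otimes> b = b"
    unfolding b_def using e assms by (metis bas_closed m_assoc m_closed zz_index_simps(1))
  have sbe: "star b \<otimes> e = star b"
    using bc e eb star_mult[of e b] by simp
  have ea: "e \<otimes> a = a" "a \<otimes> e = a"
    unfolding a_def using bc e eb sbe by (simp add: m_assoc[symmetric], simp add: m_assoc)
  have sa: "star a = a" using bc by (simp add: a_def star_mult)
  have chi_b: "co (Ev j) b = (if j = i then \<one>\<^bsub>K\<^esub> else \<zero>\<^bsub>K\<^esub>)" if "j \<in> V" for j
    using that assms e by (simp add: b_def co_mult_E co_bas co_closed)
  \<comment> \<open>Passing from \<open>b\<close> to \<open>b \<otimes> star b\<close> preserves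
    these values because characters are invariant under the anti-involution.\<close>
  have chi_a: "co (Ev j) a = (if j = i then \<one>\<^bsub>K\<^esub> else \<zero>\<^bsub>K\<^esub>)" if "j \<in> V" for j
    using that bc chi_b[OF that] char_star[OF char_Ev[OF that] bc(1)] by (simp add: a_def co_mult_E)
  have "rad (a \<ominus> a \<otimes> a)"
    using bc chi_a unfolding rad_def by (auto simp: co_minus co_mult_E R.minus_eq R.r_neg)
  then have nil: "(a \<ominus> a \<otimes> a) \<otimes> (a \<ominus> a \<otimes> a) \<otimes> (a \<ominus> a \<otimes> a) = \<zero>" by (intro rad_cube)
  define c where "c = a \<otimes> a \<otimes> a"
  define d where "d = \<one> \<ominus> c"
  define f where "f = \<one> \<ominus> d \<otimes> d \<otimes> d"
  note li = lift_idempotent[OF bc(2) nil, folded c_def d_def f_def, folded d_def f_def, folded f_def]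
  have cl: "c \<in> carrier R" "d \<in> carrier R" "f \<in> carrier R"
    using bc by (auto simp: c_def d_def f_def)
  have "star c = c" using bc sa by (simp add: c_def star_mult m_assoc)
  then have "star d = d" using cl by (simp add: d_def star_minus)
  then have sf: "star f = f" using cl by (simp add: f_def star_minus star_mult m_assoc)
  have ec: "e \<otimes> c = c" "c \<otimes> e = c"
    unfolding c_def using bc e ea by (simp add: m_assoc[symmetric], simp add: m_assoc)
  \<comment> \<open>Of the two factorizations of \<open>f\<close> through \<open>c\<close>, one
    places \<open>f\<close> in the corner from the left and the other from the right.\<close>
  have "e \<otimes> f = f" unfolding li(2) using cl e ec by (simp add: m_assoc[symmetric])
  moreover have "f \<otimes> e = f" unfolding li(3) using cl e ec by (simp add: m_assoc)
  ultimately have "corner e f" using cl by (simp add: corner_def)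
  moreover have "co (Ev j) f = (if j = i then \<one>\<^bsub>K\<^esub> else \<zero>\<^bsub>K\<^esub>)" if "j \<in> V" for j
  proof -
    have c: "co (Ev j) c = (if j = i then \<one>\<^bsub>K\<^esub> else \<zero>\<^bsub>K\<^esub>)"
      using that bc chi_a by (simp add: c_def co_mult_E)
    then have "co (Ev j) d = (if j = i then \<zero>\<^bsub>K\<^esub> else \<one>\<^bsub>K\<^esub>)"
      using that cl by (simp add: d_def co_minus co_one_E R.minus_eq R.r_neg)
    then show ?thesis
      using that cl by (simp add: f_def co_minus co_one_E co_mult_E R.minus_eq R.r_neg)
  qed
  ultimately show ?thesis using li(1) sf cl(3) unfolding e_def by blast
qed

section \<open>Lifted idempotents acting on cells\<close>

definition fi :: "'v \<Rightarrow> 'a" where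
  "fi i = (SOME f. f \<in> carrier R \<and> f \<otimes> f = f \<and> star f = f \<and> corner (ei i) f \<and>
    (\<forall>j\<in>V. co (Ev j) f = (if j = i then \<one>\<^bsub>K\<^esub> else \<zero>\<^bsub>K\<^esub>)))"

lemma
  assumes "i \<in> V"
  shows fi_closed: "fi i \<in> carrier R" and fi_idem: "fi i \<otimes> fi i = fi i" and fi_star: "star (fi i) = fi i"
    and fi_corner: "corner (ei i) (fi i)"
    and fi_co: "j \<in> V \<Longrightarrow> co (Ev j) (fi i) = (if j = i then \<one>\<^bsub>K\<^esub> else \<zero>\<^bsub>K\<^esub>)"
  using someI_ex[OF lift_exists[OF assms]] unfolding fi_def[symmetric] by blast+

lemma fi_lift: "primitive_lift fi"
  using fi_closed fi_idem fi_co by (auto simp: primitive_lift_def)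

text \<open>Within a cell, left multiplication changes only the row and right multiplication only
  the column, so the coordinate factors. That \<open>b\<close> lies in the corner of the column
  idempotent keeps the remainder \<open>u \<otimes> b\<close> in the lower cells.\<close>

lemma ccoord_two_sided:
  assumes "\<nu> \<in> X" "S \<in> M \<nu>" "T \<in> M \<nu>" "S' \<in> M \<nu>" "T' \<in> M \<nu>" "a \<in> carrier R"
    and "eps \<nu> T = \<epsilon>" "corner \<epsilon> b"
  shows "ccoord (\<nu>, S', T') (a \<otimes> C \<nu> S T \<otimes> b) = act a \<nu> S' S \<otimes>\<^bsub>K\<^esub> act (star b) \<nu> T' T"
proof -
  have e: "\<epsilon> \<in> E" using eps_in_E assms by blast
  have b: "b \<in> carrier R" using assms by (simp add: corner_def)
  have i: "(\<nu>, S', T') \<in> Cidx" using assms by simp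
  let ?r = "\<lambda>S''. act a \<nu> S'' S"
  have rc: "?r S'' \<in> carrier K" if "S'' \<in> M \<nu>" for S'' using that assms by (simp add: act_closed)
  obtain u where u: "u \<in> low (eps \<nu> T) \<nu>" "a \<otimes> C \<nu> S T = (\<Oplus>S''\<in>M \<nu>. ?r S'' \<odot> C \<nu> S'' T) \<oplus> u"
    using mult_C_act[OF assms(1-3,6)] .
  have uc: "u \<in> carrier R" using cspan_closed[OF below_subset[OF e]] u(1) assms(7) by blast
  have "u \<otimes> b \<in> low \<epsilon> \<nu>" using low_corner[OF e assms(8)] u(1) assms(7) by simp
  then have "ccoord (\<nu>, S', T') (u \<otimes> b) = \<zero>\<^bsub>K\<^esub>"
    using i by (intro ccoord_cspan[OF below_subset[OF e]]) (auto simp: below_def)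
  moreover have "a \<otimes> C \<nu> S T \<otimes> b = (\<Oplus>S''\<in>M \<nu>. (?r S'' \<odot> C \<nu> S'' T) \<otimes> b) \<oplus> u \<otimes> b"
  proof -
    have "a \<otimes> C \<nu> S T \<otimes> b = (\<Oplus>S''\<in>M \<nu>. ?r S'' \<odot> C \<nu> S'' T) \<otimes> b \<oplus> u \<otimes> b"
      unfolding u(2) using assms rc uc b by (intro l_distr row_closed) auto
    also have "(\<Oplus>S''\<in>M \<nu>. ?r S'' \<odot> C \<nu> S'' T) \<otimes> b = (\<Oplus>S''\<in>M \<nu>. (?r S'' \<odot> C \<nu> S'' T) \<otimes> b)"
      using assms rc b finite_M by (intro finsum_ldistr) auto
    finally show ?thesis .
  qed
  moreover have "(\<Oplus>S''\<in>M \<nu>. (?r S'' \<odot> C \<nu> S'' T) \<otimes> b) \<in> carrier R"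
    using assms rc b by (intro M.finsum_closed) auto
  ultimately have "ccoord (\<nu>, S', T') (a \<otimes> C \<nu> S T \<otimes> b)
      = ccoord (\<nu>, S', T') (\<Oplus>S''\<in>M \<nu>. (?r S'' \<odot> C \<nu> S'' T) \<otimes> b)"
    using ccoord_add[OF i] ccoord_closed[OF i] uc b by simp
  also have "\<dots> = (\<Oplus>\<^bsub>K\<^esub>S''\<in>M \<nu>. ccoord (\<nu>, S', T') ((?r S'' \<odot> C \<nu> S'' T) \<otimes> b))"
    using assms rc b finite_M by (intro lin_form_finsum ccoord_lin) auto
  also have "\<dots> = (\<Oplus>\<^bsub>K\<^esub>S''\<in>M \<nu>. if S' = S'' then ?r S'' \<otimes>\<^bsub>K\<^esub> act (star b) \<nu> T' T else \<zero>\<^bsub>K\<^esub>)"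
  proof (rule R.finsum_cong')
    fix S'' assume S: "S'' \<in> M \<nu>"
    have "ccoord (\<nu>, S', T') (C \<nu> S'' T \<otimes> b) = ccoord (\<nu>, T', S') (star (C \<nu> S'' T \<otimes> b))"
      using assms S b by (simp add: ccoord_star)
    also have "\<dots> = ccoord (\<nu>, T', S') (star b \<otimes> C \<nu> T S'')"
      using assms S b by (simp add: star_mult star_C)
    also have "\<dots> = (if S' = S'' then act (star b) \<nu> T' T else \<zero>\<^bsub>K\<^esub>)"
      using assms S b by (simp add: ccoord_mult_C)
    finally show "ccoord (\<nu>, S', T') ((?r S'' \<odot> C \<nu> S'' T) \<otimes> b)
        = (if S' = S'' then ?r S'' \<otimes>\<^bsub>K\<^esub> act (star b) \<nu> T' T else \<zero>\<^bsub>K\<^esub>)"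
      using assms S b rc[OF S] ccoord_smult[OF i rc[OF S], of "C \<nu> S'' T \<otimes> b"]
      by (simp add: smult_mult_left)
  qed (use assms b rc in \<open>auto simp: act_closed\<close>)
  also have "\<dots> = ?r S' \<otimes>\<^bsub>K\<^esub> act (star b) \<nu> T' T"
    using assms b rc finite_M
    by (subst R.finsum_singleton[where f = "\<lambda>S''. ?r S'' \<otimes>\<^bsub>K\<^esub> act (star b) \<nu> T' T"])
       (auto simp: act_closed)
  finally show ?thesis .
qed

text \<open>In \<open>mult_C\<close> the order that governs left multiplication by an arbitrary
  element is that of the column idempotent. Cutting the columns down by \<epsilon> makes this the
  order of \<epsilon> throughout.\<close>

lemma low_left_ideal:
  assumes "\<epsilon> \<in> E" "x \<in> low \<epsilon> \<nu>" "a \<in> carrier R"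
  shows "a \<otimes> (x \<otimes> \<epsilon>) \<in> low \<epsilon> \<nu>"
proof -
  note sub = below_subset[OF assms(1), of \<nu>]
  show ?thesis using assms(2) sub
  proof (induction rule: cspan_induct)
    case zero
    then show ?case using cspan_zero[OF sub] assms by simp
  next
    case (base \<mu> S T)
    show ?case
    proof (cases "eps \<mu> T = \<epsilon>")
      case True
      obtain u where u: "u \<in> low (eps \<mu> T) \<mu>"
        "a \<otimes> C \<mu> S T = (\<Oplus>S'\<in>M \<mu>. act a \<mu> S' S \<odot> C \<mu> S' T) \<oplus> u"
        using mult_C_act[OF base(2-4) assms(3)] .
      have "(\<Oplus>S'\<in>M \<mu>. act a \<mu> S' S \<odot> C \<mu> S' T) \<in> low \<epsilon> \<nu>"
        using base assms finite_M
        by (intro submodule_finsum cspan_submodule[OF sub])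
           (auto intro!: cspan_smult[OF sub] C_in_cspan[OF sub] act_closed)
      moreover have "u \<in> low \<epsilon> \<nu>"
        using u(1) True cspan_mono[OF below_mono[OF assms(1) base(1)]] by auto
      ultimately show ?thesis
        using u(2) True base assms cspan_add[OF sub] by (simp add: C_E)
    next
      case False
      then show ?thesis using base assms cspan_zero[OF sub] by (simp add: C_E)
    qed
  next
    case (add x y)
    then show ?case using cspan_add[OF sub] assms by (simp add: l_distr r_distr)
  next
    case (smult c x)
    then show ?case using cspan_smult[OF sub] assms by (simp add: smult_mult_left smult_mult_right)
  qed
qed

text \<open>In the cell module of \<open>k\<close>, the basis vector indexed by \<open>S\<close> is
  not annihilated by \<open>fi i\<close>.\<close>

definition z :: "'v \<Rightarrow> 'x \<Rightarrow> 's \<Rightarrow> bool" where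
  "z i k S \<longleftrightarrow> (\<exists>S'\<in>M k. act (fi i) k S' S \<noteq> \<zero>\<^bsub>K\<^esub>)"

lemma fi_C_eps:
  assumes "i \<in> V" "k \<in> X" "S \<in> M k" "T \<in> M k"
  shows "eps k S \<noteq> ei i \<Longrightarrow> fi i \<otimes> C k S T = \<zero>" "eps k T \<noteq> ei i \<Longrightarrow> C k S T \<otimes> fi i = \<zero>"
proof -
  have f: "fi i \<otimes> ei i = fi i" "ei i \<otimes> fi i = fi i" "fi i \<in> carrier R" "ei i \<in> E"
    using cornerD[OF fi_corner[OF assms(1)]] ei_E[OF assms(1)] by auto
  have "fi i \<otimes> C k S T = fi i \<otimes> (ei i \<otimes> C k S T)"
    using f assms by (metis C_closed E_carrier m_assoc)
  then show "eps k S \<noteq> ei i \<Longrightarrow> fi i \<otimes> C k S T = \<zero>" using assms f by (simp add: E_C)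
  have "C k S T \<otimes> fi i = (C k S T \<otimes> ei i) \<otimes> fi i"
    using f assms by (metis C_closed E_carrier m_assoc)
  then show "eps k T \<noteq> ei i \<Longrightarrow> C k S T \<otimes> fi i = \<zero>" using assms f by (simp add: C_E)
qed

lemma z_eps:
  assumes "i \<in> V" "k \<in> X" "S \<in> M k" "z i k S"
  shows "eps k S = ei i"
proof (rule ccontr)
  assume "eps k S \<noteq> ei i"
  then have "act (fi i) k S' S = \<zero>\<^bsub>K\<^esub>" if "S' \<in> M k" for S'
    using that assms by (simp add: act_def fi_C_eps ccoord_zero)
  then show False using assms(4) by (auto simp: z_def)
qed

lemma not_z_low:
  assumes "i \<in> V" "k \<in> X" "S \<in> M k" "T \<in> M k" "\<not> z i k S"
  shows "fi i \<otimes> C k S T \<in> low (eps k T) k"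
proof -
  obtain u where u: "u \<in> low (eps k T) k" "fi i \<otimes> C k S T = (\<Oplus>S'\<in>M k. act (fi i) k S' S \<odot> C k S' T) \<oplus> u"
    using mult_C_act[OF assms(2-4) fi_closed[OF assms(1)]] .
  have "(\<Oplus>S'\<in>M k. act (fi i) k S' S \<odot> C k S' T) = (\<Oplus>S'\<in>M k. \<zero>)"
    using assms by (intro M.finsum_cong') (auto simp: z_def smult_l_null)
  moreover have "u \<in> carrier R"
    using u(1) cspan_closed[OF below_subset] eps_in_E[OF assms(2,4)] by blast
  ultimately show ?thesis using u by simp
qed

text \<open>For want of a row or of a column, the component has no part in the cell \<open>k\<close>
  itself. The point is that the rest is low for the order of \<open>ei j\<close>, also when it is
  the column that fails.\<close>

lemma peirce_low:
  assumes "i \<in> V" "j \<in> V" "k \<in> X" "S \<in> M k" "T \<in> M k" "\<not> z i k S \<or> \<not> z j k T"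
  shows "fi i \<otimes> C k S T \<otimes> fi j \<in> low (ei j) k"
proof -
  note c = fi_closed[OF assms(1)] fi_closed[OF assms(2)]
  note ej = ei_E[OF assms(2)]
  note sub = below_subset[OF ej, of k]
  have C: "C k S T \<in> carrier R" "C k T S \<in> carrier R" using assms by auto
  show ?thesis
  proof (cases "eps k T = ei j")
    case False
    have "fi i \<otimes> C k S T \<otimes> fi j = fi i \<otimes> (C k S T \<otimes> fi j)" using c C by (simp add: m_assoc)
    then show ?thesis using fi_C_eps(2)[OF assms(2-5) False] c cspan_zero[OF sub] by simp
  next
    case True
    show ?thesis
    proof (cases "z i k S")
      case False
      then show ?thesis
        using not_z_low[OF assms(1,3,4,5)] low_corner[OF ej fi_corner[OF assms(2)]] True by simp
    next
      case zi: True
      then have nz: "\<not> z j k T" using assms(6) by simp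
      \<comment> \<open>Here \<open>not_z_low\<close> would only give the order of
        \<open>eps k S\<close>, which is attached to the vertex \<open>i\<close>. Instead,
        \<open>corner_C_upto\<close> bounds the element by \<open>k\<close> for the order of
        \<open>ei j\<close>, and its coordinates in \<open>k\<close> vanish by
        \<open>nz\<close>.\<close>
      have fjC: "fi j \<otimes> C k T S \<in> low (ei j) k"
      proof (subst in_cspan_iff[OF sub], goal_cases)
        case 1
        then show ?case using c C by simp
      next
        case 2
        show ?case
        proof (intro ballI impI)
          fix q assume q: "q \<in> Cidx" "fst q \<notin> below (ei j) k"
          obtain \<mu> U W where qq: "q = (\<mu>, U, W)" by (cases q)
          show "ccoord q (fi j \<otimes> C k T S) = \<zero>\<^bsub>K\<^esub>"
          proof (cases "\<mu> = k")
            case True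
            then have "\<mu> \<in> X" "U \<in> M k" "W \<in> M k" using q qq by auto
            then show ?thesis
              using nz True qq assms c ccoord_mult_C[OF assms(3,5,4) _ _ c(2), of U W]
              by (auto simp: z_def)
          next
            case False
            then have "fst q \<notin> {\<mu>. (\<mu>, k) \<in> leq (ei j)}" using q qq by (auto simp: below_def)
            then show ?thesis
              using ccoord_cspan[OF upto_subset[OF ej] corner_C_upto[OF assms(3,5,4) ej fi_corner[OF assms(2)]] q(1)]
              by simp
          qed
        qed
      qed
      have "star (fi j \<otimes> C k T S) = C k S T \<otimes> fi j"
        using c C assms by (simp add: star_mult star_C fi_star)
      then have "C k S T \<otimes> fi j \<in> low (ei j) k" using star_cspan[OF sub fjC] by simp
      then have "fi i \<otimes> ((C k S T \<otimes> fi j) \<otimes> ei j) \<in> low (ei j) k"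
        using low_left_ideal[OF ej] c by blast
      moreover have "(C k S T \<otimes> fi j) \<otimes> ei j = C k S T \<otimes> fi j"
        using c C ej cornerD[OF fi_corner[OF assms(2)]] by (simp add: m_assoc)
      ultimately show ?thesis using c C by (simp add: m_assoc)
    qed
  qed
qed

text \<open>At suitable indices the coordinate is the product of a non-zero matrix entry of each of
  the two idempotents.\<close>

lemma peirce_not_low:
  assumes "i \<in> V" "j \<in> V" "k \<in> X" "S \<in> M k" "T \<in> M k" "z i k S" "z j k T"
  shows "\<exists>U\<in>M k. \<exists>W\<in>M k. ccoord (k, U, W) (fi i \<otimes> C k S T \<otimes> fi j) \<noteq> \<zero>\<^bsub>K\<^esub>"
    and "fi i \<otimes> C k S T \<otimes> fi j \<notin> low (ei j) k" and "fi i \<otimes> C k S T \<otimes> fi j \<noteq> \<zero>"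
proof -
  obtain U W where UW: "U \<in> M k" "W \<in> M k" "act (fi i) k U S \<noteq> \<zero>\<^bsub>K\<^esub>" "act (fi j) k W T \<noteq> \<zero>\<^bsub>K\<^esub>"
    using assms by (auto simp: z_def)
  have "ccoord (k, U, W) (fi i \<otimes> C k S T \<otimes> fi j) = act (fi i) k U S \<otimes>\<^bsub>K\<^esub> act (fi j) k W T"
    using ccoord_two_sided[OF assms(3-5) UW(1,2) fi_closed[OF assms(1)] z_eps[OF assms(2,3,5,7)] fi_corner[OF assms(2)]]
    by (simp add: fi_star assms)
  moreover have "\<dots> \<noteq> \<zero>\<^bsub>K\<^esub>"
    using UW domain.integral[OF K_domain] act_closed[OF assms(3)] assms fi_closed by metis
  ultimately have nz: "ccoord (k, U, W) (fi i \<otimes> C k S T \<otimes> fi j) \<noteq> \<zero>\<^bsub>K\<^esub>" by simp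
  show "\<exists>U\<in>M k. \<exists>W\<in>M k. ccoord (k, U, W) (fi i \<otimes> C k S T \<otimes> fi j) \<noteq> \<zero>\<^bsub>K\<^esub>"
    using nz UW by blast
  have i: "(k, U, W) \<in> Cidx" using UW assms by simp
  show "fi i \<otimes> C k S T \<otimes> fi j \<notin> low (ei j) k"
    using nz ccoord_cspan[OF below_subset[OF ei_E[OF assms(2)]] _ i] by (auto simp: below_def)
  show "fi i \<otimes> C k S T \<otimes> fi j \<noteq> \<zero>" using nz ccoord_zero[OF i] by auto
qed

end


section \<open>Vertices occurring in cells\<close>

context zigzag_cell_datum
begin

text \<open>In terms of representations: the simple module at \<open>i\<close> is a composition factor of the
  cell module of \<open>k\<close>.\<close>

definition rel :: "'v \<Rightarrow> 'x \<Rightarrow> bool" where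
  "rel i k \<longleftrightarrow> k \<in> X \<and> (\<exists>S\<in>M k. z i k S)"

lemma sandwich_fi_zero:
  assumes "i \<in> V" "j \<in> V" "Y \<subseteq> X" "y \<in> cspan Y"
    and "\<And>\<mu> S T. \<mu> \<in> Y \<Longrightarrow> S \<in> M \<mu> \<Longrightarrow> T \<in> M \<mu> \<Longrightarrow> fi i \<otimes> C \<mu> S T \<otimes> fi j = \<zero>"
  shows "fi i \<otimes> y \<otimes> fi j = \<zero>"
  using assms(4,3)
proof (induction rule: cspan_induct)
  case (add x y)
  then show ?case using fi_closed assms(1,2) by (simp add: l_distr r_distr)
next
  case (smult c x)
  then show ?case using fi_closed assms(1,2) by (simp add: smult_mult_left smult_mult_right)
qed (use assms fi_closed in auto)

text \<open>Among the cells of \<open>Y\<close> with a non-zero component take one that is minimal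
  for \<open>ei j\<close>. Were its component a combination of lower cells, multiplying once more by
  the two idempotents would leave it unchanged and yet kill it. Hence \<open>peirce_low\<close>
  provides both vertices.\<close>

lemma peirce_witness:
  assumes "i \<in> V" "j \<in> V" "Y \<subseteq> X" "\<And>\<kappa>. \<kappa> \<in> Y \<Longrightarrow> below (ei j) \<kappa> \<subseteq> Y"
    and "y \<in> cspan Y" "fi i \<otimes> y \<otimes> fi j \<noteq> \<zero>"
  shows "\<exists>\<kappa>\<in>Y. \<exists>S\<in>M \<kappa>. \<exists>T\<in>M \<kappa>. z i \<kappa> S \<and> z j \<kappa> T"
proof -
  define P where "P \<kappa> \<longleftrightarrow> \<kappa> \<in> Y \<and> (\<exists>S\<in>M \<kappa>. \<exists>T\<in>M \<kappa>. fi i \<otimes> C \<kappa> S T \<otimes> fi j \<noteq> \<zero>)" for \<kappa>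
  note c = fi_closed[OF assms(1)] fi_closed[OF assms(2)]
  have "\<exists>\<nu>. P \<nu>" using sandwich_fi_zero[OF assms(1,2,3,5)] assms(6) unfolding P_def by blast
  then obtain \<nu> where "P \<nu>" by blast
  moreover have "\<And>\<nu>. P \<nu> \<Longrightarrow> \<nu> \<in> X \<and> M \<nu> \<noteq> {}" using assms(3) by (auto simp: P_def)
  ultimately obtain \<kappa> where \<kappa>: "P \<kappa>" "\<And>\<mu>. \<mu> \<in> below (ei j) \<kappa> \<Longrightarrow> \<not> P \<mu>"
    using minimal_cell[OF ei_E[OF assms(2)]] by blast
  then obtain S T where ST: "S \<in> M \<kappa>" "T \<in> M \<kappa>" "fi i \<otimes> C \<kappa> S T \<otimes> fi j \<noteq> \<zero>"
    and kY: "\<kappa> \<in> Y" by (auto simp: P_def)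
  have kX: "\<kappa> \<in> X" using kY assms(3) by blast
  have "fi i \<otimes> C \<kappa> S T \<otimes> fi j \<notin> low (ei j) \<kappa>"
  proof
    assume low: "fi i \<otimes> C \<kappa> S T \<otimes> fi j \<in> low (ei j) \<kappa>"
    have "fi i \<otimes> (fi i \<otimes> C \<kappa> S T \<otimes> fi j) \<otimes> fi j = \<zero>"
      using \<kappa>(2) assms(4)[OF kY]
      by (intro sandwich_fi_zero[OF assms(1,2) below_subset[OF ei_E[OF assms(2)]] low]) (auto simp: P_def)
    moreover have "fi i \<otimes> (fi i \<otimes> C \<kappa> S T \<otimes> fi j) \<otimes> fi j = fi i \<otimes> C \<kappa> S T \<otimes> fi j"
      using peirceI[OF fi_lift assms(1,2), of "C \<kappa> S T"] kX ST c by (simp add: peirce_def)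
    ultimately show False using ST(3) by simp
  qed
  then have "z i \<kappa> S" "z j \<kappa> T" using peirce_low[OF assms(1,2) kX ST(1,2)] by blast+
  then show ?thesis using kY ST by blast
qed

lemma upto_corner:
  assumes "\<epsilon> \<in> E" "corner \<epsilon> a" "x \<in> cspan {\<mu>. (\<mu>, \<nu>) \<in> leq \<epsilon>}"
  shows "x \<otimes> a \<in> cspan {\<mu>. (\<mu>, \<nu>) \<in> leq \<epsilon>}"
proof -
  note sub = upto_subset[OF assms(1), of \<nu>]
  have left: "b \<otimes> y \<in> cspan {\<mu>. (\<mu>, \<nu>) \<in> leq \<epsilon>}"
    if "corner \<epsilon> b" "y \<in> cspan {\<mu>. (\<mu>, \<nu>) \<in> leq \<epsilon>}" for b y
    using that(2) sub
  proof (induction rule: cspan_induct)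
    case zero
    then show ?case using cspan_zero[OF sub] that(1) by (simp add: corner_def)
  next
    case (base \<mu> S T)
    have "{\<kappa>. (\<kappa>, \<mu>) \<in> leq \<epsilon>} \<subseteq> {\<mu>. (\<mu>, \<nu>) \<in> leq \<epsilon>}"
      using base(1) leq_trans[OF assms(1)] by blast
    then show ?case using corner_C_upto[OF base(2-4) assms(1) that(1)] cspan_mono by blast
  next
    case (add x y)
    then show ?case using cspan_add[OF sub] that(1) by (simp add: r_distr corner_def)
  next
    case (smult c x)
    then show ?case using cspan_smult[OF sub] that(1) by (simp add: smult_mult_right corner_def)
  qed
  have c: "x \<in> carrier R" "a \<in> carrier R"
    using cspan_closed[OF sub assms(3)] assms(2) by (auto simp: corner_def)
  have "star (star a \<otimes> star x) \<in> cspan {\<mu>. (\<mu>, \<nu>) \<in> leq \<epsilon>}"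
    using assms by (intro star_cspan[OF sub] left corner_star)
  then show ?thesis using c by (simp add: star_mult)
qed

text \<open>The element w = f_i C_SS f_i lies in the cells up to the head and equals \<beta> f_i - y
  with \<beta> non-zero and y^2 = 0. Then w(\<beta> f_i + y) = \<beta>^2 f_i still lies in these
  cells and is a non-zero multiple of f_i.\<close>

lemma fi_upto:
  assumes "i \<in> V"
  shows "fi i \<in> cspan {\<mu>. (\<mu>, lam i) \<in> leq (ei i)}"
proof -
  let ?U = "cspan {\<mu>. (\<mu>, lam i) \<in> leq (ei i)}"
  note ej = ei_E[OF assms] and f = fi_closed[OF assms] and lX = lam_X[OF assms]
  note fc = cornerD[OF fi_corner[OF assms]]
  note sub = upto_subset[OF ej, of "lam i"]
  obtain S where S: "S \<in> M (lam i)" "co (Ev i) (C (lam i) S S) \<noteq> \<zero>\<^bsub>K\<^esub>"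
    using head_form(1)[OF char_Ev[OF assms] head_lam[OF assms]] by blast
  define w where "w = fi i \<otimes> C (lam i) S S \<otimes> fi i"
  define \<beta> where "\<beta> = co (Ev i) w"
  have C: "C (lam i) S S \<in> carrier R" using S lX by simp
  have w: "w \<in> carrier R" using f C by (simp add: w_def)
  have pw: "fi i \<otimes> w = w" "w \<otimes> fi i = w"
    using peirceI[OF fi_lift assms assms C] by (auto simp: w_def peirce_def)
  have wU: "w \<in> ?U"
    unfolding w_def using upto_corner[OF ej fi_corner[OF assms]]
      corner_C_upto[OF lX S(1,1) ej fi_corner[OF assms]] by blast
  have \<beta>: "\<beta> \<in> carrier K" "\<beta> = co (Ev i) (C (lam i) S S)"
    using w C f assms by (auto simp: \<beta>_def w_def co_mult_E fi_co co_closed)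
  define y where "y = \<beta> \<odot> fi i \<ominus> w"
  have y: "y \<in> carrier R" using w f \<beta> by (simp add: y_def)
  have py: "peirce fi i i y"
    using w f \<beta> y pw fi_idem[OF assms] unfolding peirce_def
    by (simp add: y_def minus_eq r_distr l_distr smult_mult_left smult_mult_right r_minus l_minus)
  have "co (Ev i) y = \<zero>\<^bsub>K\<^esub>"
    using w f \<beta> assms by (simp add: y_def co_minus co_smult fi_co \<beta>_def[symmetric] R.minus_eq R.r_neg)
  then have yy: "y \<otimes> y = \<zero>" using peirce_diag_square[OF fi_lift assms py] by simp
  have wy: "w = \<beta> \<odot> fi i \<ominus> y"
    unfolding y_def using w f \<beta> by (simp add: minus_eq minus_add r_neg2)
  have py': "fi i \<otimes> y = y" using py by (simp add: peirce_def)
  have "w \<otimes> (\<beta> \<odot> fi i \<oplus> y) = (\<beta> \<odot> fi i \<ominus> y) \<otimes> (\<beta> \<odot> fi i) \<oplus> (\<beta> \<odot> fi i \<ominus> y) \<otimes> y"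
    using w f \<beta> y unfolding wy by (simp add: r_distr)
  also have "(\<beta> \<odot> fi i \<ominus> y) \<otimes> y = \<beta> \<odot> y"
    using f \<beta> y yy py' by (simp add: minus_eq l_distr smult_mult_left l_minus)
  also have "(\<beta> \<odot> fi i \<ominus> y) \<otimes> (\<beta> \<odot> fi i) = \<beta> \<odot> w"
    using w f \<beta> pw unfolding wy[symmetric] by (simp add: smult_mult_right)
  also have "\<beta> \<odot> w \<oplus> \<beta> \<odot> y = \<beta> \<odot> (\<beta> \<odot> fi i)"
    using w f \<beta> y by (simp add: smult_r_distr[symmetric] y_def minus_eq a_comm r_neg2)
  finally have eq: "w \<otimes> (\<beta> \<odot> fi i \<oplus> y) = (\<beta> \<otimes>\<^bsub>K\<^esub> \<beta>) \<odot> fi i"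
    using f \<beta> by (simp add: smult_assoc1)
  have "corner (ei i) (\<beta> \<odot> fi i \<oplus> y)"
  proof -
    have "ei i \<otimes> y = y" "y \<otimes> ei i = y"
      using py fc ej f y unfolding peirce_def by (metis E_carrier m_assoc)+
    then show ?thesis using fc ej f y \<beta>
      by (simp add: corner_def r_distr l_distr smult_mult_left smult_mult_right)
  qed
  then have "(\<beta> \<otimes>\<^bsub>K\<^esub> \<beta>) \<odot> fi i \<in> ?U" using upto_corner[OF ej _ wU] eq by metis
  moreover have "\<beta> \<otimes>\<^bsub>K\<^esub> \<beta> \<noteq> \<zero>\<^bsub>K\<^esub>" using \<beta> S domain.integral[OF K_domain] by metis
  ultimately show ?thesis
    using \<beta> f cspan_smult[OF sub, of "inv\<^bsub>K\<^esub> (\<beta> \<otimes>\<^bsub>K\<^esub> \<beta>)" "(\<beta> \<otimes>\<^bsub>K\<^esub> \<beta>) \<odot> fi i"]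
    by (simp add: smult_assoc1[symmetric] field_Units R.Units_l_inv)
qed

text \<open>A component f_i C_SS f_i is a multiple of f_i, so by \<open>fi_upto\<close> it lies in
  the cells up to the head. As it has a non-zero coordinate in \<open>k\<close>, this cell is one of
  them.\<close>

lemma rel_le_lam:
  assumes "i \<in> V" "rel i k"
  shows "(k, lam i) \<in> leq (ei i)"
proof (rule ccontr)
  assume neg: "(k, lam i) \<notin> leq (ei i)"
  note ej = ei_E[OF assms(1)]
  obtain S where S: "k \<in> X" "S \<in> M k" "z i k S" using assms by (auto simp: rel_def)
  define w where "w = fi i \<otimes> C k S S \<otimes> fi i"
  have "peirce fi i i w" using peirceI[OF fi_lift assms(1,1)] S by (simp add: w_def)
  then have w: "w = fi i \<otimes> w" "corner (ei i) w"
    using cornerD[OF fi_corner[OF assms(1)]] ej unfolding peirce_def corner_def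
    by (metis, metis E_carrier m_assoc)
  have "w \<in> cspan {\<mu>. (\<mu>, lam i) \<in> leq (ei i)}"
    using upto_corner[OF ej w(2) fi_upto[OF assms(1)]] w(1) by simp
  then have "ccoord (k, U, W) w = \<zero>\<^bsub>K\<^esub>" if "U \<in> M k" "W \<in> M k" for U W
    using ccoord_cspan[OF upto_subset[OF ej]] that neg S by auto
  then show False using peirce_not_low(1)[OF assms(1,1) S(1,2,2,3,3)] by (auto simp: w_def)
qed

text \<open>By \<open>rel_le_lam\<close> the cell \<open>k\<close> is strictly below the head, where
  \<chi>_i vanishes; so the component is nilpotent and lies on the line of x_i.\<close>

lemma rel_radical:
  assumes "i \<in> V" "k \<in> X" "S \<in> M k" "z i k S" "k \<noteq> lam i"
  defines "w \<equiv> fi i \<otimes> C k S S \<otimes> fi i"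
  shows "peirce fi i i w" "co (Ev i) w = \<zero>\<^bsub>K\<^esub>" "co (Xv i) w \<noteq> \<zero>\<^bsub>K\<^esub>" "w \<noteq> \<zero>"
    "w \<in> cspan {\<mu>. (\<mu>, k) \<in> leq (ei i)}"
proof -
  note ej = ei_E[OF assms(1)]
  have C: "C k S S \<in> carrier R" using assms by simp
  show p: "peirce fi i i w" using peirceI[OF fi_lift assms(1,1) C] by (simp add: w_def)
  show nz: "w \<noteq> \<zero>" using peirce_not_low(3)[OF assms(1,1-3,3,4,4)] by (simp add: w_def)
  have "k \<in> below (ei i) (lam i)"
    using rel_le_lam[of i k] assms by (auto simp: rel_def below_def)
  then have "co (Ev i) (C k S S) = \<zero>\<^bsub>K\<^esub>" using head_lam[OF assms(1)] assms by (auto simp: head_def)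
  then show E0: "co (Ev i) w = \<zero>\<^bsub>K\<^esub>"
    using assms(1) C fi_closed[OF assms(1)] by (simp add: w_def co_mult_E co_closed)
  show "co (Xv i) w \<noteq> \<zero>\<^bsub>K\<^esub>" using peirce_diag_zero[OF fi_lift assms(1) p E0] nz by blast
  show "w \<in> cspan {\<mu>. (\<mu>, k) \<in> leq (ei i)}"
    unfolding w_def using upto_corner[OF ej fi_corner[OF assms(1)]]
      corner_C_upto[OF assms(2,3,3) ej fi_corner[OF assms(1)]] by blast
qed

text \<open>Both cells yield non-zero elements in the nilpotent part of f_i R f_i, which is a line,
  so the two are proportional. The second lies in the cells up to \<open>k'\<close> and, like the
  first, has a non-zero coordinate in \<open>k\<close>; hence \<open>k\<close> is at most
  \<open>k'\<close>, and conversely.\<close>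

lemma rel_unique:
  assumes "i \<in> V" "rel i k" "k \<noteq> lam i" "rel i k'" "k' \<noteq> lam i"
  shows "k = k'"
proof -
  note ej = ei_E[OF assms(1)]
  have le: "(k, k') \<in> leq (ei i)" if rel: "rel i k" "k \<noteq> lam i" "rel i k'" "k' \<noteq> lam i" for k k'
  proof (rule ccontr)
    assume neg: "(k, k') \<notin> leq (ei i)"
    obtain S where S: "k \<in> X" "S \<in> M k" "z i k S" using rel by (auto simp: rel_def)
    obtain S' where S': "k' \<in> X" "S' \<in> M k'" "z i k' S'" using rel by (auto simp: rel_def)
    define w where "w = fi i \<otimes> C k S S \<otimes> fi i"
    define w' where "w' = fi i \<otimes> C k' S' S' \<otimes> fi i"
    note W = rel_radical[OF assms(1) S rel(2), folded w_def]
    note W' = rel_radical[OF assms(1) S' rel(4), folded w'_def]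
    have wc: "w \<in> carrier R" "w' \<in> carrier R" using W(1) W'(1) by (auto simp: peirce_def)
    obtain U T where UT: "U \<in> M k" "T \<in> M k" "ccoord (k, U, T) w \<noteq> \<zero>\<^bsub>K\<^esub>"
      using peirce_not_low(1)[OF assms(1,1) S(1,2,2,3,3)] by (auto simp: w_def)
    have i: "(k, U, T) \<in> Cidx" using UT S by simp
    have c0: "ccoord (k, U, T) w' = \<zero>\<^bsub>K\<^esub>"
      using ccoord_cspan[OF upto_subset[OF ej] W'(5) i] neg by simp
    have Xc: "co (Xv i) w \<in> carrier K" "co (Xv i) w' \<in> carrier K"
      using wc assms(1) by (auto simp: co_closed)
    have "ccoord (k, U, T) (co (Xv i) w' \<odot> w) = ccoord (k, U, T) (co (Xv i) w \<odot> w')"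
      using peirce_diag_dependent[OF fi_lift assms(1) W(1,2) W'(1,2)] by simp
    then have "co (Xv i) w' \<otimes>\<^bsub>K\<^esub> ccoord (k, U, T) w = \<zero>\<^bsub>K\<^esub>"
      using ccoord_smult[OF i] Xc wc c0 by simp
    then show False
      using domain.integral[OF K_domain _ Xc(2) ccoord_closed[OF i wc(1)]] UT(3) W'(3) by blast
  qed
  show ?thesis using le[OF assms(2-5)] le[OF assms(4,5,2,3)] leq_antisym[OF ej] by blast
qed

text \<open>A non-zero value would exhibit the vertex in a cell strictly below \<open>k\<close>,
  hence strictly below the head too, against \<open>rel_unique\<close>.\<close>

lemma rel_below_zero:
  assumes "i \<in> V" "rel i k" "k \<noteq> lam i" "y \<in> low (ei i) k"
  shows "fi i \<otimes> y \<otimes> fi i = \<zero>"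
proof (rule ccontr)
  assume nz: "fi i \<otimes> y \<otimes> fi i \<noteq> \<zero>"
  note ej = ei_E[OF assms(1)]
  obtain \<kappa> S where "\<kappa> \<in> below (ei i) k" "S \<in> M \<kappa>" "z i \<kappa> S"
    using peirce_witness[OF assms(1,1) below_subset[OF ej] below_mono[OF ej] assms(4) nz] by blast
  then have \<kappa>: "\<kappa> \<in> below (ei i) k" "rel i \<kappa>" using below_subset[OF ej] by (auto simp: rel_def)
  have "\<kappa> \<noteq> lam i"
    using \<kappa>(1) rel_le_lam[OF assms(1,2)] leq_antisym[OF ej] by (auto simp: below_def)
  then have "\<kappa> = k" using rel_unique[OF assms(1) \<kappa>(2) _ assms(2,3)] by blast
  then show False using \<kappa>(1) by (simp add: below_def)
qed

text \<open>For two distinct vertices the value \<open>t\<close> of the twisted form would have to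
  be non-zero, since it carries the product of the arrows back and forth, and zero, since it is the
  factor in v^2 = t v for some v that is non-zero with v^2 = 0.\<close>

lemma rel_tail_inj:
  assumes "i \<in> V" "j \<in> V" "rel i k" "rel j k" "k \<noteq> lam i" "k \<noteq> lam j"
  shows "i = j"
proof (rule ccontr)
  assume ij: "i \<noteq> j"
  note fc = fi_closed[OF assms(1)] fi_closed[OF assms(2)]
  obtain S where S: "k \<in> X" "S \<in> M k" "z i k S" using assms by (auto simp: rel_def)
  obtain T where T: "T \<in> M k" "z j k T" using assms by (auto simp: rel_def)
  have C: "C k S T \<in> carrier R" "C k T S \<in> carrier R" "C k S S \<in> carrier R" "C k T T \<in> carrier R"
    using S T by auto
  define t where "t = form (fi j) k T T"
  have tc: "t \<in> carrier K" using form_closed S T fc by (simp add: t_def)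
  define x where "x = fi i \<otimes> C k S T \<otimes> fi j"
  define y where "y = fi j \<otimes> C k T S \<otimes> fi i"
  have px: "peirce fi i j x" "peirce fi j i y"
    using peirceI[OF fi_lift] assms C by (auto simp: x_def y_def)
  have nz: "x \<noteq> \<zero>" "y \<noteq> \<zero>"
    using peirce_not_low(3)[OF assms(1,2) S(1,2) T(1) S(3) T(2)]
      peirce_not_low(3)[OF assms(2,1) S(1) T(1) S(2) T(2) S(3)] by (auto simp: x_def y_def)
  have adj: "adj i j" and A: "co (Ar i j) x \<noteq> \<zero>\<^bsub>K\<^esub>" "co (Ar j i) y \<noteq> \<zero>\<^bsub>K\<^esub>"
    using peirce_off_diag[OF fi_lift assms(1,2) ij px(1) nz(1)]
      peirce_off_diag[OF fi_lift assms(2,1) ij[symmetric] px(2) nz(2)] by auto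
  have xc: "x \<in> carrier R" "y \<in> carrier R" using px by (auto simp: peirce_def)
  have "co (Xv i) (x \<otimes> y) \<noteq> \<zero>\<^bsub>K\<^esub>"
    using peirce_mult_X[OF fi_lift adj px] A domain.integral[OF K_domain] co_closed adj adj_sym xc
    by (metis zz_index_simps(3))
  then have xy: "x \<otimes> y \<noteq> \<zero>" using co_zero[of "Xv i"] assms(1) by auto
  have z1: "eps k S = ei i" "eps k T = ei j" using z_eps S T assms by auto
  \<comment> \<open>Modulo lower cells, which vanish between two factors f_i by
    \<open>rel_below_zero\<close>, the product \<open>x \<otimes> y\<close> is \<open>t\<close>
    times the component of \<open>C k S S\<close>; and this product is non-zero.\<close>
  have t0: "t \<noteq> \<zero>\<^bsub>K\<^esub>"
  proof
    assume "t = \<zero>\<^bsub>K\<^esub>"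
    obtain u where u: "u \<in> low (eps k S) k" "C k S T \<otimes> fi j \<otimes> C k T S = t \<odot> C k S S \<oplus> u"
      using sandwich[OF S(1,2) T(1,1) S(2) fc(2)] by (auto simp: t_def)
    then have "C k S T \<otimes> fi j \<otimes> C k T S \<in> low (ei i) k"
      using \<open>t = \<zero>\<^bsub>K\<^esub>\<close> z1 C cspan_closed[OF below_subset[OF ei_E[OF assms(1)]]] by (simp add: smult_l_null)
    then have "fi i \<otimes> (C k S T \<otimes> fi j \<otimes> C k T S) \<otimes> fi i = \<zero>"
      using rel_below_zero[OF assms(1,3,5)] by blast
    moreover have "x \<otimes> y = fi i \<otimes> (C k S T \<otimes> ((fi j \<otimes> fi j) \<otimes> C k T S)) \<otimes> fi i"
      unfolding x_def y_def using fc C by (simp add: m_assoc)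
    ultimately show False using xy fc C fi_idem[OF assms(2)] by (simp add: m_assoc)
  qed
  \<comment> \<open>The component of \<open>C k T T\<close> squares to \<open>t\<close> times
    itself, again up to terms that vanish between two factors f_j.\<close>
  define v where "v = fi j \<otimes> C k T T \<otimes> fi j"
  have W: "peirce fi j j v" "co (Ev j) v = \<zero>\<^bsub>K\<^esub>" "v \<noteq> \<zero>"
    using rel_radical[OF assms(2) S(1) T assms(6)] by (auto simp: v_def)
  have vc: "v \<in> carrier R" using fc C by (simp add: v_def)
  obtain u where u: "u \<in> low (eps k T) k" "C k T T \<otimes> fi j \<otimes> C k T T = t \<odot> C k T T \<oplus> u"
    using sandwich[OF S(1) T(1,1,1,1) fc(2)] by (auto simp: t_def)
  have uc: "u \<in> carrier R"
    using u(1) z1 cspan_closed[OF below_subset[OF ei_E[OF assms(2)]]] by simp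
  have "fi j \<otimes> u \<otimes> fi j = \<zero>" using rel_below_zero[OF assms(2,4,6)] u(1) z1 by simp
  then have "fi j \<otimes> (t \<odot> C k T T \<oplus> u) \<otimes> fi j = t \<odot> v"
    using fc C uc tc by (simp add: v_def r_distr l_distr smult_mult_left smult_mult_right)
  moreover have "v \<otimes> v = fi j \<otimes> (C k T T \<otimes> (fi j \<otimes> fi j) \<otimes> C k T T) \<otimes> fi j"
    unfolding v_def using fc C by (simp add: m_assoc)
  ultimately have "v \<otimes> v = t \<odot> v" using u(2) by (simp only: fi_idem[OF assms(2)])
  then have "t \<odot> v = \<zero>" using peirce_diag_square[OF fi_lift assms(2) W(1,2)] by simp
  then have "inv\<^bsub>K\<^esub> t \<odot> (t \<odot> v) = \<zero>" using tc t0 by (simp add: field_Units)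
  then have "v = \<zero>" using tc t0 vc by (simp add: smult_assoc1[symmetric] field_Units R.Units_l_inv)
  then show False using W(3) by simp
qed

text \<open>The component of the arrow between f_i and f_j is non-zero, so some cell must make it
  visible.\<close>

lemma adj_rel:
  assumes "adj i j"
  shows "\<exists>k. rel i k \<and> rel j k"
proof -
  have ij: "i \<in> V" "j \<in> V" using adj_V[OF assms] by auto
  have "bas (Ar i j) \<in> cspan X" using cspan_all assms by simp
  then obtain k S T where "k \<in> X" "S \<in> M k" "T \<in> M k" "z i k S" "z j k T"
    using peirce_witness[OF ij subset_refl below_subset[OF ei_E[OF ij(2)]] _ peirce_arrow[OF fi_lift assms]]
    by blast
  then show ?thesis by (auto simp: rel_def)
qed

text \<open>A cell shared by two adjacent vertices is the head cell of exactly one of them;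
  \<open>N i j\<close> says that it is the head cell of \<open>j\<close>.\<close>

theorem adjacency_is_partial_injection:
  obtains N where "\<And>i j. adj i j \<longleftrightarrow> N i j \<or> N j i"
    "\<And>i j k. N i j \<Longrightarrow> N i k \<Longrightarrow> j = k" "\<And>i j k. N i k \<Longrightarrow> N j k \<Longrightarrow> i = j"
    "E = {\<one>} \<Longrightarrow> acyclic {(i, j). N i j}"
proof -
  define N where "N i j \<longleftrightarrow> adj i j \<and> rel i (lam j)" for i j
  have NV: "i \<in> V" "j \<in> V" "lam j \<noteq> lam i" if "N i j" for i j
    using that adj_V lam_inj adj_irrefl unfolding N_def by metis+
  have N1: "adj i j \<longleftrightarrow> N i j \<or> N j i" for i j
  proof
    assume a: "adj i j"
    then have ij: "i \<in> V" "j \<in> V" "i \<noteq> j" using adj_V adj_irrefl by blast+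
    obtain k where k: "rel i k" "rel j k" using adj_rel[OF a] by blast
    then have "k = lam i \<or> k = lam j" using rel_tail_inj[OF ij(1,2)] ij(3) by blast
    then show "N i j \<or> N j i" using a k adj_sym by (auto simp: N_def)
  qed (auto simp: N_def dest: adj_sym)
  \<comment> \<open>Two successors of \<open>i\<close> would give two cells besides its head in
    which \<open>i\<close> occurs. In \<open>N3\<close>, two predecessors of \<open>k\<close> would
    occur in the head cell of \<open>k\<close>, which is the head of neither.\<close>
  have N2: "j = k" if "N i j" "N i k" for i j k
    using rel_unique[of i "lam j" "lam k"] NV[OF that(1)] NV[OF that(2)] that lam_inj
    by (auto simp: N_def)
  have N3: "i = j" if "N i k" "N j k" for i j k
    using rel_tail_inj[of i j "lam k"] NV[OF that(1)] NV[OF that(2)] that by (auto simp: N_def)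
  have N4: "acyclic {(i, j). N i j}" if "E = {\<one>}"
  proof -
    have below_lam: "lam j \<in> below \<one> (lam i)" if "N i j" for i j
      using rel_le_lam[of i "lam j"] NV[OF that] that ei_E[of i] \<open>E = {\<one>}\<close>
      by (auto simp: N_def below_def)
    have oneE: "\<one> \<in> E" using that by simp
    have "lam j \<in> below \<one> (lam i)" if "(i, j) \<in> {(i, j). N i j}\<^sup>+" for i j
      using that
    proof (induction rule: trancl_induct)
      case (step j k)
      then have "lam k \<in> below \<one> (lam j)" using below_lam by blast
      then show ?case using below_mono[OF oneE step(3)] by blast
    qed (use below_lam in auto)
    then show ?thesis by (auto simp: acyclic_def below_def)
  qed
  show ?thesis by (rule that[OF N1 N2 N3 N4])
qed

end


section \<open>Constructing relative cell data\<close>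

fun zz_flip :: "'v zz \<Rightarrow> 'v zz" where
  "zz_flip (Ev i) = Ev i" | "zz_flip (Xv i) = Xv i" | "zz_flip (Ar i j) = Ar j i"

fun zz_src :: "'v zz \<Rightarrow> 'v" where
  "zz_src (Ev i) = i" | "zz_src (Xv i) = i" | "zz_src (Ar i j) = i"

fun zz_tgt :: "'v zz \<Rightarrow> 'v" where
  "zz_tgt (Ev i) = i" | "zz_tgt (Xv i) = i" | "zz_tgt (Ar i j) = j"

lemma zz_flip_flip [simp]: "zz_flip (zz_flip d) = d"
  by (cases d) auto

section \<open>Path reversal and the standard basis\<close>

context zigzag_coordinates
begin

lemma zz_flip_index [simp]: "zz_flip d \<in> zz_index V adj \<longleftrightarrow> d \<in> zz_index V adj"
  by (cases d) (auto dest: adj_sym)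

text \<open>Path reversal, expressed in coordinates; it reverses products because the multiplication
  table is symmetric under reversal.\<close>

definition flip :: "'a \<Rightarrow> 'a" where
  "flip x = (\<Oplus>d\<in>zz_index V adj. co (zz_flip d) x \<odot> bas d)"

lemma flip_closed: "x \<in> carrier R \<Longrightarrow> flip x \<in> carrier R"
  unfolding flip_def by (intro M.finsum_closed) (auto simp: co_closed)

lemma co_flip: "\<lbrakk>x \<in> carrier R; d \<in> zz_index V adj\<rbrakk> \<Longrightarrow> co d (flip x) = co (zz_flip d) x"
  unfolding flip_def
  by (subst co_finsum_bas[where g = "\<lambda>d. co (zz_flip d) x"]) (auto simp: co_closed)

lemma flip_bas: "d \<in> zz_index V adj \<Longrightarrow> flip (bas d) = bas (zz_flip d)"
proof (rule co_eqI)
  fix c assume "d \<in> zz_index V adj" "c \<in> zz_index V adj"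
  then show "co c (flip (bas d)) = co c (bas (zz_flip d))"
    by (cases c; cases d) (auto simp: co_flip co_bas adj_sym)
qed (auto simp: flip_closed)

lemma flip_mult:
  assumes "x \<in> carrier R" "y \<in> carrier R"
  shows "flip (x \<otimes> y) = flip y \<otimes> flip x"
proof (rule co_eqI)
  note fc = flip_closed[OF assms(1)] flip_closed[OF assms(2)]
  show "flip (x \<otimes> y) \<in> carrier R" "flip y \<otimes> flip x \<in> carrier R" using assms fc by (auto simp: flip_closed)
  fix d assume d: "d \<in> zz_index V adj"
  show "co d (flip (x \<otimes> y)) = co d (flip y \<otimes> flip x)"
  proof (cases d)
    case (Ev i)
    then show ?thesis using d assms fc by (simp add: co_flip co_mult_E co_closed R.m_comm)
  next
    case (Ar i j)
    then have "adj i j" "adj j i" "i \<in> V" "j \<in> V" using d adj_sym adj_V by auto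
    then show ?thesis using Ar assms fc
      by (simp add: co_flip co_mult_A co_closed R.m_comm R.a_comm)
  next
    case (Xv i)
    then have i: "i \<in> V" using d by simp
    have "(\<Oplus>\<^bsub>K\<^esub>j\<in>{j. adj i j}. co (Ar i j) x \<otimes>\<^bsub>K\<^esub> co (Ar j i) y)
        = (\<Oplus>\<^bsub>K\<^esub>j\<in>{j. adj i j}. co (Ar i j) (flip y) \<otimes>\<^bsub>K\<^esub> co (Ar j i) (flip x))"
      using assms fc adj_sym by (intro R.finsum_cong') (auto simp: co_flip co_closed R.m_comm)
    moreover have "(\<Oplus>\<^bsub>K\<^esub>j\<in>{j. adj i j}. co (Ar i j) (flip y) \<otimes>\<^bsub>K\<^esub> co (Ar j i) (flip x)) \<in> carrier K"
      using fc adj_sym by (intro R.finsum_closed) (auto simp: co_closed)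
    ultimately show ?thesis using Xv i assms fc
      by (simp add: co_flip co_mult_X co_closed R.m_comm R.a_comm)
  qed
qed

lemma anti_involution_flip: "anti_involution K R flip"
  unfolding anti_involution_def
proof (intro conjI ballI)
  show "flip \<in> LinearCombinations.module_hom K R R"
    unfolding LinearCombinations.module_hom_def
    by (auto simp: flip_closed co_flip co_add co_smult intro!: co_eqI)
qed (auto simp: flip_mult flip_closed co_flip intro!: co_eqI)

lemma co_mult_bas_Ev:
  assumes "d \<in> zz_index V adj" "i \<in> V" "y \<in> carrier R"
  shows "co d (bas (Ev i) \<otimes> y) = (if zz_src d = i then co d y else \<zero>\<^bsub>K\<^esub>)"
    and "co d (y \<otimes> bas (Ev i)) = (if zz_tgt d = i then co d y else \<zero>\<^bsub>K\<^esub>)"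
proof -
  have "co d (bas (Ev i) \<otimes> y) = (if zz_src d = i then co d y else \<zero>\<^bsub>K\<^esub>)
      \<and> co d (y \<otimes> bas (Ev i)) = (if zz_tgt d = i then co d y else \<zero>\<^bsub>K\<^esub>)"
  proof (cases d)
    case (Ar j l)
    then have "j \<in> V" "l \<in> V" "adj j l" using assms adj_V by auto
    then show ?thesis using Ar assms by (auto simp: co_mult_A co_bas co_closed)
  qed (use assms adj_sym in \<open>auto simp: co_mult_E co_X_plain co_bas co_closed\<close>)
  then show "co d (bas (Ev i) \<otimes> y) = (if zz_src d = i then co d y else \<zero>\<^bsub>K\<^esub>)"
    "co d (y \<otimes> bas (Ev i)) = (if zz_tgt d = i then co d y else \<zero>\<^bsub>K\<^esub>)" by auto
qed

lemma bas_Ev_bas: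
  assumes "d \<in> zz_index V adj" "i \<in> V"
  shows "bas (Ev i) \<otimes> bas d = (if zz_src d = i then bas d else \<zero>)"
    and "bas d \<otimes> bas (Ev i) = (if zz_tgt d = i then bas d else \<zero>)"
  using assms by (auto intro!: co_eqI simp: co_mult_bas_Ev co_bas co_zero)

lemma inj_bas: "inj_on bas (zz_index V adj)"
proof (rule inj_onI)
  fix c d assume "c \<in> zz_index V adj" "d \<in> zz_index V adj" "bas c = bas d"
  then show "c = d" using co_bas[of c c] co_bas[of c d] by (auto split: if_splits)
qed

lemma basis_bas: "basis (bas ` zz_index V adj)"
proof -
  have sub: "bas ` zz_index V adj \<subseteq> carrier R" by auto
  have fin: "finite (bas ` zz_index V adj)" using finite_zz_index by simp
  have lc: "lincomb a (bas ` zz_index V adj) = (\<Oplus>d\<in>zz_index V adj. a (bas d) \<odot> bas d)"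
    if "a \<in> bas ` zz_index V adj \<rightarrow> carrier K" for a
    unfolding lincomb_def using that by (intro M.finsum_reindex inj_bas) (auto simp: Pi_iff)
  have "lin_indpt (bas ` zz_index V adj)"
  proof (rule finite_lin_indpt2[OF fin sub], intro ballI)
    fix a v assume a: "a \<in> bas ` zz_index V adj \<rightarrow> carrier K"
      "lincomb a (bas ` zz_index V adj) = \<zero>" "v \<in> bas ` zz_index V adj"
    then obtain c where c: "c \<in> zz_index V adj" "v = bas c" by blast
    have "co c (\<Oplus>d\<in>zz_index V adj. a (bas d) \<odot> bas d) = a (bas c)"
      using a c by (subst co_finsum_bas[where g = "\<lambda>d. a (bas d)"]) auto
    then show "a v = \<zero>\<^bsub>K\<^esub>" using lc[OF a(1)] a(2) c co_zero[OF c(1)] by simp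
  qed
  moreover have "x \<in> span (bas ` zz_index V adj)" if x: "x \<in> carrier R" for x
  proof -
    have "(\<Oplus>d\<in>zz_index V adj. co d x \<odot> bas d) \<in> span (bas ` zz_index V adj)"
      using span_is_submodule[OF sub] in_own_span[OF sub] x
      by (intro submodule_finsum finite_zz_index) (auto intro!: submodule.smult_closed simp: co_closed)
    then show ?thesis using co_expand[OF x] by simp
  qed
  ultimately show ?thesis using sub span_is_subset2[OF sub] by (auto simp: basis_def)
qed

end

text \<open>
  Every vertex \<open>v\<close> is the top of one cell, which contains \<open>e\<^sub>v\<close>, and the bottom of another one,
  which contains \<open>x\<^sub>v\<close>. The arrows between the top and the bottom of a cell belong to this cell.
\<close>

locale cell_pattern = zigzag_coordinates K R V adj co bas
  for K :: "('k, 'm) ring_scheme" and R :: "('k, 'a, 'n) module_scheme" (structure)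
    and V :: "'v set" and adj :: "'v \<Rightarrow> 'v \<Rightarrow> bool"
    and co :: "'v zz \<Rightarrow> 'a \<Rightarrow> 'k" and bas :: "'v zz \<Rightarrow> 'a" +
  fixes X :: "'x set" and \<iota> :: "'v \<Rightarrow> 's" and top bot :: "'x \<Rightarrow> 'v \<Rightarrow> bool"
    and ev :: "'v \<Rightarrow> 'a" and leq :: "'a \<Rightarrow> ('x \<times> 'x) set"
  assumes inj_\<iota>: "inj_on \<iota> V"
    and top_X: "top k v \<Longrightarrow> k \<in> X \<and> v \<in> V" and bot_X: "bot k v \<Longrightarrow> k \<in> X \<and> v \<in> V"
    and top_fun: "\<lbrakk>top k v; top k w\<rbrakk> \<Longrightarrow> v = w" and bot_fun: "\<lbrakk>bot k v; bot k w\<rbrakk> \<Longrightarrow> v = w"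
    and top_inj: "\<lbrakk>top k v; top l v\<rbrakk> \<Longrightarrow> k = l" and bot_inj: "\<lbrakk>bot k v; bot l v\<rbrakk> \<Longrightarrow> k = l"
    and top_ex: "v \<in> V \<Longrightarrow> \<exists>k. top k v" and bot_ex: "v \<in> V \<Longrightarrow> \<exists>k. bot k v"
    and adj_cell: "adj u v \<longleftrightarrow> (\<exists>k. top k u \<and> bot k v) \<or> (\<exists>k. top k v \<and> bot k u)"
    and no_two_cycle: "\<lbrakk>top k u; bot k v; top l v; bot l u\<rbrakk> \<Longrightarrow> False"
    and ev_cases: "(\<forall>v\<in>V. ev v = \<one>) \<or> (\<forall>v\<in>V. ev v = bas (Ev v))"
    and order: "v \<in> V \<Longrightarrow> partial_order_on X (leq (ev v))"
    and bot_leq_top: "\<lbrakk>top k v; bot l v\<rbrakk> \<Longrightarrow> (l, k) \<in> leq (ev v)"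
begin

section \<open>Verification of the cell axioms\<close>

definition mem :: "'x \<Rightarrow> 'v \<Rightarrow> bool" where
  "mem k v \<longleftrightarrow> top k v \<or> bot k v"

text \<open>With top v and bottom w, the entries form the matrix with rows e_v, v \<rightarrow> w
  and w \<rightarrow> v, x_w. A cell that lacks its top or its bottom keeps a single diagonal
  entry.\<close>

definition th :: "'x \<Rightarrow> 'v \<Rightarrow> 'v \<Rightarrow> 'v zz" where
  "th k s t = (if s = t then (if top k s then Ev s else Xv s) else Ar s t)"

text \<open>The datum has to live over a prescribed index type, so vertices are embedded into it by
  \<open>\<iota>\<close>, and \<open>vert\<close> undoes the embedding.\<close>

definition vert :: "'s \<Rightarrow> 'v" where
  "vert = inv_into V \<iota>"

definition cellM :: "'x \<Rightarrow> 's set" where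
  "cellM k = \<iota> ` {v. mem k v}"

definition cellC :: "'x \<Rightarrow> 's \<Rightarrow> 's \<Rightarrow> 'a" where
  "cellC k S T = bas (th k (vert S) (vert T))"

lemma mem_V: "mem k v \<Longrightarrow> v \<in> V" "mem k v \<Longrightarrow> k \<in> X"
  using top_X bot_X by (auto simp: mem_def)

lemma vert_\<iota> [simp]: "v \<in> V \<Longrightarrow> vert (\<iota> v) = v"
  unfolding vert_def using inj_\<iota> by simp

lemma in_cellM: "S \<in> cellM k \<longleftrightarrow> mem k (vert S) \<and> S = \<iota> (vert S)"
proof
  assume "S \<in> cellM k"
  then obtain v where "mem k v" "S = \<iota> v" by (auto simp: cellM_def)
  then show "mem k (vert S) \<and> S = \<iota> (vert S)" using mem_V by simp
qed (auto simp: cellM_def)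

lemma vert_eq: "\<lbrakk>S \<in> cellM k; T \<in> cellM l\<rbrakk> \<Longrightarrow> vert S = vert T \<longleftrightarrow> S = T"
  by (metis in_cellM)

lemma finite_cellM: "finite (cellM k)"
proof -
  have "{v. mem k v} \<subseteq> V" using mem_V by blast
  then show ?thesis using finite_V finite_subset by (auto simp: cellM_def)
qed

lemma not_top_bot: "top k v \<Longrightarrow> bot k v \<Longrightarrow> False"
  using no_two_cycle by blast

lemma mem_adj: "\<lbrakk>mem k s; mem k t; s \<noteq> t\<rbrakk> \<Longrightarrow> adj s t"
  unfolding adj_cell mem_def using top_fun bot_fun by blast

lemma th_index [simp]: "mem k s \<Longrightarrow> mem k t \<Longrightarrow> th k s t \<in> zz_index V adj"
  using mem_V mem_adj by (auto simp: th_def)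

lemma th_flip: "zz_flip (th k s t) = th k t s"
  by (auto simp: th_def)

lemma th_src [simp]: "zz_src (th k s t) = s" and th_tgt [simp]: "zz_tgt (th k s t) = t"
  by (auto simp: th_def)

text \<open>A diagonal label reveals whether its vertex is the top or the bottom, and thereby the
  cell. The ends of an arrow could lie in two different cells only with exchanged roles, which
  \<open>no_two_cycle\<close> forbids.\<close>

lemma th_inj:
  assumes "mem k s" "mem k t" "mem l s'" "mem l t'" "th k s t = th l s' t'"
  shows "k = l \<and> s = s' \<and> t = t'"
proof -
  have st: "s = s'" "t = t'" using arg_cong[OF assms(5), of zz_src] arg_cong[OF assms(5), of zz_tgt] by auto
  show ?thesis
  proof (cases "s = t")
    case True
    then have "top k s \<longleftrightarrow> top l s" using assms(5) st by (auto simp: th_def split: if_splits)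
    then show ?thesis using assms(1,3) st top_inj bot_inj by (auto simp: mem_def)
  next
    case False
    then show ?thesis
      using assms(1-4) st top_fun bot_fun top_inj bot_inj no_two_cycle unfolding mem_def by metis
  qed
qed

lemma th_surj:
  assumes "d \<in> zz_index V adj"
  obtains k s t where "mem k s" "mem k t" "d = th k s t"
proof (cases d)
  case (Ev i)
  then obtain k where "top k i" using top_ex assms by auto
  then show ?thesis using that[of k i i] Ev by (auto simp: mem_def th_def)
next
  case (Xv i)
  then obtain k where "bot k i" using bot_ex assms by auto
  moreover from this have "\<not> top k i" using not_top_bot by blast
  ultimately show ?thesis using that[of k i i] Xv by (auto simp: mem_def th_def)
next
  case (Ar i j)
  then have "adj i j" using assms by simp
  then show ?thesis using that[of _ i j] Ar adj_irrefl unfolding adj_cell mem_def th_def by metis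
qed

abbreviation cellI :: "('x \<times> 's \<times> 's) set" where
  "cellI \<equiv> SIGMA k:X. cellM k \<times> cellM k"

lemma cellC_image: "(\<lambda>(k, S, T). cellC k S T) ` cellI = bas ` zz_index V adj"
proof (intro equalityI subsetI)
  fix x assume "x \<in> (\<lambda>(k, S, T). cellC k S T) ` cellI"
  then show "x \<in> bas ` zz_index V adj" by (auto simp: cellC_def in_cellM)
next
  fix x assume "x \<in> bas ` zz_index V adj"
  then obtain d where d: "d \<in> zz_index V adj" "x = bas d" by blast
  obtain k s t where k: "mem k s" "mem k t" "d = th k s t" using th_surj[OF d(1)] .
  have "x = (\<lambda>(k, S, T). cellC k S T) (k, \<iota> s, \<iota> t)" using k d mem_V by (simp add: cellC_def)
  moreover have "(k, \<iota> s, \<iota> t) \<in> cellI" using k mem_V by (auto simp: cellM_def)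
  ultimately show "x \<in> (\<lambda>(k, S, T). cellC k S T) ` cellI" by blast
qed

lemma inj_cellC: "inj_on (\<lambda>(k, S, T). cellC k S T) cellI"
proof -
  have "k = l \<and> S = S' \<and> T = T'"
    if m: "S \<in> cellM k" "T \<in> cellM k" "S' \<in> cellM l" "T' \<in> cellM l" and eq: "cellC k S T = cellC l S' T'"
    for k S T l S' T'
  proof -
  have "th k (vert S) (vert T) = th l (vert S') (vert T')"
    using eq m inj_onD[OF inj_bas] by (auto simp: cellC_def in_cellM)
  then have "k = l \<and> vert S = vert S' \<and> vert T = vert T'"
    using m th_inj by (auto simp: in_cellM)
  then show "k = l \<and> S = S' \<and> T = T'" using m vert_eq by blast
  qed
  then show ?thesis by (force simp: inj_on_def)
qed

lemma in_cell_span: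
  assumes "y \<in> carrier R"
    and "\<And>d. d \<in> zz_index V adj \<Longrightarrow> co d y \<noteq> \<zero>\<^bsub>K\<^esub> \<Longrightarrow> \<exists>k\<in>Y. \<exists>s t. mem k s \<and> mem k t \<and> d = th k s t"
  shows "y \<in> cell_span K R cellM cellC Y"
proof -
  let ?B = "{cellC \<mu> S T |\<mu> S T. \<mu> \<in> Y \<and> S \<in> cellM \<mu> \<and> T \<in> cellM \<mu>}"
  have sub: "?B \<subseteq> carrier R" by (auto simp: cellC_def in_cellM)
  have "(\<Oplus>d\<in>zz_index V adj. co d y \<odot> bas d) \<in> span ?B"
  proof (intro submodule_finsum finite_zz_index funcsetI span_is_submodule[OF sub])
    fix d assume d: "d \<in> zz_index V adj"
    show "co d y \<odot> bas d \<in> span ?B"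
    proof (cases "co d y = \<zero>\<^bsub>K\<^esub>")
      case True
      then show ?thesis using d submodule.zero_closed[OF span_is_submodule[OF sub]] by (simp add: smult_l_null)
    next
      case False
      then obtain k s t where k: "k \<in> Y" "mem k s" "mem k t" "d = th k s t" using assms(2)[OF d] by blast
      then have "bas d = cellC k (\<iota> s) (\<iota> t)" "\<iota> s \<in> cellM k" "\<iota> t \<in> cellM k"
        using mem_V by (auto simp: cellC_def cellM_def)
      then have "bas d \<in> ?B" using k by blast
      then have "bas d \<in> span ?B" using in_own_span[OF sub] by blast
      then show ?thesis using submodule.smult_closed[OF span_is_submodule[OF sub]] d assms(1) by (simp add: co_closed)
    qed
  qed
  then show ?thesis using co_expand[OF assms(1)] by (simp add: cell_span_def)
qed

text \<open>On the left of this arrow only e_u and the opposite arrow have a non-zero product,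
  namely the arrow itself and x_v.\<close>

lemma co_mult_arrow:
  assumes "adj u v" "a \<in> carrier R" "d \<in> zz_index V adj"
  shows "co d (a \<otimes> bas (Ar u v)) = (if d = Ar u v then co (Ev u) a else if d = Xv v then co (Ar v u) a else \<zero>\<^bsub>K\<^esub>)"
proof (cases d)
  case (Xv i)
  then have i: "i \<in> V" using assms by simp
  have cl: "co (Ar i j) a \<in> carrier K" if "adj i j" for j using that assms by (simp add: co_closed)
  have "(\<Oplus>\<^bsub>K\<^esub>j\<in>{j. adj i j}. co (Ar i j) a \<otimes>\<^bsub>K\<^esub> co (Ar j i) (bas (Ar u v)))
      = (\<Oplus>\<^bsub>K\<^esub>j\<in>{j. adj i j}. if u = j then (if i = v then co (Ar i j) a else \<zero>\<^bsub>K\<^esub>) else \<zero>\<^bsub>K\<^esub>)"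
    using assms adj_sym cl by (intro R.finsum_cong') (auto simp: co_bas)
  also have "\<dots> = (if i = v then co (Ar v u) a else \<zero>\<^bsub>K\<^esub>)"
  proof (cases "adj i u")
    case True
    then show ?thesis using finite_adj cl
      by (subst R.finsum_singleton[where f = "\<lambda>j. if i = v then co (Ar i j) a else \<zero>\<^bsub>K\<^esub>"]) auto
  next
    case False
    then have "(\<Oplus>\<^bsub>K\<^esub>j\<in>{j. adj i j}. if u = j then (if i = v then co (Ar i j) a else \<zero>\<^bsub>K\<^esub>) else \<zero>\<^bsub>K\<^esub>)
      = (\<Oplus>\<^bsub>K\<^esub>j\<in>{j. adj i j}. \<zero>\<^bsub>K\<^esub>)" by (intro R.finsum_cong') auto
    moreover have "i \<noteq> v" using False assms adj_sym by blast
    ultimately show ?thesis by simp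
  qed
  finally show ?thesis using Xv i assms adj_sym[OF assms(1)] by (auto simp: co_mult_X co_bas co_closed)
qed (use assms adj_V in \<open>auto simp: co_mult_E co_mult_A co_bas co_closed\<close>)

lemma co_mult_x:
  assumes "v \<in> V" "a \<in> carrier R" "d \<in> zz_index V adj"
  shows "co d (a \<otimes> bas (Xv v)) = (if d = Xv v then co (Ev v) a else \<zero>\<^bsub>K\<^esub>)"
proof (cases d)
  case (Ar j l)
  then have "j \<in> V" "l \<in> V" "adj j l" using assms adj_V by auto
  then show ?thesis using Ar assms by (auto simp: co_mult_A co_bas co_closed)
qed (use assms adj_sym in \<open>auto simp: co_mult_E co_X_plain co_bas co_closed\<close>)

text \<open>The scalars r_a(s', s). Only the top has an off-diagonal coefficient: an arrow
  multiplied to the row of the bottom gives zero or leaves the cell.\<close>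

definition rcoef :: "'x \<Rightarrow> 'v \<Rightarrow> 'a \<Rightarrow> 'v \<Rightarrow> 'k" where
  "rcoef k s a s' = (if s' = s then co (Ev s) a else if top k s then co (Ar s' s) a else \<zero>\<^bsub>K\<^esub>)"

lemma rcoef_closed: "\<lbrakk>mem k s; mem k s'; a \<in> carrier R\<rbrakk> \<Longrightarrow> rcoef k s a s' \<in> carrier K"
  using mem_V mem_adj by (auto simp: rcoef_def co_closed)

text \<open>The value is the same for every column \<open>t\<close>, which is the independence that
  \<open>mult_C\<close> demands of the scalars.\<close>

lemma co_mult_th:
  assumes "mem k s" "mem k t" "mem k s'" "a \<in> carrier R"
  shows "co (th k s' t) (a \<otimes> bas (th k s t)) = rcoef k s a s'"
proof (cases "s = t")
  case True
  have V: "s \<in> V" "s' \<in> V" using assms mem_V by auto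
  show ?thesis
  proof (cases "top k s")
    case True
    show ?thesis
      using True \<open>s = t\<close> assms V mem_adj[OF assms(3,1)] by (auto simp: th_def co_mult_bas_Ev rcoef_def)
  next
    case False
    then show ?thesis
      using \<open>s = t\<close> assms V mem_adj[OF assms(3,1)] by (auto simp: th_def co_mult_x rcoef_def)
  qed
next
  case False
  have st: "adj s t" using mem_adj assms False by blast
  have s': "s' = s \<or> s' = t" using assms False top_fun bot_fun unfolding mem_def by metis
  have V: "t \<in> V" using assms mem_V by auto
  have "top k s \<longleftrightarrow> \<not> top k t"
    using assms False top_fun bot_fun unfolding mem_def by metis
  then show ?thesis
    using s' st assms False V by (auto simp: th_def co_mult_arrow rcoef_def)
qed

text \<open>A term that leaves the cell \<open>k\<close> is x_t, or an arrow into t arising from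
  e_t; either belongs to the cell with bottom t, while t is the top of \<open>k\<close>. The
  comparisons in \<open>bot_leq_top\<close> are therefore those that the cell axioms ask
  for.\<close>

lemma co_mult_th_other:
  assumes "mem k s" "mem k t" "a \<in> carrier R" "d \<in> zz_index V adj"
    and "\<And>s'. mem k s' \<Longrightarrow> d \<noteq> th k s' t" "co d (a \<otimes> bas (th k s t)) \<noteq> \<zero>\<^bsub>K\<^esub>"
  shows "top k t \<and> (d = Xv t \<or> s = t) \<and> (\<exists>l. bot l t \<and> (\<exists>u w. mem l u \<and> mem l w \<and> d = th l u w))"
proof -
  have V: "s \<in> V" "t \<in> V" using assms mem_V by auto
  obtain l where l: "bot l t" using bot_ex V by blast
  have Xl: "Xv t = th l t t" using not_top_bot l by (auto simp: th_def)
  have ml: "mem l t" using l by (simp add: mem_def)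
  have XX: "d = Xv t \<Longrightarrow> ?thesis" if "top k t" using that l Xl ml by blast
  show ?thesis
  proof (cases "s = t")
    case False
    then have st: "adj s t" using mem_adj assms by blast
    then have "d = Ar s t \<or> d = Xv t"
      using assms(6) co_mult_arrow[OF st assms(3,4)] False by (auto simp: th_def split: if_splits)
    moreover have "d \<noteq> Ar s t" using assms(5)[OF assms(1)] False by (auto simp: th_def)
    ultimately have d: "d = Xv t" by blast
    then have "top k t" using assms(5)[OF assms(2)] by (auto simp: th_def split: if_splits)
    then show ?thesis using XX d by blast
  next
    case True
    show ?thesis
    proof (cases "top k t")
      case top: True
      then have "zz_tgt d = t"
        using assms(3,4,6) True V by (auto simp: th_def co_mult_bas_Ev split: if_splits)
      moreover have "d \<noteq> Ev t" using assms(5)[OF assms(2)] top by (auto simp: th_def)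
      ultimately consider "d = Xv t" | u where "d = Ar u t" by (cases d) auto
      then show ?thesis
      proof cases
        case 1
        then show ?thesis using XX top by blast
      next
        case 2
        then have ut: "adj u t" using assms(4) by simp
        then have neq: "u \<noteq> t" using adj_irrefl by blast
        have "\<not> (top k' t \<and> bot k' u)" for k'
          using assms(5)[of u] 2 neq top top_inj by (auto simp: th_def mem_def)
        then obtain l' where "top l' u" "bot l' t" using ut unfolding adj_cell by blast
        moreover from this have "mem l' u" "mem l' t" by (auto simp: mem_def)
        ultimately show ?thesis using True top 2 neq unfolding th_def by metis
      qed
    next
      case False
      then have "d = Xv t"
        using assms(3,4,6) True V by (auto simp: th_def co_mult_x split: if_splits)
      then show ?thesis using assms(5)[OF assms(2)] False by (auto simp: th_def)
    qed
  qed
qed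

lemma co_row:
  assumes "T \<in> cellM k" "r \<in> cellM k \<rightarrow> carrier K" "d \<in> zz_index V adj"
  shows "\<And>S. S \<in> cellM k \<Longrightarrow> d = th k (vert S) (vert T) \<Longrightarrow>
      co d (\<Oplus>S'\<in>cellM k. r S' \<odot> cellC k S' T) = r S"
    and "(\<And>S. S \<in> cellM k \<Longrightarrow> d \<noteq> th k (vert S) (vert T)) \<Longrightarrow>
      co d (\<Oplus>S'\<in>cellM k. r S' \<odot> cellC k S' T) = \<zero>\<^bsub>K\<^esub>"
proof -
  have idx: "th k (vert S) (vert T) \<in> zz_index V adj" if "S \<in> cellM k" for S
    using that assms by (auto simp: in_cellM)
  have row: "co d (\<Oplus>S'\<in>cellM k. r S' \<odot> cellC k S' T)
      = (\<Oplus>\<^bsub>K\<^esub>S'\<in>cellM k. if d = th k (vert S') (vert T) then r S' else \<zero>\<^bsub>K\<^esub>)"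
  proof -
    have "co d (\<Oplus>S'\<in>cellM k. r S' \<odot> cellC k S' T) = (\<Oplus>\<^bsub>K\<^esub>S'\<in>cellM k. co d (r S' \<odot> cellC k S' T))"
      using assms finite_cellM idx by (intro lin_form_finsum co_lin) (auto simp: cellC_def)
    also have "\<dots> = (\<Oplus>\<^bsub>K\<^esub>S'\<in>cellM k. if d = th k (vert S') (vert T) then r S' else \<zero>\<^bsub>K\<^esub>)"
      using assms idx by (intro R.finsum_cong') (auto simp: cellC_def co_smult co_bas Pi_iff)
    finally show ?thesis .
  qed
  { fix S assume S: "S \<in> cellM k" "d = th k (vert S) (vert T)"
    have "d = th k (vert S') (vert T) \<longleftrightarrow> S = S'" if "S' \<in> cellM k" for S'
    proof -
      have "d = th k (vert S') (vert T) \<longleftrightarrow> vert S = vert S'"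
        using S(2) by (metis th_src)
      then show ?thesis using vert_eq S(1) that by blast
    qed
    then have "(\<Oplus>\<^bsub>K\<^esub>S'\<in>cellM k. if d = th k (vert S') (vert T) then r S' else \<zero>\<^bsub>K\<^esub>)
        = (\<Oplus>\<^bsub>K\<^esub>S'\<in>cellM k. if S = S' then r S' else \<zero>\<^bsub>K\<^esub>)"
      using assms by (intro R.finsum_cong') (auto simp: Pi_iff)
    also have "\<dots> = r S" using assms S finite_cellM by (subst R.finsum_singleton) auto
    finally show "co d (\<Oplus>S'\<in>cellM k. r S' \<odot> cellC k S' T) = r S" using row by simp }
  { assume "\<And>S. S \<in> cellM k \<Longrightarrow> d \<noteq> th k (vert S) (vert T)"
    then have "(\<Oplus>\<^bsub>K\<^esub>S'\<in>cellM k. if d = th k (vert S') (vert T) then r S' else \<zero>\<^bsub>K\<^esub>)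
        = (\<Oplus>\<^bsub>K\<^esub>S'\<in>cellM k. \<zero>\<^bsub>K\<^esub>)" by (intro R.finsum_cong') auto
    then show "co d (\<Oplus>S'\<in>cellM k. r S' \<odot> cellC k S' T) = \<zero>\<^bsub>K\<^esub>" using row by simp }
qed

lemma cellC_closed: "S \<in> cellM k \<Longrightarrow> T \<in> cellM k \<Longrightarrow> cellC k S T \<in> carrier R"
  by (auto simp: cellC_def in_cellM)

lemma ev_closed: "v \<in> V \<Longrightarrow> ev v \<in> carrier R"
  using ev_cases by auto

lemma ev_cellC:
  assumes "S \<in> cellM k" "T \<in> cellM k" "v \<in> V"
  shows "ev v \<otimes> cellC k S T = (if ev (vert S) = ev v then cellC k S T else \<zero>)"
    and "cellC k S T \<otimes> ev (vert T) = cellC k S T"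
proof -
  have V: "vert S \<in> V" "vert T \<in> V" using assms mem_V by (auto simp: in_cellM)
  have idx: "th k (vert S) (vert T) \<in> zz_index V adj" using assms by (auto simp: in_cellM)
  show "ev v \<otimes> cellC k S T = (if ev (vert S) = ev v then cellC k S T else \<zero>)"
    using ev_cases
  proof
    assume "\<forall>v\<in>V. ev v = bas (Ev v)"
    moreover have "bas (Ev (vert S)) = bas (Ev v) \<longleftrightarrow> vert S = v"
      using inj_onD[OF inj_bas, of "Ev (vert S)" "Ev v"] V assms by auto
    ultimately show ?thesis using V assms idx by (simp add: cellC_def bas_Ev_bas)
  qed (use V assms cellC_closed in simp)
  show "cellC k S T \<otimes> ev (vert T) = cellC k S T"
    using ev_cases V assms idx cellC_closed by (auto simp: cellC_def bas_Ev_bas)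
qed

lemma mult_cellC:
  assumes "S \<in> cellM k" "T \<in> cellM k" "a \<in> carrier R"
  shows "\<exists>u\<in>cell_span K R cellM cellC {\<mu>. (\<mu>, k) \<in> leq (ev (vert T)) \<and> \<mu> \<noteq> k}.
    a \<otimes> cellC k S T = (\<Oplus>S'\<in>cellM k. rcoef k (vert S) a (vert S') \<odot> cellC k S' T) \<oplus> u \<otimes> ev (vert T)"
proof -
  let ?r = "\<lambda>S'. rcoef k (vert S) a (vert S')"
  define row where "row = (\<Oplus>S'\<in>cellM k. ?r S' \<odot> cellC k S' T)"
  define u where "u = a \<otimes> cellC k S T \<ominus> row"
  have m: "mem k (vert S)" "mem k (vert T)" using assms by (auto simp: in_cellM)
  have V: "vert T \<in> V" using m mem_V by blast
  have r: "?r \<in> cellM k \<rightarrow> carrier K" using m assms rcoef_closed by (auto simp: in_cellM)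
  have "row \<in> carrier R"
    unfolding row_def using assms r cellC_closed by (intro M.finsum_closed) (auto simp: Pi_iff)
  then have cl: "row \<in> carrier R" "u \<in> carrier R" "cellC k S T \<in> carrier R"
    using assms cellC_closed by (auto simp: u_def simp del: M.minus_eq)
  have "u \<in> cell_span K R cellM cellC {\<mu>. (\<mu>, k) \<in> leq (ev (vert T)) \<and> \<mu> \<noteq> k}"
  proof (rule in_cell_span[OF cl(2)])
    fix d assume d: "d \<in> zz_index V adj" "co d u \<noteq> \<zero>\<^bsub>K\<^esub>"
    have cod: "co d u = co d (a \<otimes> cellC k S T) \<ominus>\<^bsub>K\<^esub> co d row"
      using d cl assms by (simp add: u_def co_minus)
    have no: "d \<noteq> th k s' (vert T)" if s': "mem k s'" for s'
    proof
      assume eq: "d = th k s' (vert T)"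
      have S': "\<iota> s' \<in> cellM k" "vert (\<iota> s') = s'" using s' mem_V by (auto simp: cellM_def)
      have "co d row = rcoef k (vert S) a s'"
        unfolding row_def using co_row(1)[OF assms(2) r d(1) S'(1)] eq S' by simp
      moreover have "co d (a \<otimes> cellC k S T) = rcoef k (vert S) a s'"
        using co_mult_th[OF m s' assms(3)] eq by (simp add: cellC_def)
      ultimately show False
        using d(2) cod rcoef_closed[OF m(1) s' assms(3)] by (simp add: R.minus_eq R.r_neg)
    qed
    then have "co d row = \<zero>\<^bsub>K\<^esub>"
      unfolding row_def using co_row(2)[OF assms(2) r d(1)] by (auto simp: in_cellM)
    then have "co d (a \<otimes> bas (th k (vert S) (vert T))) \<noteq> \<zero>\<^bsub>K\<^esub>"
      using d cod by (auto simp: cellC_def R.minus_eq)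
    then obtain l where "top k (vert T)" "bot l (vert T)" and l: "\<exists>u w. mem l u \<and> mem l w \<and> d = th l u w"
      using co_mult_th_other[OF m assms(3) d(1) no] by blast
    then have "(l, k) \<in> leq (ev (vert T))" "l \<noteq> k" using bot_leq_top not_top_bot by blast+
    then show "\<exists>k\<in>{\<mu>. (\<mu>, k) \<in> leq (ev (vert T)) \<and> \<mu> \<noteq> k}. \<exists>s t. mem k s \<and> mem k t \<and> d = th k s t"
      using l by blast
  qed
  moreover have "a \<otimes> cellC k S T = row \<oplus> u \<otimes> ev (vert T)"
  proof -
    note ec = ev_closed[OF V]
    have "row \<otimes> ev (vert T) = (\<Oplus>S'\<in>cellM k. (?r S' \<odot> cellC k S' T) \<otimes> ev (vert T))"
      unfolding row_def using r ec finite_cellM cellC_closed assms by (intro finsum_ldistr) auto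
    also have "\<dots> = row"
      unfolding row_def using r ec cellC_closed assms ev_cellC(2)[OF _ _ V]
      by (intro M.finsum_cong') (auto simp: smult_mult_left Pi_iff)
    finally have "row \<otimes> ev (vert T) = row" .
    moreover have "a \<otimes> cellC k S T \<otimes> ev (vert T) = a \<otimes> cellC k S T"
      using assms cl ec ev_cellC(2)[OF _ _ V] by (simp add: m_assoc)
    ultimately have "u \<otimes> ev (vert T) = u"
      using assms cl ec by (simp add: u_def minus_eq l_distr l_minus)
    moreover have "row \<oplus> u = a \<otimes> cellC k S T"
      using assms cl by (simp add: u_def minus_eq a_comm r_neg2)
    ultimately show ?thesis by simp
  qed
  ultimately show ?thesis unfolding row_def by blast
qed

lemma corner_cellC:
  assumes "S \<in> cellM k" "T \<in> cellM k" "a \<in> carrier R" "v \<in> V"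
  shows "(ev v \<otimes> a \<otimes> ev v) \<otimes> cellC k S T \<in> cell_span K R cellM cellC {\<mu>. (\<mu>, k) \<in> leq (ev v)}"
proof -
  have m: "mem k (vert S)" "mem k (vert T)" using assms by (auto simp: in_cellM)
  have V: "vert S \<in> V" "vert T \<in> V" "k \<in> X" using m mem_V by blast+
  note ec = ev_closed[OF assms(4)]
  define b where "b = ev v \<otimes> a \<otimes> ev v"
  have b: "b \<in> carrier R" using ec assms by (simp add: b_def)
  have kk: "(k, k) \<in> leq (ev v)"
    using order[OF assms(4)] V by (auto simp: partial_order_on_def preorder_on_def refl_on_def)
  have "b \<otimes> cellC k S T \<in> cell_span K R cellM cellC {\<mu>. (\<mu>, k) \<in> leq (ev v)}"
  proof (rule in_cell_span)
    show "b \<otimes> cellC k S T \<in> carrier R" using b cellC_closed assms by simp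
    fix d assume d: "d \<in> zz_index V adj" "co d (b \<otimes> cellC k S T) \<noteq> \<zero>\<^bsub>K\<^esub>"
    show "\<exists>k\<in>{\<mu>. (\<mu>, k) \<in> leq (ev v)}. \<exists>s t. mem k s \<and> mem k t \<and> d = th k s t"
    proof (cases "\<exists>s'. mem k s' \<and> d = th k s' (vert T)")
      case True
      then show ?thesis using kk m by blast
    next
      case False
      then obtain l where l: "top k (vert T)" "d = Xv (vert T) \<or> vert S = vert T" "bot l (vert T)"
          "\<exists>u w. mem l u \<and> mem l w \<and> d = th l u w"
        using co_mult_th_other[OF m b d(1)] d(2) by (auto simp: cellC_def)
      \<comment> \<open>The available comparison is for the order of \<open>ev (vert T)\<close>.
        With vertex idempotents, the two outer factors \<open>ev v\<close> force both the row of
        \<open>S\<close> and the source of \<open>d\<close> to be \<open>v\<close>; either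
        alternative for \<open>d\<close> then identifies \<open>vert T\<close> with
        \<open>v\<close>.\<close>
      have "ev (vert T) = ev v"
        using ev_cases
      proof
        assume e: "\<forall>v\<in>V. ev v = bas (Ev v)"
        have "b \<otimes> cellC k S T = bas (Ev v) \<otimes> (a \<otimes> bas (Ev v) \<otimes> cellC k S T)"
          unfolding b_def using e assms cellC_closed by (simp add: m_assoc)
        then have "zz_src d = v"
          using d assms cellC_closed by (auto simp: co_mult_bas_Ev split: if_splits)
        moreover have "vert S = v"
        proof (rule ccontr)
          assume "vert S \<noteq> v"
          then have "bas (Ev v) \<otimes> cellC k S T = \<zero>" using assms m by (simp add: cellC_def bas_Ev_bas)
          then have "b \<otimes> cellC k S T = \<zero>"
            unfolding b_def using e assms cellC_closed by (simp add: m_assoc)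
          then show False using d co_zero by simp
        qed
        ultimately show ?thesis using l(2) by auto
      qed (use V assms in simp)
      then show ?thesis using bot_leq_top[OF l(1,3)] l(4) by auto
    qed
  qed
  then show ?thesis by (simp add: b_def)
qed

theorem relative_cell_datum_pattern:
  "relative_cell_datum K R X cellM cellC flip (ev ` V) leq (\<lambda>k S. ev (vert S))"
proof unfold_locales
  fix \<nu> S T assume *: "\<nu> \<in> X" "S \<in> cellM \<nu>" "T \<in> cellM \<nu>"
  show "flip (cellC \<nu> S T) = cellC \<nu> T S"
    using * by (simp add: cellC_def flip_bas th_flip in_cellM)
next
  have "ev v \<noteq> \<zero>" if "v \<in> V" for v
    using ev_cases
  proof
    assume "\<forall>v\<in>V. ev v = bas (Ev v)"
    then show ?thesis using that co_bas[of "Ev v" "Ev v"] co_zero[of "Ev v"] by auto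
  next
    assume "\<forall>v\<in>V. ev v = \<one>"
    then show ?thesis using that co_one_E[of v] co_zero[of "Ev v"] by auto
  qed
  then show "\<zero> \<notin> ev ` V" by (metis imageE)
next
  fix \<epsilon> assume "\<epsilon> \<in> ev ` V"
  then obtain v where v: "v \<in> V" "\<epsilon> = ev v" by blast
  show "\<epsilon> \<otimes> \<epsilon> = \<epsilon>" using ev_cases v by (auto simp: bas_Ev_bas)
  have "flip \<one> = \<one>"
    using anti_involution_flip unfolding anti_involution_def
    by (metis flip_closed l_one one_closed r_one)
  then show "flip \<epsilon> = \<epsilon>" using ev_cases v by (auto simp: flip_bas)
  show "partial_order_on X (leq \<epsilon>)" using order v by blast
next
  fix \<epsilon> \<epsilon>' assume "\<epsilon> \<in> ev ` V" "\<epsilon>' \<in> ev ` V" "\<epsilon> \<noteq> \<epsilon>'"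
  then obtain v w where "v \<in> V" "\<epsilon> = ev v" "w \<in> V" "\<epsilon>' = ev w" "v \<noteq> w" by blast
  then show "\<epsilon> \<otimes> \<epsilon>' = \<zero>" using ev_cases \<open>\<epsilon> \<noteq> \<epsilon>'\<close> by (auto simp: bas_Ev_bas)
next
  fix \<nu> S a assume "\<nu> \<in> X" "S \<in> cellM \<nu>" "a \<in> carrier R"
  then show "\<exists>r. (\<forall>S'\<in>cellM \<nu>. r S' \<in> carrier K) \<and> (\<forall>T\<in>cellM \<nu>.
      \<exists>u\<in>cell_span K R cellM cellC {\<mu>. (\<mu>, \<nu>) \<in> leq (ev (vert T)) \<and> \<mu> \<noteq> \<nu>}.
      a \<otimes> cellC \<nu> S T = (\<Oplus>S'\<in>cellM \<nu>. r S' \<odot> cellC \<nu> S' T) \<oplus> u \<otimes> ev (vert T))"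
    using mult_cellC rcoef_closed
    by (intro exI[of _ "\<lambda>S'. rcoef \<nu> (vert S) a (vert S')"]) (auto simp: in_cellM)
qed (use inj_cellC cellC_image basis_bas anti_involution_flip finite_cellM ev_closed ev_cellC corner_cellC
      mem_V in \<open>auto simp: in_cellM\<close>)

end


section \<open>Path algebras\<close>

text \<open>An elementwise list of laws, suited to path algebras, where they are checked pointwise,
  and to quotients, where they are checked on representatives.\<close>

lemma assoc_algebraI:
  fixes K :: "('k, 'm) ring_scheme" and R :: "('k, 'a, 'n) module_scheme"
  assumes "field K"
    and "\<zero>\<^bsub>R\<^esub> \<in> carrier R" "\<one>\<^bsub>R\<^esub> \<in> carrier R"
    and "\<And>x y. \<lbrakk>x \<in> carrier R; y \<in> carrier R\<rbrakk> \<Longrightarrow> x \<oplus>\<^bsub>R\<^esub> y \<in> carrier R"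
    and "\<And>x y. \<lbrakk>x \<in> carrier R; y \<in> carrier R\<rbrakk> \<Longrightarrow> x \<otimes>\<^bsub>R\<^esub> y \<in> carrier R"
    and "\<And>c x. \<lbrakk>c \<in> carrier K; x \<in> carrier R\<rbrakk> \<Longrightarrow> c \<odot>\<^bsub>R\<^esub> x \<in> carrier R"
    and "\<And>x. x \<in> carrier R \<Longrightarrow> \<exists>y\<in>carrier R. x \<oplus>\<^bsub>R\<^esub> y = \<zero>\<^bsub>R\<^esub>"
    and "\<And>x y. \<lbrakk>x \<in> carrier R; y \<in> carrier R\<rbrakk> \<Longrightarrow> x \<oplus>\<^bsub>R\<^esub> y = y \<oplus>\<^bsub>R\<^esub> x"
    and "\<And>x y z. \<lbrakk>x \<in> carrier R; y \<in> carrier R; z \<in> carrier R\<rbrakk> \<Longrightarrow> (x \<oplus>\<^bsub>R\<^esub> y) \<oplus>\<^bsub>R\<^esub> z = x \<oplus>\<^bsub>R\<^esub> (y \<oplus>\<^bsub>R\<^esub> z)"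
    and "\<And>x. x \<in> carrier R \<Longrightarrow> x \<oplus>\<^bsub>R\<^esub> \<zero>\<^bsub>R\<^esub> = x"
    and "\<And>a b x. \<lbrakk>a \<in> carrier K; b \<in> carrier K; x \<in> carrier R\<rbrakk> \<Longrightarrow> (a \<otimes>\<^bsub>K\<^esub> b) \<odot>\<^bsub>R\<^esub> x = a \<odot>\<^bsub>R\<^esub> (b \<odot>\<^bsub>R\<^esub> x)"
    and "\<And>x. x \<in> carrier R \<Longrightarrow> \<one>\<^bsub>K\<^esub> \<odot>\<^bsub>R\<^esub> x = x"
    and "\<And>a b x. \<lbrakk>a \<in> carrier K; b \<in> carrier K; x \<in> carrier R\<rbrakk> \<Longrightarrow> (a \<oplus>\<^bsub>K\<^esub> b) \<odot>\<^bsub>R\<^esub> x = a \<odot>\<^bsub>R\<^esub> x \<oplus>\<^bsub>R\<^esub> b \<odot>\<^bsub>R\<^esub> x"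
    and "\<And>a x y. \<lbrakk>a \<in> carrier K; x \<in> carrier R; y \<in> carrier R\<rbrakk> \<Longrightarrow> a \<odot>\<^bsub>R\<^esub> (x \<oplus>\<^bsub>R\<^esub> y) = a \<odot>\<^bsub>R\<^esub> x \<oplus>\<^bsub>R\<^esub> a \<odot>\<^bsub>R\<^esub> y"
    and "\<And>x y z. \<lbrakk>x \<in> carrier R; y \<in> carrier R; z \<in> carrier R\<rbrakk> \<Longrightarrow> (x \<otimes>\<^bsub>R\<^esub> y) \<otimes>\<^bsub>R\<^esub> z = x \<otimes>\<^bsub>R\<^esub> (y \<otimes>\<^bsub>R\<^esub> z)"
    and "\<And>x. x \<in> carrier R \<Longrightarrow> \<one>\<^bsub>R\<^esub> \<otimes>\<^bsub>R\<^esub> x = x" "\<And>x. x \<in> carrier R \<Longrightarrow> x \<otimes>\<^bsub>R\<^esub> \<one>\<^bsub>R\<^esub> = x"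
    and "\<And>x y z. \<lbrakk>x \<in> carrier R; y \<in> carrier R; z \<in> carrier R\<rbrakk> \<Longrightarrow> (x \<oplus>\<^bsub>R\<^esub> y) \<otimes>\<^bsub>R\<^esub> z = x \<otimes>\<^bsub>R\<^esub> z \<oplus>\<^bsub>R\<^esub> y \<otimes>\<^bsub>R\<^esub> z"
    and "\<And>x y z. \<lbrakk>x \<in> carrier R; y \<in> carrier R; z \<in> carrier R\<rbrakk> \<Longrightarrow> z \<otimes>\<^bsub>R\<^esub> (x \<oplus>\<^bsub>R\<^esub> y) = z \<otimes>\<^bsub>R\<^esub> x \<oplus>\<^bsub>R\<^esub> z \<otimes>\<^bsub>R\<^esub> y"
    and "\<And>c x y. \<lbrakk>c \<in> carrier K; x \<in> carrier R; y \<in> carrier R\<rbrakk> \<Longrightarrow> (c \<odot>\<^bsub>R\<^esub> x) \<otimes>\<^bsub>R\<^esub> y = c \<odot>\<^bsub>R\<^esub> (x \<otimes>\<^bsub>R\<^esub> y)"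
    and "\<And>c x y. \<lbrakk>c \<in> carrier K; x \<in> carrier R; y \<in> carrier R\<rbrakk> \<Longrightarrow> x \<otimes>\<^bsub>R\<^esub> (c \<odot>\<^bsub>R\<^esub> y) = c \<odot>\<^bsub>R\<^esub> (x \<otimes>\<^bsub>R\<^esub> y)"
  shows "assoc_algebra K R"
proof -
  have vs: "vectorspace K R"
    using assms by (intro vs_criteria) auto
  have "abelian_group R"
    using vectorspace.axioms(1)[OF vs] by (rule module.axioms)
  moreover have "monoid R" using assms by (intro monoidI) auto
  ultimately have "ring R" using assms by (intro ringI) auto
  with vs show ?thesis
    using assms by (intro assoc_algebra.intro assoc_algebra_axioms.intro) auto
qed

lemma (in abelian_monoid) finsum_swap:
  assumes "finite A" "finite B" "\<And>a b. a \<in> A \<Longrightarrow> b \<in> B \<Longrightarrow> f a b \<in> carrier G"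
  shows "(\<Oplus>a\<in>A. \<Oplus>b\<in>B. f a b) = (\<Oplus>b\<in>B. \<Oplus>a\<in>A. f a b)"
  using assms(1,3)
proof (induction A)
  case (insert a A)
  have "(\<Oplus>a\<in>insert a A. \<Oplus>b\<in>B. f a b) = (\<Oplus>b\<in>B. f a b) \<oplus>\<^bsub>G\<^esub> (\<Oplus>a\<in>A. \<Oplus>b\<in>B. f a b)"
    using insert by (intro finsum_insert) (auto intro!: finsum_closed)
  also have "\<dots> = (\<Oplus>b\<in>B. f a b) \<oplus>\<^bsub>G\<^esub> (\<Oplus>b\<in>B. \<Oplus>a\<in>A. f a b)"
    using insert by simp
  also have "\<dots> = (\<Oplus>b\<in>B. f a b \<oplus>\<^bsub>G\<^esub> (\<Oplus>a\<in>A. f a b))"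
    using insert by (intro finsum_addf[symmetric]) (auto intro!: finsum_closed)
  also have "\<dots> = (\<Oplus>b\<in>B. \<Oplus>a\<in>insert a A. f a b)"
    using insert by (intro finsum_cong') (auto intro!: finsum_closed finsum_insert[symmetric])
  finally show ?case .
qed simp

lemma (in abelian_monoid) finsum_extend:
  assumes "finite B" "A \<subseteq> B" "\<And>a. a \<in> A \<Longrightarrow> f a \<in> carrier G"
  shows "(\<Oplus>a\<in>A. f a) = (\<Oplus>a\<in>B. if a \<in> A then f a else \<zero>)"
proof -
  have "(\<Oplus>a\<in>B. if a \<in> A then f a else \<zero>) = (\<Oplus>a\<in>A \<union> (B - A). if a \<in> A then f a else \<zero>)"
    using assms by (simp add: Un_absorb1)
  also have "\<dots> = (\<Oplus>a\<in>A. if a \<in> A then f a else \<zero>) \<oplus>\<^bsub>G\<^esub> (\<Oplus>a\<in>B - A. if a \<in> A then f a else \<zero>)"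
    using assms finite_subset[OF assms(2,1)] by (intro finsum_Un_disjoint) auto
  also have "(\<Oplus>a\<in>B - A. if a \<in> A then f a else \<zero>) = (\<Oplus>a\<in>B - A. \<zero>)"
    by (intro finsum_cong') auto
  also have "(\<Oplus>a\<in>A. if a \<in> A then f a else \<zero>) = (\<Oplus>a\<in>A. f a)"
    using assms by (intro finsum_cong') auto
  finally show ?thesis using assms by (simp add: finsum_closed)
qed

text \<open>Consecutive positions are convenient when a path is split by \<open>take\<close> and
  \<open>drop\<close>.\<close>

lemma vwalk_nth_iff:
  "vwalk p G \<longleftrightarrow> p \<noteq> [] \<and> set p \<subseteq> verts G \<and> (\<forall>m. Suc m < length p \<longrightarrow> (p ! m, p ! Suc m) \<in> arcs_ends G)"
proof -
  have "set (vwalk_arcs p) = {(p ! m, p ! Suc m) | m. Suc m < length p}"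
  proof (induction p rule: vwalk_arcs.induct)
    case (3 x y xs)
    have "{((x # y # xs) ! m, (x # y # xs) ! Suc m) | m. Suc m < length (x # y # xs)}
        = insert (x, y) {((y # xs) ! m, (y # xs) ! Suc m) | m. Suc m < length (y # xs)}" (is "?L = ?R")
    proof (intro equalityI subsetI)
      fix z assume "z \<in> ?L"
      then obtain m where "z = ((x # y # xs) ! m, (x # y # xs) ! Suc m)" "Suc m < length (x # y # xs)" by blast
      then show "z \<in> ?R" by (cases m) auto
    next
      fix z assume "z \<in> ?R"
      then consider "z = (x, y)" | m where "z = ((y # xs) ! m, (y # xs) ! Suc m)" "Suc m < length (y # xs)"
        by blast
      then show "z \<in> ?L"
      proof cases
        case 1
        then show ?thesis by (intro CollectI exI[of _ 0]) simp
      next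
        case (2 m)
        then show ?thesis by (intro CollectI exI[of _ "Suc m"]) simp
      qed
    qed
    then show ?case using 3 by simp
  qed auto
  then show ?thesis unfolding vwalk_def by auto
qed

text \<open>Both pieces contain the vertex at position \<open>m\<close> where the path is cut, so
  each arrow lies in one of them.\<close>

lemma vwalk_take_drop:
  assumes "m < length p"
  shows "vwalk p G \<longleftrightarrow> vwalk (take (Suc m) p) G \<and> vwalk (drop m p) G"
proof
  assume *: "vwalk (take (Suc m) p) G \<and> vwalk (drop m p) G"
  have "p = take m p @ drop m p" by simp
  then have "set p \<subseteq> verts G"
    using * set_take_subset_set_take[of m "Suc m" p] unfolding vwalk_nth_iff
    by (metis Un_subset_iff le_SucI order_refl set_append subset_trans)
  moreover have "(p ! l, p ! Suc l) \<in> arcs_ends G" if l: "Suc l < length p" for l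
  proof (cases "l < m")
    case True
    then show ?thesis using * l assms unfolding vwalk_nth_iff by (auto dest!: spec[of _ l])
  next
    case False
    then have "Suc (l - m) < length (drop m p)" "drop m p ! (l - m) = p ! l"
      "drop m p ! Suc (l - m) = p ! Suc l" using l by auto
    then show ?thesis using * unfolding vwalk_nth_iff by metis
  qed
  ultimately show "vwalk p G" using assms unfolding vwalk_nth_iff by auto
qed (use assms in \<open>auto simp: vwalk_nth_iff dest: in_set_takeD in_set_dropD\<close>)

lemma vwalk_singleton [simp]: "vwalk [i] G \<longleftrightarrow> i \<in> verts G"
  by (simp add: vwalk_def)

lemma vwalk_Cons_Cons [simp]:
  "vwalk (i # j # p) G \<longleftrightarrow> i \<in> verts G \<and> (i, j) \<in> arcs_ends G \<and> vwalk (j # p) G"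
  by (auto simp: vwalk_def)

locale quiver_field = K: field K for K :: "('k, 'm) ring_scheme" +
  fixes Q :: "'v pair_pre_digraph"
  assumes finite_pverts: "finite (pverts Q)"
begin

abbreviation PA :: "('k, 'v list \<Rightarrow> 'k) module" where
  "PA \<equiv> path_algebra K Q"

lemma PA_carrier: "f \<in> carrier PA \<longleftrightarrow> (\<forall>p. f p \<in> carrier K) \<and>
    (\<forall>p. \<not> vwalk p Q \<longrightarrow> f p = \<zero>\<^bsub>K\<^esub>) \<and> finite {p. f p \<noteq> \<zero>\<^bsub>K\<^esub>}"
  by (simp add: path_algebra_def)

lemma PA_add [simp]: "(f \<oplus>\<^bsub>PA\<^esub> g) p = f p \<oplus>\<^bsub>K\<^esub> g p"
  and PA_zero [simp]: "\<zero>\<^bsub>PA\<^esub> p = \<zero>\<^bsub>K\<^esub>"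
  and PA_smult [simp]: "(k \<odot>\<^bsub>PA\<^esub> f) p = k \<otimes>\<^bsub>K\<^esub> f p"
  and PA_one: "\<one>\<^bsub>PA\<^esub> p = (if vwalk p Q \<and> length p = 1 then \<one>\<^bsub>K\<^esub> else \<zero>\<^bsub>K\<^esub>)"
  and PA_mult: "(f \<otimes>\<^bsub>PA\<^esub> g) p = (\<Oplus>\<^bsub>K\<^esub>m\<in>{..<length p}. f (take (Suc m) p) \<otimes>\<^bsub>K\<^esub> g (drop m p))"
  by (simp_all add: path_algebra_def)

lemma PA_closed [simp]: "f \<in> carrier PA \<Longrightarrow> f p \<in> carrier K"
  by (simp add: PA_carrier)

lemma PA_eqI: "(\<And>p. f p = g p) \<Longrightarrow> f = (g :: 'v list \<Rightarrow> 'k)"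
  by blast

lemma PA_mult_closed:
  assumes "f \<in> carrier PA" "g \<in> carrier PA"
  shows "f \<otimes>\<^bsub>PA\<^esub> g \<in> carrier PA"
proof -
  have sum0: "(f \<otimes>\<^bsub>PA\<^esub> g) p = \<zero>\<^bsub>K\<^esub>"
    if "\<And>m. m < length p \<Longrightarrow> f (take (Suc m) p) = \<zero>\<^bsub>K\<^esub> \<or> g (drop m p) = \<zero>\<^bsub>K\<^esub>" for p
  proof -
    have "(f \<otimes>\<^bsub>PA\<^esub> g) p = (\<Oplus>\<^bsub>K\<^esub>m\<in>{..<length p}. \<zero>\<^bsub>K\<^esub>)"
      unfolding PA_mult
    proof (intro K.finsum_cong')
      fix m assume "m \<in> {..<length p}"
      then show "f (take (Suc m) p) \<otimes>\<^bsub>K\<^esub> g (drop m p) = \<zero>\<^bsub>K\<^esub>"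
        using that[of m] PA_closed[OF assms(1)] PA_closed[OF assms(2)] by fastforce
    qed auto
    then show ?thesis by simp
  qed
  let ?F = "{p. f p \<noteq> \<zero>\<^bsub>K\<^esub>}" and ?G = "{p. g p \<noteq> \<zero>\<^bsub>K\<^esub>}"
  \<comment> \<open>The composite of the paths \<open>q\<close> and \<open>r\<close> is
    \<open>q @ tl r\<close>, as their common vertex is listed in both. The support of a product
    therefore lies in a finite image.\<close>
  have "{p. (f \<otimes>\<^bsub>PA\<^esub> g) p \<noteq> \<zero>\<^bsub>K\<^esub>} \<subseteq> (\<lambda>(q, r). q @ tl r) ` (?F \<times> ?G)"
  proof
    fix p assume "p \<in> {p. (f \<otimes>\<^bsub>PA\<^esub> g) p \<noteq> \<zero>\<^bsub>K\<^esub>}"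
    then obtain m where m: "m < length p" "f (take (Suc m) p) \<noteq> \<zero>\<^bsub>K\<^esub>" "g (drop m p) \<noteq> \<zero>\<^bsub>K\<^esub>"
      using sum0 by blast
    have "take (Suc m) p @ tl (drop m p) = p" by (simp add: drop_Suc[symmetric] tl_drop)
    then show "p \<in> (\<lambda>(q, r). q @ tl r) ` (?F \<times> ?G)"
      using m by (intro image_eqI[of _ _ "(take (Suc m) p, drop m p)"]) auto
  qed
  moreover have "finite ?F" "finite ?G" using assms by (auto simp: PA_carrier)
  ultimately have "finite {p. (f \<otimes>\<^bsub>PA\<^esub> g) p \<noteq> \<zero>\<^bsub>K\<^esub>}"
    by (meson finite_SigmaI finite_imageI finite_subset)
  moreover have "(f \<otimes>\<^bsub>PA\<^esub> g) p = \<zero>\<^bsub>K\<^esub>" if "\<not> vwalk p Q" for p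
    using that assms vwalk_take_drop[of _ p Q] by (intro sum0) (auto simp: PA_carrier)
  moreover have "(f \<otimes>\<^bsub>PA\<^esub> g) p \<in> carrier K" for p
    unfolding PA_mult using assms by (intro K.finsum_closed) auto
  ultimately show ?thesis by (auto simp: PA_carrier)
qed

text \<open>Both bracketings are sums over pairs of cuts l \<le> m. The triangle is extended by zero
  to a square so that the order of summation can be exchanged.\<close>

lemma PA_assoc:
  assumes "f \<in> carrier PA" "g \<in> carrier PA" "h \<in> carrier PA"
  shows "(f \<otimes>\<^bsub>PA\<^esub> g) \<otimes>\<^bsub>PA\<^esub> h = f \<otimes>\<^bsub>PA\<^esub> (g \<otimes>\<^bsub>PA\<^esub> h)"
proof (rule PA_eqI)
  fix p :: "'v list"
  let ?n = "length p"
  define t where "t l m = f (take (Suc l) p) \<otimes>\<^bsub>K\<^esub> (g (drop l (take (Suc m) p)) \<otimes>\<^bsub>K\<^esub> h (drop m p))" for l m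
  define T where "T l m = (if l \<le> m then t l m else \<zero>\<^bsub>K\<^esub>)" for l m
  have tc: "t l m \<in> carrier K" for l m using assms by (simp add: t_def)
  have "((f \<otimes>\<^bsub>PA\<^esub> g) \<otimes>\<^bsub>PA\<^esub> h) p = (\<Oplus>\<^bsub>K\<^esub>m\<in>{..<?n}. \<Oplus>\<^bsub>K\<^esub>l\<in>{..<?n}. T l m)"
    unfolding PA_mult[of "f \<otimes>\<^bsub>PA\<^esub> g"]
  proof (rule K.finsum_cong')
    fix m assume m: "m \<in> {..<?n}"
    have "(f \<otimes>\<^bsub>PA\<^esub> g) (take (Suc m) p) \<otimes>\<^bsub>K\<^esub> h (drop m p)
      = (\<Oplus>\<^bsub>K\<^esub>l\<in>{..m}. f (take (Suc l) p) \<otimes>\<^bsub>K\<^esub> g (drop l (take (Suc m) p))) \<otimes>\<^bsub>K\<^esub> h (drop m p)"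
    proof -
      have "(f \<otimes>\<^bsub>PA\<^esub> g) (take (Suc m) p) = (\<Oplus>\<^bsub>K\<^esub>l\<in>{..m}. f (take (Suc l) p) \<otimes>\<^bsub>K\<^esub> g (drop l (take (Suc m) p)))"
        unfolding PA_mult using assms m by (intro K.finsum_cong') (auto simp: min_def take_Suc)
      then show ?thesis by simp
    qed
    also have "\<dots> = (\<Oplus>\<^bsub>K\<^esub>l\<in>{..m}. f (take (Suc l) p) \<otimes>\<^bsub>K\<^esub> g (drop l (take (Suc m) p)) \<otimes>\<^bsub>K\<^esub> h (drop m p))"
      using assms by (intro K.finsum_ldistr) auto
    also have "\<dots> = (\<Oplus>\<^bsub>K\<^esub>l\<in>{..m}. t l m)"
      using assms by (intro K.finsum_cong') (auto simp: t_def K.m_assoc)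
    also have "\<dots> = (\<Oplus>\<^bsub>K\<^esub>l\<in>{..<?n}. if l \<in> {..m} then t l m else \<zero>\<^bsub>K\<^esub>)"
      using m tc by (intro K.finsum_extend) auto
    finally show "(f \<otimes>\<^bsub>PA\<^esub> g) (take (Suc m) p) \<otimes>\<^bsub>K\<^esub> h (drop m p) = (\<Oplus>\<^bsub>K\<^esub>l\<in>{..<?n}. T l m)"
      by (simp add: T_def)
  qed (use tc in \<open>auto simp: T_def intro!: K.finsum_closed\<close>)
  also have "\<dots> = (\<Oplus>\<^bsub>K\<^esub>l\<in>{..<?n}. \<Oplus>\<^bsub>K\<^esub>m\<in>{..<?n}. T l m)"
    using tc by (intro K.finsum_swap) (auto simp: T_def)
  also have "\<dots> = (f \<otimes>\<^bsub>PA\<^esub> (g \<otimes>\<^bsub>PA\<^esub> h)) p"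
    unfolding PA_mult[of f]
  proof (rule K.finsum_cong')
    fix l assume l: "l \<in> {..<?n}"
    have "(\<Oplus>\<^bsub>K\<^esub>m\<in>{..<?n}. T l m) = (\<Oplus>\<^bsub>K\<^esub>m\<in>{l..<?n}. t l m)"
    proof -
      have "(\<Oplus>\<^bsub>K\<^esub>m\<in>{l..<?n}. t l m) = (\<Oplus>\<^bsub>K\<^esub>m\<in>{..<?n}. if m \<in> {l..<?n} then t l m else \<zero>\<^bsub>K\<^esub>)"
        using tc by (intro K.finsum_extend) auto
      also have "\<dots> = (\<Oplus>\<^bsub>K\<^esub>m\<in>{..<?n}. T l m)"
        using tc by (intro K.finsum_cong') (auto simp: T_def)
      finally show ?thesis by simp
    qed
    also have "\<dots> = (\<Oplus>\<^bsub>K\<^esub>m\<in>(\<lambda>j. l + j) ` {..<?n - l}. t l m)"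
    proof -
      have "(\<lambda>j. l + j) ` {..<?n - l} = {l..<?n}"
        using l by (auto simp: image_iff) (metis add_diff_inverse_nat diff_less_mono lessThan_iff not_less)
      then show ?thesis by simp
    qed
    also have "\<dots> = (\<Oplus>\<^bsub>K\<^esub>j\<in>{..<?n - l}. t l (l + j))"
      using tc by (intro K.finsum_reindex) auto
    also have "\<dots> = (\<Oplus>\<^bsub>K\<^esub>j\<in>{..<?n - l}. f (take (Suc l) p) \<otimes>\<^bsub>K\<^esub>
        (g (take (Suc j) (drop l p)) \<otimes>\<^bsub>K\<^esub> h (drop j (drop l p))))"
      using assms by (intro K.finsum_cong') (auto simp: t_def drop_take add.commute)
    also have "\<dots> = f (take (Suc l) p) \<otimes>\<^bsub>K\<^esub> (\<Oplus>\<^bsub>K\<^esub>j\<in>{..<?n - l}.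
        g (take (Suc j) (drop l p)) \<otimes>\<^bsub>K\<^esub> h (drop j (drop l p)))"
      using assms by (intro K.finsum_rdistr[symmetric]) auto
    finally show "(\<Oplus>\<^bsub>K\<^esub>m\<in>{..<?n}. T l m) = f (take (Suc l) p) \<otimes>\<^bsub>K\<^esub> (g \<otimes>\<^bsub>PA\<^esub> h) (drop l p)"
      by (simp add: PA_mult)
  qed (use assms PA_mult_closed in auto)
  finally show "((f \<otimes>\<^bsub>PA\<^esub> g) \<otimes>\<^bsub>PA\<^esub> h) p = (f \<otimes>\<^bsub>PA\<^esub> (g \<otimes>\<^bsub>PA\<^esub> h)) p" .
qed

text \<open>The unit is supported on paths with one vertex, so the only contributing cut is the one
  at the first vertex, respectively at the last.\<close>

lemma PA_units:
  assumes "f \<in> carrier PA"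
  shows "\<one>\<^bsub>PA\<^esub> \<otimes>\<^bsub>PA\<^esub> f = f" "f \<otimes>\<^bsub>PA\<^esub> \<one>\<^bsub>PA\<^esub> = f"
proof -
  show "\<one>\<^bsub>PA\<^esub> \<otimes>\<^bsub>PA\<^esub> f = f"
  proof (rule PA_eqI)
    fix p
    have "(\<one>\<^bsub>PA\<^esub> \<otimes>\<^bsub>PA\<^esub> f) p = (\<Oplus>\<^bsub>K\<^esub>m\<in>{..<length p}. if 0 = m then f p else \<zero>\<^bsub>K\<^esub>)"
      unfolding PA_mult
    proof (intro K.finsum_cong')
      fix m assume m: "m \<in> {..<length p}"
      show "\<one>\<^bsub>PA\<^esub> (take (Suc m) p) \<otimes>\<^bsub>K\<^esub> f (drop m p) = (if 0 = m then f p else \<zero>\<^bsub>K\<^esub>)"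
      proof (cases "m = 0")
        case True
        then show ?thesis
          using m assms vwalk_take_drop[of 0 p Q]
          by (cases p; cases "vwalk p Q") (auto simp: PA_one PA_carrier)
      qed (use m assms in \<open>auto simp: PA_one\<close>)
    qed (use assms in auto)
    also have "\<dots> = f p"
    \<comment> \<open>The empty list is not a walk, so \<open>f\<close> vanishes there, in agreement
      with the empty sum.\<close>
    proof (cases "p = []")
      case True
      then show ?thesis using assms by (auto simp: PA_carrier vwalk_def)
    next
      case False
      then show ?thesis using assms by (subst K.finsum_singleton[where f = "\<lambda>_. f p"]) auto
    qed
    finally show "(\<one>\<^bsub>PA\<^esub> \<otimes>\<^bsub>PA\<^esub> f) p = f p" .
  qed
  show "f \<otimes>\<^bsub>PA\<^esub> \<one>\<^bsub>PA\<^esub> = f"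
  proof (rule PA_eqI)
    fix p
    have "(f \<otimes>\<^bsub>PA\<^esub> \<one>\<^bsub>PA\<^esub>) p = (\<Oplus>\<^bsub>K\<^esub>m\<in>{..<length p}. if length p - 1 = m then f p else \<zero>\<^bsub>K\<^esub>)"
      unfolding PA_mult
    proof (intro K.finsum_cong')
      fix m assume m: "m \<in> {..<length p}"
      show "f (take (Suc m) p) \<otimes>\<^bsub>K\<^esub> \<one>\<^bsub>PA\<^esub> (drop m p) = (if length p - 1 = m then f p else \<zero>\<^bsub>K\<^esub>)"
      proof (cases "length p - 1 = m")
        case True
        then show ?thesis
          using m assms vwalk_take_drop[of m p Q] by (cases "vwalk p Q") (auto simp: PA_one PA_carrier)
      next
        case False
        then have "length (drop m p) \<noteq> 1" using m by auto
        then have "\<one>\<^bsub>PA\<^esub> (drop m p) = \<zero>\<^bsub>K\<^esub>" by (simp add: PA_one)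
        then show ?thesis using False assms by simp
      qed
    qed (use assms in auto)
    also have "\<dots> = f p"
    proof (cases "p = []")
      case True
      then show ?thesis using assms by (auto simp: PA_carrier vwalk_def)
    next
      case False
      then show ?thesis using assms by (subst K.finsum_singleton[where f = "\<lambda>_. f p"]) auto
    qed
    finally show "(f \<otimes>\<^bsub>PA\<^esub> \<one>\<^bsub>PA\<^esub>) p = f p" .
  qed
qed

lemma PA_add_closed:
  assumes "f \<in> carrier PA" "g \<in> carrier PA"
  shows "f \<oplus>\<^bsub>PA\<^esub> g \<in> carrier PA"
proof -
  have "{p. (f \<oplus>\<^bsub>PA\<^esub> g) p \<noteq> \<zero>\<^bsub>K\<^esub>} \<subseteq> {p. f p \<noteq> \<zero>\<^bsub>K\<^esub>} \<union> {p. g p \<noteq> \<zero>\<^bsub>K\<^esub>}" by auto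
  moreover have "finite ({p. f p \<noteq> \<zero>\<^bsub>K\<^esub>} \<union> {p. g p \<noteq> \<zero>\<^bsub>K\<^esub>})" using assms by (auto simp: PA_carrier)
  ultimately have "finite {p. (f \<oplus>\<^bsub>PA\<^esub> g) p \<noteq> \<zero>\<^bsub>K\<^esub>}" by (rule finite_subset)
  then show ?thesis using assms unfolding PA_carrier PA_add by simp
qed

lemma PA_smult_closed:
  assumes "c \<in> carrier K" "f \<in> carrier PA"
  shows "c \<odot>\<^bsub>PA\<^esub> f \<in> carrier PA"
proof -
  have "{p. (c \<odot>\<^bsub>PA\<^esub> f) p \<noteq> \<zero>\<^bsub>K\<^esub>} \<subseteq> {p. f p \<noteq> \<zero>\<^bsub>K\<^esub>}" using assms by auto
  moreover have "finite {p. f p \<noteq> \<zero>\<^bsub>K\<^esub>}" using assms by (auto simp: PA_carrier)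
  ultimately have "finite {p. (c \<odot>\<^bsub>PA\<^esub> f) p \<noteq> \<zero>\<^bsub>K\<^esub>}" by (rule finite_subset)
  then show ?thesis using assms unfolding PA_carrier PA_smult by simp
qed

lemma PA_one_closed: "\<one>\<^bsub>PA\<^esub> \<in> carrier PA"
proof -
  have "{p. \<one>\<^bsub>PA\<^esub> p \<noteq> \<zero>\<^bsub>K\<^esub>} \<subseteq> (\<lambda>i. [i]) ` pverts Q"
  proof
    fix p assume "p \<in> {p. \<one>\<^bsub>PA\<^esub> p \<noteq> \<zero>\<^bsub>K\<^esub>}"
    then have "vwalk p Q" "length p = 1" by (auto simp: PA_one split: if_splits)
    then show "p \<in> (\<lambda>i. [i]) ` pverts Q" by (cases p) auto
  qed
  then have "finite {p. \<one>\<^bsub>PA\<^esub> p \<noteq> \<zero>\<^bsub>K\<^esub>}" using finite_pverts finite_subset by blast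
  then show ?thesis unfolding PA_carrier by (auto simp: PA_one)
qed

theorem assoc_algebra_PA: "assoc_algebra K PA"
proof (rule assoc_algebraI)
  show "field K" by unfold_locales
  show "\<zero>\<^bsub>PA\<^esub> \<in> carrier PA" by (simp add: PA_carrier)
  show "\<exists>g\<in>carrier PA. f \<oplus>\<^bsub>PA\<^esub> g = \<zero>\<^bsub>PA\<^esub>" if "f \<in> carrier PA" for f
  proof (intro bexI)
    show "(\<ominus>\<^bsub>K\<^esub> \<one>\<^bsub>K\<^esub>) \<odot>\<^bsub>PA\<^esub> f \<in> carrier PA" using that by (intro PA_smult_closed) auto
    show "f \<oplus>\<^bsub>PA\<^esub> ((\<ominus>\<^bsub>K\<^esub> \<one>\<^bsub>K\<^esub>) \<odot>\<^bsub>PA\<^esub> f) = \<zero>\<^bsub>PA\<^esub>"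
      using that by (intro PA_eqI) (simp add: K.l_minus K.r_neg)
  qed
  show "(f \<oplus>\<^bsub>PA\<^esub> g) \<otimes>\<^bsub>PA\<^esub> h = f \<otimes>\<^bsub>PA\<^esub> h \<oplus>\<^bsub>PA\<^esub> g \<otimes>\<^bsub>PA\<^esub> h"
    if "f \<in> carrier PA" "g \<in> carrier PA" "h \<in> carrier PA" for f g h
  proof (rule PA_eqI)
    fix p show "((f \<oplus>\<^bsub>PA\<^esub> g) \<otimes>\<^bsub>PA\<^esub> h) p = (f \<otimes>\<^bsub>PA\<^esub> h \<oplus>\<^bsub>PA\<^esub> g \<otimes>\<^bsub>PA\<^esub> h) p"
      unfolding PA_add PA_mult using that
      by (subst K.finsum_addf[symmetric]) (auto intro!: K.finsum_cong' simp: K.l_distr)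
  qed
  show "h \<otimes>\<^bsub>PA\<^esub> (f \<oplus>\<^bsub>PA\<^esub> g) = h \<otimes>\<^bsub>PA\<^esub> f \<oplus>\<^bsub>PA\<^esub> h \<otimes>\<^bsub>PA\<^esub> g"
    if "f \<in> carrier PA" "g \<in> carrier PA" "h \<in> carrier PA" for f g h
  proof (rule PA_eqI)
    fix p show "(h \<otimes>\<^bsub>PA\<^esub> (f \<oplus>\<^bsub>PA\<^esub> g)) p = (h \<otimes>\<^bsub>PA\<^esub> f \<oplus>\<^bsub>PA\<^esub> h \<otimes>\<^bsub>PA\<^esub> g) p"
      unfolding PA_add PA_mult using that
      by (subst K.finsum_addf[symmetric]) (auto intro!: K.finsum_cong' simp: K.r_distr)
  qed
  show "(c \<odot>\<^bsub>PA\<^esub> f) \<otimes>\<^bsub>PA\<^esub> g = c \<odot>\<^bsub>PA\<^esub> (f \<otimes>\<^bsub>PA\<^esub> g)"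
    if "c \<in> carrier K" "f \<in> carrier PA" "g \<in> carrier PA" for c f g
  proof (rule PA_eqI)
    fix p show "((c \<odot>\<^bsub>PA\<^esub> f) \<otimes>\<^bsub>PA\<^esub> g) p = (c \<odot>\<^bsub>PA\<^esub> (f \<otimes>\<^bsub>PA\<^esub> g)) p"
      unfolding PA_smult PA_mult using that
      by (subst K.finsum_rdistr) (auto intro!: K.finsum_cong' simp: K.m_assoc)
  qed
  show "f \<otimes>\<^bsub>PA\<^esub> (c \<odot>\<^bsub>PA\<^esub> g) = c \<odot>\<^bsub>PA\<^esub> (f \<otimes>\<^bsub>PA\<^esub> g)"
    if "c \<in> carrier K" "f \<in> carrier PA" "g \<in> carrier PA" for c f g
  proof (rule PA_eqI)
    fix p show "(f \<otimes>\<^bsub>PA\<^esub> (c \<odot>\<^bsub>PA\<^esub> g)) p = (c \<odot>\<^bsub>PA\<^esub> (f \<otimes>\<^bsub>PA\<^esub> g)) p"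
      unfolding PA_smult PA_mult using that
      by (subst K.finsum_rdistr) (auto intro!: K.finsum_cong' simp: K.m_lcomm)
  qed
qed (auto intro!: PA_eqI simp: PA_one_closed PA_add_closed PA_mult_closed PA_smult_closed PA_assoc PA_units
    K.a_ac K.m_ac K.l_distr K.r_distr)

end


section \<open>Quotient algebras\<close>

context assoc_algebra
begin

context
  fixes I
  assumes I: "ideal I R"
begin

lemma quotient_carrier: "carrier (quotient_algebra R I) = (\<lambda>x. I +> x) ` carrier R"
  by (auto simp: quotient_algebra_def ring.defs module.defs FactRing_def A_RCOSETS_def')

lemma quotient_mult:
  "\<lbrakk>x \<in> carrier R; y \<in> carrier R\<rbrakk> \<Longrightarrow> (I +> x) \<otimes>\<^bsub>quotient_algebra R I\<^esub> (I +> y) = I +> (x \<otimes> y)"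
  by (simp add: quotient_algebra_def ring.defs module.defs FactRing_def ideal.rcoset_mult_add[OF I])

lemma quotient_add:
  "\<lbrakk>x \<in> carrier R; y \<in> carrier R\<rbrakk> \<Longrightarrow> (I +> x) \<oplus>\<^bsub>quotient_algebra R I\<^esub> (I +> y) = I +> (x \<oplus> y)"
  by (simp add: quotient_algebra_def ring.defs module.defs FactRing_def
      abelian_subgroup.a_rcos_sum[OF ideal.axioms(1)[OF I, THEN abelian_subgroupI3]] is_abelian_group
      ideal.a_rcos_sum[OF I])

lemma quotient_zero: "\<zero>\<^bsub>quotient_algebra R I\<^esub> = I +> \<zero>"
  using additive_subgroup.a_subset[OF ideal.axioms(1)[OF I]]
  by (simp add: quotient_algebra_def ring.defs module.defs FactRing_def)

lemma quotient_one: "\<one>\<^bsub>quotient_algebra R I\<^esub> = I +> \<one>"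
  by (simp add: quotient_algebra_def ring.defs module.defs FactRing_def)

lemma coset_eq_iff:
  "\<lbrakk>x \<in> carrier R; y \<in> carrier R\<rbrakk> \<Longrightarrow> I +> x = I +> y \<longleftrightarrow> x \<ominus> y \<in> I"
  using quotient_eq_iff_same_a_r_cos[OF I] by simp

lemma coset_memD:
  assumes "b \<in> I +> x" "x \<in> carrier R"
  shows "b \<in> carrier R" "I +> b = I +> x"
proof -
  show "b \<in> carrier R"
    using assms additive_subgroup.a_subset[OF ideal.axioms(1)[OF I]] a_r_coset_subset_G by blast
  show "I +> b = I +> x"
    using abelian_group.a_repr_independence[OF is_abelian_group assms] additive_subgroup.a_subgroup
      ideal.axioms(1)[OF I] by blast
qed

lemma coset_self: "x \<in> carrier R \<Longrightarrow> x \<in> I +> x"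
  by (rule abelian_subgroup.a_rcos_self)
     (auto intro!: abelian_subgroupI3 ideal.axioms(1)[OF I] is_abelian_group)

lemma ideal_smult:
  assumes "k \<in> carrier K" "x \<in> I"
  shows "k \<odot> x \<in> I"
proof -
  have x: "x \<in> carrier R" using assms ideal.Icarr[OF I] by blast
  have "k \<odot> x = (k \<odot> \<one>) \<otimes> x" using assms x by (simp add: smult_mult_left)
  then show ?thesis using ideal.I_l_closed[OF I assms(2), of "k \<odot> \<one>"] assms by simp
qed

text \<open>The scalar multiple of a coset is a union over its elements. All members of this union
  agree because ideals are closed under scalars, \<open>k \<odot> x\<close> being
  \<open>(k \<odot> \<one>) \<otimes> x\<close>.\<close>

lemma quotient_smult:
  assumes "k \<in> carrier K" "x \<in> carrier R"
  shows "k \<odot>\<^bsub>quotient_algebra R I\<^esub> (I +> x) = I +> (k \<odot> x)"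
proof -
  have "I +> (k \<odot> b) = I +> (k \<odot> x)" if b: "b \<in> I +> x" for b
  proof -
    note bc = coset_memD[OF b assms(2)]
    have "b \<ominus> x \<in> I" using bc coset_eq_iff assms by simp
    then have "k \<odot> (b \<ominus> x) \<in> I" by (rule ideal_smult[OF assms(1)])
    moreover have "k \<odot> (b \<ominus> x) = k \<odot> b \<ominus> k \<odot> x"
      using bc assms by (simp add: a_minus_def smult_r_distr smult_r_minus)
    ultimately show ?thesis using bc assms by (simp add: coset_eq_iff)
  qed
  then have "(\<Union>b\<in>I +> x. I +> (k \<odot> b)) = (\<Union>b\<in>I +> x. I +> (k \<odot> x))" by simp
  also have "\<dots> = I +> (k \<odot> x)" using coset_self[OF assms(2)] by blast
  finally show ?thesis by (simp add: quotient_algebra_def ring.defs module.defs)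
qed

lemmas quotient_simps = quotient_mult quotient_add quotient_zero quotient_one quotient_smult

theorem assoc_algebra_quotient: "assoc_algebra K (quotient_algebra R I)"
proof (rule assoc_algebraI, goal_cases)
  case 1
  show ?case by unfold_locales
next
  case (7 x)
  then obtain y where y: "y \<in> carrier R" "x = I +> y" by (auto simp: quotient_carrier)
  then have "x \<oplus>\<^bsub>quotient_algebra R I\<^esub> (I +> (\<ominus> y)) = \<zero>\<^bsub>quotient_algebra R I\<^esub>"
    by (simp add: quotient_simps r_neg)
  then show ?case using y by (auto simp: quotient_carrier)
qed (auto simp: quotient_carrier quotient_simps a_ac m_assoc l_distr r_distr smult_assoc1 smult_l_distr
    smult_r_distr smult_mult_left smult_mult_right)

end

end

section \<open>The quotient by the common kernel of the coordinate forms\<close>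

context zigzag_forms
begin

definition kernel :: "'a set" where
  "kernel = {x \<in> carrier R. \<forall>c\<in>zz_index V adj. co c x = \<zero>\<^bsub>K\<^esub>}"

text \<open>Every summand in a coordinate of a product contains a coordinate of each of the two
  factors.\<close>

lemma kernel_ideal: "ideal kernel R"
proof (rule idealI)
  show "ring R" by unfold_locales
  show "subgroup kernel (add_monoid R)"
  proof (unfold_locales, goal_cases)
    case (4 x)
    then have "\<ominus> x \<in> kernel" by (auto simp: kernel_def lin_form_uminus co_lin)
    then show ?case by (simp add: a_inv_def)
  qed (auto simp: kernel_def co_add co_zero)
  have mult: "a \<otimes> x \<in> kernel \<and> x \<otimes> a \<in> kernel" if "x \<in> kernel" "a \<in> carrier R" for a x
  proof -
    have x: "x \<in> carrier R" and 0: "\<And>c. c \<in> zz_index V adj \<Longrightarrow> co c x = \<zero>\<^bsub>K\<^esub>"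
      using that by (auto simp: kernel_def)
    have s: "(\<Oplus>\<^bsub>K\<^esub>j\<in>{j. adj i j}. co (Ar i j) a \<otimes>\<^bsub>K\<^esub> co (Ar j i) x) = \<zero>\<^bsub>K\<^esub>"
      "(\<Oplus>\<^bsub>K\<^esub>j\<in>{j. adj i j}. co (Ar i j) x \<otimes>\<^bsub>K\<^esub> co (Ar j i) a) = \<zero>\<^bsub>K\<^esub>" for i
    proof -
      have "(\<Oplus>\<^bsub>K\<^esub>j\<in>{j. adj i j}. co (Ar i j) a \<otimes>\<^bsub>K\<^esub> co (Ar j i) x) = (\<Oplus>\<^bsub>K\<^esub>j\<in>{j. adj i j}. \<zero>\<^bsub>K\<^esub>)"
        using that x adj_sym by (intro R.finsum_cong') (auto simp: 0 co_closed)
      then show "(\<Oplus>\<^bsub>K\<^esub>j\<in>{j. adj i j}. co (Ar i j) a \<otimes>\<^bsub>K\<^esub> co (Ar j i) x) = \<zero>\<^bsub>K\<^esub>" by simp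
      have "(\<Oplus>\<^bsub>K\<^esub>j\<in>{j. adj i j}. co (Ar i j) x \<otimes>\<^bsub>K\<^esub> co (Ar j i) a) = (\<Oplus>\<^bsub>K\<^esub>j\<in>{j. adj i j}. \<zero>\<^bsub>K\<^esub>)"
        using that x adj_sym by (intro R.finsum_cong') (auto simp: 0 co_closed)
      then show "(\<Oplus>\<^bsub>K\<^esub>j\<in>{j. adj i j}. co (Ar i j) x \<otimes>\<^bsub>K\<^esub> co (Ar j i) a) = \<zero>\<^bsub>K\<^esub>" by simp
    qed
    have "co c (a \<otimes> x) = \<zero>\<^bsub>K\<^esub> \<and> co c (x \<otimes> a) = \<zero>\<^bsub>K\<^esub>" if c: "c \<in> zz_index V adj" for c
    proof (cases c)
      case (Ar i j)
      then have "adj i j" "i \<in> V" "j \<in> V" using c adj_V by auto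
      then show ?thesis using Ar x \<open>a \<in> carrier R\<close> by (simp add: co_mult_A 0 co_closed)
    qed (use c x \<open>a \<in> carrier R\<close> s in \<open>simp_all add: co_mult_E co_mult_X 0 co_closed\<close>)
    then show ?thesis using x that by (simp add: kernel_def)
  qed
  show "a \<otimes> x \<in> kernel" "x \<otimes> a \<in> kernel" if "x \<in> kernel" "a \<in> carrier R" for a x
    using mult that by auto
qed

text \<open>The normal form \<open>nf\<close> expands a vector by its coordinates. Modulo
  \<open>I\<close> each generator equals its normal form, hence so does every vector, and elements
  of \<open>kernel\<close> have normal form zero. Identifying a presented algebra thus amounts to
  rewriting a spanning set.\<close>

lemma kernel_eqI:
  assumes "ideal I R" "I \<subseteq> kernel" "S \<subseteq> carrier R" "span S = carrier R"
    and "\<And>s. s \<in> S \<Longrightarrow> s \<in> I \<or> (\<exists>d\<in>zz_index V adj. s \<ominus> bas d \<in> I)"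
  shows "I = kernel"
proof
  define nf where "nf x = (\<Oplus>d\<in>zz_index V adj. co d x \<odot> bas d)" for x
  have nfc: "nf x \<in> carrier R" if "x \<in> carrier R" for x
    unfolding nf_def using that by (intro M.finsum_closed) (auto simp: co_closed)
  have I0: "\<zero> \<in> I" using additive_subgroup.zero_closed[OF ideal.axioms(1)[OF assms(1)]] .
  have Iadd: "x \<oplus> y \<in> I" if "x \<in> I" "y \<in> I" for x y
    using additive_subgroup.a_closed[OF ideal.axioms(1)[OF assms(1)]] that .
  have nf_add: "nf (x \<oplus> y) = nf x \<oplus> nf y" if "x \<in> carrier R" "y \<in> carrier R" for x y
  proof -
    have "nf (x \<oplus> y) = (\<Oplus>d\<in>zz_index V adj. co d x \<odot> bas d \<oplus> co d y \<odot> bas d)"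
      unfolding nf_def using that by (intro M.finsum_cong') (auto simp: co_add co_closed smult_l_distr)
    then show ?thesis unfolding nf_def using that by (simp add: M.finsum_addf co_closed Pi_iff)
  qed
  have nf_smult: "nf (k \<odot> x) = k \<odot> nf x" if "k \<in> carrier K" "x \<in> carrier R" for k x
  proof -
    have "nf (k \<odot> x) = (\<Oplus>d\<in>zz_index V adj. k \<odot> (co d x \<odot> bas d))"
      unfolding nf_def using that by (intro M.finsum_cong') (auto simp: co_smult co_closed smult_assoc1)
    then show ?thesis unfolding nf_def using that by (simp add: finsum_smult co_closed Pi_iff)
  qed
  have "x \<in> carrier R \<and> x \<ominus> nf x \<in> I" if "x \<in> span S" for x
    using that assms(3)
  proof (induction rule: span_induct)
    case zero
    have "nf \<zero> = \<zero>" using nf_smult[of "\<zero>\<^bsub>K\<^esub>" "\<zero>"] nfc[of "\<zero>"] by (simp add: smult_l_null)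
    then show ?case using I0 by (simp add: a_minus_def)
  next
    case (base s)
    then have s: "s \<in> carrier R" using assms(3) by blast
    show ?case
    proof (cases "s \<in> I")
      case True
      then have "co d s = \<zero>\<^bsub>K\<^esub>" if "d \<in> zz_index V adj" for d
        using assms(2) that by (auto simp: kernel_def)
      then have "nf s = (\<Oplus>d\<in>zz_index V adj. \<zero>)"
        unfolding nf_def by (intro M.finsum_cong') (auto simp: smult_l_null)
      then show ?thesis using s True by (simp add: a_minus_def)
    next
      case False
      then obtain d where d: "d \<in> zz_index V adj" "s \<ominus> bas d \<in> I" using assms(5)[OF base] by blast
      have "co c s = (if d = c then \<one>\<^bsub>K\<^esub> else \<zero>\<^bsub>K\<^esub>)" if c: "c \<in> zz_index V adj" for c
      proof -
        have "co c (s \<ominus> bas d) = \<zero>\<^bsub>K\<^esub>" using d assms(2) c by (auto simp: kernel_def)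
        then have z: "co c s \<ominus>\<^bsub>K\<^esub> co c (bas d) = \<zero>\<^bsub>K\<^esub>" using s d c by (simp add: co_minus)
        have "co c s = co c (bas d)"
          using z s d c by (simp add: R.minus_eq) (metis R.a_inv_closed R.l_neg R.minus_equality R.minus_minus bas_closed co_closed)
        then show ?thesis using c d by (simp add: co_bas)
      qed
      then have "nf s = (\<Oplus>c\<in>zz_index V adj. if d = c then bas c else \<zero>)"
        unfolding nf_def by (intro M.finsum_cong') (auto simp: smult_l_null)
      also have "\<dots> = bas d"
        using d finite_zz_index by (subst M.finsum_singleton) auto
      finally show ?thesis using s d by simp
    qed
  next
    case (add x y)
    then have "(x \<oplus> y) \<ominus> nf (x \<oplus> y) = (x \<ominus> nf x) \<oplus> (y \<ominus> nf y)"
      using nfc by (simp add: nf_add minus_eq minus_add a_ac)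
    then show ?case using add Iadd by simp
  next
    case (smult k x)
    then have "k \<odot> x \<ominus> nf (k \<odot> x) = k \<odot> (x \<ominus> nf x)"
      using nfc by (simp add: nf_smult minus_eq smult_r_distr smult_r_minus)
    then show ?case using smult ideal_smult[OF assms(1)] by simp
  qed
  then have "x \<in> I" if "x \<in> kernel" for x
  proof -
    have x: "x \<in> carrier R" "\<And>d. d \<in> zz_index V adj \<Longrightarrow> co d x = \<zero>\<^bsub>K\<^esub>" using that by (auto simp: kernel_def)
    then have "nf x = (\<Oplus>d\<in>zz_index V adj. \<zero>)"
      unfolding nf_def by (intro M.finsum_cong') (auto simp: smult_l_null)
    moreover have "x \<ominus> nf x \<in> I" using \<open>\<And>x. x \<in> span S \<Longrightarrow> x \<in> carrier R \<and> x \<ominus> nf x \<in> I\<close> assms(4) x by blast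
    ultimately show ?thesis using x by (simp add: a_minus_def)
  qed
  then show "kernel \<subseteq> I" by blast
qed (rule assms(2))

text \<open>The coordinate of a coset is taken at an arbitrary representative; the choice is
  immaterial because the forms vanish on \<open>kernel\<close>. In the quotient they become jointly
  injective.\<close>

theorem zigzag_coordinates_quotient:
  "zigzag_coordinates K (quotient_algebra R kernel) V adj
     (\<lambda>c B. co c (SOME x. x \<in> B)) (\<lambda>d. kernel +> bas d)"
proof -
  let ?Q = "quotient_algebra R kernel"
  let ?co = "\<lambda>c B. co c (SOME x. x \<in> B)"
  interpret Q: assoc_algebra K ?Q by (rule assoc_algebra_quotient[OF kernel_ideal])
  note qs = quotient_simps[OF kernel_ideal]
  have co: "?co c (kernel +> x) = co c x" if "x \<in> carrier R" "c \<in> zz_index V adj" for c x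
  proof -
    define y where "y = (SOME y. y \<in> kernel +> x)"
    have y: "y \<in> kernel +> x" unfolding y_def using coset_self[OF kernel_ideal that(1)] by (rule someI)
    note yc = coset_memD[OF kernel_ideal y that(1)]
    then have "y \<ominus> x \<in> kernel" using coset_eq_iff[OF kernel_ideal yc(1) that(1)] by simp
    then have z: "co c y \<ominus>\<^bsub>K\<^esub> co c x = \<zero>\<^bsub>K\<^esub>" using that yc by (simp add: kernel_def co_minus)
    have "co c y = co c x"
      using z yc that by (simp add: R.minus_eq) (metis R.a_inv_closed R.l_neg R.minus_equality R.minus_minus co_closed)
    then show ?thesis by (simp add: y_def)
  qed
  have qc: "B \<in> carrier ?Q \<longleftrightarrow> (\<exists>x\<in>carrier R. B = kernel +> x)" for B
    by (auto simp: quotient_carrier[OF kernel_ideal])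
  show ?thesis
  proof (unfold_locales, goal_cases)
    case (5 c)
    then show ?case unfolding Q.lin_form_def by (auto simp: qc qs co co_closed co_add co_smult)
  next
    case (12 B)
    then obtain x where x: "x \<in> carrier R" "B = kernel +> x" by (auto simp: qc)
    have "co c x = \<zero>\<^bsub>K\<^esub>" if "c \<in> zz_index V adj" for c
      using 12(2)[OF that] co[OF x(1) that] x(2) by simp
    then have "x \<in> kernel" using x(1) by (simp add: kernel_def)
    then have "x \<ominus> \<zero> \<in> kernel" using x by (simp add: a_minus_def)
    then show ?case using x coset_eq_iff[OF kernel_ideal x(1), of "\<zero>"] by (simp add: qs)
  next
    case (11 i B C)
    then obtain x y where x: "x \<in> carrier R" "B = kernel +> x" "y \<in> carrier R" "C = kernel +> y"
      by (auto simp: qc)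
    have "(\<Oplus>\<^bsub>K\<^esub>j\<in>{j. adj i j}. ?co (Ar i j) B \<otimes>\<^bsub>K\<^esub> ?co (Ar j i) C)
        = (\<Oplus>\<^bsub>K\<^esub>j\<in>{j. adj i j}. co (Ar i j) x \<otimes>\<^bsub>K\<^esub> co (Ar j i) y)"
      using x adj_sym by (intro R.finsum_cong') (auto simp: co co_closed)
    then show ?case using 11 x by (simp add: qs co co_mult_X)
  qed (auto simp: qc qs co co_bas co_one_E co_mult_E co_mult_A finite_V adj_V adj_irrefl adj_sym dest: adj_V)
qed

end


section \<open>Coordinates on zigzag algebras\<close>

sublocale quiver_field \<subseteq> P: assoc_algebra K PA
  by (rule assoc_algebra_PA)

context quiver_field
begin

lemma path_elem_simp: "path_elem K p q = (if q = p then \<one>\<^bsub>K\<^esub> else \<zero>\<^bsub>K\<^esub>)"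
  by (simp add: path_elem_def)

lemma path_elem_closed: "vwalk p Q \<Longrightarrow> path_elem K p \<in> carrier PA"
proof -
  assume "vwalk p Q"
  moreover have "{q. path_elem K p q \<noteq> \<zero>\<^bsub>K\<^esub>} \<subseteq> {p}" by (auto simp: path_elem_simp)
  then have "finite {q. path_elem K p q \<noteq> \<zero>\<^bsub>K\<^esub>}" using finite_subset by blast
  ultimately show ?thesis unfolding PA_carrier by (auto simp: path_elem_simp)
qed

text \<open>The length of the first piece fixes the cut and both pieces together fix the list, so a
  single summand survives, at \<open>q = p\<close> and \<open>l = m\<close>.\<close>

lemma path_elem_split:
  assumes "vwalk p Q" "m < length p"
  shows "path_elem K p = path_elem K (take (Suc m) p) \<otimes>\<^bsub>PA\<^esub> path_elem K (drop m p)"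
proof (rule PA_eqI)
  fix q
  have split: "take (Suc l) q = take (Suc m) p \<and> drop l q = drop m p \<longleftrightarrow> l = m \<and> q = p" if "l < length q" for l
  proof
    assume *: "take (Suc l) q = take (Suc m) p \<and> drop l q = drop m p"
    then have "length (take (Suc l) q) = length (take (Suc m) p)" by simp
    then have lm: "l = m" using that assms by simp
    then have "take m q = take m p" using * by (metis lessI less_imp_le_nat min.absorb1 take_take)
    then show "l = m \<and> q = p" using * lm by (metis append_take_drop_id)
  qed simp
  have "(path_elem K (take (Suc m) p) \<otimes>\<^bsub>PA\<^esub> path_elem K (drop m p)) q
      = (\<Oplus>\<^bsub>K\<^esub>l\<in>{..<length q}. if m = l then (if q = p then \<one>\<^bsub>K\<^esub> else \<zero>\<^bsub>K\<^esub>) else \<zero>\<^bsub>K\<^esub>)"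
    unfolding PA_mult
  proof (intro K.finsum_cong')
    fix l assume "l \<in> {..<length q}"
    then have "l < length q" by simp
    from split[OF this] consider "l = m" "q = p"
      | "\<not> (l = m \<and> q = p)" "take (Suc l) q \<noteq> take (Suc m) p \<or> drop l q \<noteq> drop m p" by argo
    then show "path_elem K (take (Suc m) p) (take (Suc l) q) \<otimes>\<^bsub>K\<^esub> path_elem K (drop m p) (drop l q)
        = (if m = l then (if q = p then \<one>\<^bsub>K\<^esub> else \<zero>\<^bsub>K\<^esub>) else \<zero>\<^bsub>K\<^esub>)"
      by cases (simp_all only: path_elem_simp, auto)
  qed auto
  also have "\<dots> = path_elem K p q"
  proof (cases "q = p")
    case True
    then show ?thesis using assms
      by (simp add: path_elem_simp) (subst K.finsum_singleton[where f = "\<lambda>_. \<one>\<^bsub>K\<^esub>"], auto)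
  qed (simp add: path_elem_simp)
  finally show "path_elem K p q = (path_elem K (take (Suc m) p) \<otimes>\<^bsub>PA\<^esub> path_elem K (drop m p)) q" by simp
qed

lemma PA_finsum_apply:
  assumes "finite A" "F \<in> A \<rightarrow> carrier PA"
  shows "finsum PA F A q = (\<Oplus>\<^bsub>K\<^esub>a\<in>A. F a q)"
  using assms
proof (induction A)
  case (insert a A)
  then have "finsum PA F (insert a A) = F a \<oplus>\<^bsub>PA\<^esub> finsum PA F A"
    by (intro P.M.finsum_insert) auto
  moreover have "(\<Oplus>\<^bsub>K\<^esub>a\<in>insert a A. F a q) = F a q \<oplus>\<^bsub>K\<^esub> (\<Oplus>\<^bsub>K\<^esub>a\<in>A. F a q)"
    using insert by (intro K.finsum_insert) (auto simp: Pi_iff)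
  ultimately show ?case using insert by simp
qed simp

lemma span_path_elem: "P.span (path_elem K ` {p. vwalk p Q}) = carrier PA"
proof
  have sub: "path_elem K ` {p. vwalk p Q} \<subseteq> carrier PA" using path_elem_closed by auto
  then show "P.span (path_elem K ` {p. vwalk p Q}) \<subseteq> carrier PA" by (rule P.span_is_subset2)
  show "carrier PA \<subseteq> P.span (path_elem K ` {p. vwalk p Q})"
  proof
    fix f assume f: "f \<in> carrier PA"
    let ?A = "{p. f p \<noteq> \<zero>\<^bsub>K\<^esub>}"
    have fin: "finite ?A" and walk: "\<And>p. p \<in> ?A \<Longrightarrow> vwalk p Q" using f by (auto simp: PA_carrier)
    let ?s = "finsum PA (\<lambda>p. f p \<odot>\<^bsub>PA\<^esub> path_elem K p) ?A"
    have in_span: "?s \<in> P.span (path_elem K ` {p. vwalk p Q})"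
      using P.span_is_submodule[OF sub] P.in_own_span[OF sub] walk f fin
      by (intro P.submodule_finsum) (auto intro!: submodule.smult_closed)
    have "?s = f"
    proof (rule PA_eqI)
      fix q
      have "?s q = (\<Oplus>\<^bsub>K\<^esub>p\<in>?A. (f p \<odot>\<^bsub>PA\<^esub> path_elem K p) q)"
        using f walk path_elem_closed by (intro PA_finsum_apply fin) (auto intro!: P.smult_closed)
      also have "\<dots> = (\<Oplus>\<^bsub>K\<^esub>p\<in>?A. if q = p then f p else \<zero>\<^bsub>K\<^esub>)"
        using f by (intro K.finsum_cong') (auto simp: path_elem_simp)
      also have "\<dots> = f q"
      proof (cases "q \<in> ?A")
        case True
        then show ?thesis using f fin by (subst K.finsum_singleton) auto
      next
        case False
        then have "(\<Oplus>\<^bsub>K\<^esub>p\<in>?A. if q = p then f p else \<zero>\<^bsub>K\<^esub>) = (\<Oplus>\<^bsub>K\<^esub>p\<in>?A. \<zero>\<^bsub>K\<^esub>)"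
          by (intro K.finsum_cong') auto
        then show ?thesis using False by simp
      qed
      finally show "?s q = f q" .
    qed
    then show "f \<in> P.span (path_elem K ` {p. vwalk p Q})" using in_span by simp
  qed
qed

lemma path_elem_prefix_ideal:
  assumes "ideal I PA" "vwalk p Q" "m < length p" "path_elem K (take (Suc m) p) \<in> I"
  shows "path_elem K p \<in> I"
proof -
  have "vwalk (drop m p) Q" using assms(2) vwalk_take_drop[OF assms(3)] by blast
  from ideal.I_r_closed[OF assms(1,4) path_elem_closed[OF this]]
  show ?thesis by (subst path_elem_split[OF assms(2,3)])
qed

lemma path_elem_suffix_ideal:
  assumes "ideal I PA" "vwalk p Q" "m < length p" "path_elem K (drop m p) \<in> I"
  shows "path_elem K p \<in> I"
proof -
  have "vwalk (take (Suc m) p) Q" using assms(2) vwalk_take_drop[OF assms(3)] by blast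
  from ideal.I_l_closed[OF assms(1,4) path_elem_closed[OF this]]
  show ?thesis by (subst path_elem_split[OF assms(2,3)])
qed

lemma minus_self_ideal: "ideal I PA \<Longrightarrow> x \<in> carrier PA \<Longrightarrow> x \<ominus>\<^bsub>PA\<^esub> x \<in> I"
  using additive_subgroup.zero_closed[OF ideal.axioms(1)] by (simp add: P.minus_eq P.r_neg)

end

fun loop_co :: "('k, 'm) ring_scheme \<Rightarrow> 'v zz \<Rightarrow> ('v list \<Rightarrow> 'k) \<Rightarrow> 'k" where
  "loop_co K (Ev i) f = f [i]" | "loop_co K (Xv i) f = f [i, i]" | "loop_co K (Ar i j) f = \<zero>\<^bsub>K\<^esub>"

fun loop_path :: "'v zz \<Rightarrow> 'v list" where
  "loop_path (Ev i) = [i]" | "loop_path (Xv i) = [i, i]" | "loop_path (Ar i j) = [i, j]"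

lemma (in quiver_field) loop_zigzag:
  assumes "pverts Q = {v}" "parcs Q = {(v, v)}"
  shows "\<exists>co bas. zigzag_coordinates K (quiver_algebra_mod K Q {path_elem K [i, i, i] | i. i \<in> {v}})
     {v} (\<lambda>_ _. False) co bas"
proof -
  let ?adj = "\<lambda>_ _. False" and ?rels = "{path_elem K [i, i, i] | i. i \<in> {v}}"
  interpret Z: zigzag_forms K PA "{v}" ?adj "loop_co K" "\<lambda>d. path_elem K (loop_path d)"
  proof (unfold_locales, goal_cases)
    case (5 c)
    then show ?case by (cases c) (auto simp: P.lin_form_def)
  next
    case (6 c)
    then show ?case using assms by (cases c) (auto intro!: path_elem_closed)
  next
    case (7 c d)
    then show ?case by (cases c; cases d) (auto simp: path_elem_simp)
  qed (use assms in \<open>auto simp: PA_one PA_mult lessThan_Suc K.a_comm\<close>)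
  have walk: "set p \<subseteq> {v}" if "vwalk p Q" for p using that assms by (auto simp: vwalk_def)
  have sub: "?rels \<subseteq> carrier PA" using assms by (auto intro!: path_elem_closed)
  have I: "ideal (Idl\<^bsub>PA\<^esub> ?rels) PA" by (rule P.genideal_ideal[OF sub])
  have "Idl\<^bsub>PA\<^esub> ?rels = Z.kernel"
  proof (rule Z.kernel_eqI[OF I _ _ span_path_elem])
    show "Idl\<^bsub>PA\<^esub> ?rels \<subseteq> Z.kernel"
    proof (rule P.genideal_minimal[OF Z.kernel_ideal])
      have "loop_co K c (path_elem K [v, v, v]) = \<zero>\<^bsub>K\<^esub>" for c by (cases c) (auto simp: path_elem_simp)
      then show "?rels \<subseteq> Z.kernel" using sub by (auto simp: Z.kernel_def)
    qed
    show "path_elem K ` {p. vwalk p Q} \<subseteq> carrier PA" using path_elem_closed by auto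
    fix s assume "s \<in> path_elem K ` {p. vwalk p Q}"
    then obtain p where p: "vwalk p Q" "s = path_elem K p" by blast
    \<comment> \<open>All walks are powers of the loop. From three vertices on, such a walk has the
      square of x as a prefix.\<close>
    have "p = replicate (length p) v"
      using walk[OF p(1)] by (intro replicate_length_same[symmetric]) auto
    moreover have "length p \<noteq> 0" using p(1) by (auto simp: vwalk_def)
    then have "length p = 1 \<or> length p = 2 \<or> (\<exists>k. length p = Suc (Suc (Suc k)))" by presburger
    ultimately consider "p = [v]" | "p = [v, v]" | q where "p = v # v # v # q"
      by (metis One_nat_def numeral_2_eq_2 replicate_0 replicate_Suc)
    then show "s \<in> Idl\<^bsub>PA\<^esub> ?rels \<or> (\<exists>d\<in>zz_index {v} ?adj. s \<ominus>\<^bsub>PA\<^esub> path_elem K (loop_path d) \<in> Idl\<^bsub>PA\<^esub> ?rels)"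
    proof cases
      case 1
      then have "s \<ominus>\<^bsub>PA\<^esub> path_elem K (loop_path (Ev v)) \<in> Idl\<^bsub>PA\<^esub> ?rels"
        using p minus_self_ideal[OF I] path_elem_closed by auto
      moreover have "Ev v \<in> zz_index {v} ?adj" by simp
      ultimately show ?thesis by blast
    next
      case 2
      then have "s \<ominus>\<^bsub>PA\<^esub> path_elem K (loop_path (Xv v)) \<in> Idl\<^bsub>PA\<^esub> ?rels"
        using p minus_self_ideal[OF I path_elem_closed[OF p(1)]] by simp
      moreover have "Xv v \<in> zz_index {v} ?adj" by simp
      ultimately show ?thesis by blast
    next
      case 3
      have "path_elem K (take (Suc 2) p) \<in> Idl\<^bsub>PA\<^esub> ?rels"
        using 3 P.genideal_self[OF sub] by (auto simp: numeral_2_eq_2)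
      then show ?thesis using path_elem_prefix_ideal[OF I p(1), of 2] 3 p by auto
    qed
  qed
  then show ?thesis using Z.zigzag_coordinates_quotient unfolding quiver_algebra_mod_def by auto
qed

section \<open>Double quivers of graphs without isolated vertices\<close>

locale zigzag_quiver = quiver_field K Q for K :: "('k, 'm) ring_scheme" and Q :: "'v pair_pre_digraph" +
  fixes adj :: "'v \<Rightarrow> 'v \<Rightarrow> bool"
  assumes parcs: "parcs Q = {(i, j). adj i j}"
    and adj_Q: "adj i j \<Longrightarrow> i \<in> pverts Q \<and> j \<in> pverts Q"
    and adj_symm: "adj i j \<Longrightarrow> adj j i"
    and adj_irr: "\<not> adj i i"
    and not_isolated: "i \<in> pverts Q \<Longrightarrow> \<exists>j. adj i j"
begin

text \<open>The neighbour through which x_i is represented by a path; modulo the zigzag relations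
  any other neighbour gives the same element.\<close>

definition nb :: "'v \<Rightarrow> 'v" where
  "nb i = (SOME j. adj i j)"

lemma adj_nb: "i \<in> pverts Q \<Longrightarrow> adj i (nb i)"
  unfolding nb_def using not_isolated by (rule someI_ex)

text \<open>All closed paths of length two at \<open>i\<close> become x_i in the zigzag algebra, so
  its coordinate adds up their coefficients. The paths not listed become zero and receive no
  coordinate.\<close>

fun quiver_co :: "'v zz \<Rightarrow> ('v list \<Rightarrow> 'k) \<Rightarrow> 'k" where
  "quiver_co (Ev i) f = f [i]"
| "quiver_co (Xv i) f = (\<Oplus>\<^bsub>K\<^esub>j\<in>{j. adj i j}. f [i, j, i])"
| "quiver_co (Ar i j) f = f [i, j]"

fun quiver_path :: "'v zz \<Rightarrow> 'v list" where
  "quiver_path (Ev i) = [i]" | "quiver_path (Xv i) = [i, nb i, i]" | "quiver_path (Ar i j) = [i, j]"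

lemma finite_nbs: "finite {j. adj i j}"
  using finite_pverts by (rule rev_finite_subset) (auto dest: adj_Q)

lemma quiver_co_path_elem:
  "quiver_co (Ev i) (path_elem K p) = (if p = [i] then \<one>\<^bsub>K\<^esub> else \<zero>\<^bsub>K\<^esub>)"
  "quiver_co (Ar i j) (path_elem K p) = (if p = [i, j] then \<one>\<^bsub>K\<^esub> else \<zero>\<^bsub>K\<^esub>)"
  "quiver_co (Xv i) (path_elem K p) = (if \<exists>j. adj i j \<and> p = [i, j, i] then \<one>\<^bsub>K\<^esub> else \<zero>\<^bsub>K\<^esub>)"
proof -
  show "quiver_co (Xv i) (path_elem K p) = (if \<exists>j. adj i j \<and> p = [i, j, i] then \<one>\<^bsub>K\<^esub> else \<zero>\<^bsub>K\<^esub>)"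
  proof (cases "\<exists>j. adj i j \<and> p = [i, j, i]")
    case True
    then obtain j where j: "adj i j" "p = [i, j, i]" by blast
    have "quiver_co (Xv i) (path_elem K p) = (\<Oplus>\<^bsub>K\<^esub>k\<in>{j. adj i j}. if j = k then \<one>\<^bsub>K\<^esub> else \<zero>\<^bsub>K\<^esub>)"
      using j by (auto simp: path_elem_simp intro!: K.finsum_cong')
    also have "\<dots> = \<one>\<^bsub>K\<^esub>"
      using j finite_nbs by (subst K.finsum_singleton[where f = "\<lambda>_. \<one>\<^bsub>K\<^esub>"]) auto
    finally show ?thesis using True by simp
  next
    case False
    then have "quiver_co (Xv i) (path_elem K p) = (\<Oplus>\<^bsub>K\<^esub>k\<in>{j. adj i j}. \<zero>\<^bsub>K\<^esub>)"
      unfolding quiver_co.simps by (intro K.finsum_cong') (auto simp: path_elem_simp)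
    then show ?thesis using False by simp
  qed
qed (auto simp: path_elem_simp)

lemma zigzag_forms_quiver:
  "zigzag_forms K PA (pverts Q) adj quiver_co (\<lambda>d. path_elem K (quiver_path d))"
proof (unfold_locales, goal_cases)
  case (5 c)
  show ?case
  proof (cases c)
    case (Xv i)
    have "(\<Oplus>\<^bsub>K\<^esub>j\<in>{j. adj i j}. k \<otimes>\<^bsub>K\<^esub> f [i, j, i]) = k \<otimes>\<^bsub>K\<^esub> (\<Oplus>\<^bsub>K\<^esub>j\<in>{j. adj i j}. f [i, j, i])"
      if "k \<in> carrier K" "f \<in> carrier PA" for k f
      using that finite_nbs by (intro K.finsum_rdistr[symmetric]) auto
    then show ?thesis unfolding Xv P.lin_form_def
      by (auto simp: K.finsum_addf intro!: K.finsum_closed)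
  qed (auto simp: P.lin_form_def)
next
  case (6 c)
  show ?case
  proof (cases c)
    case (Xv i)
    then have i: "adj i (nb i)" using 6 adj_nb by simp
    then show ?thesis using Xv adj_symm[OF i] adj_Q[OF i] parcs by (auto intro!: path_elem_closed)
  qed (use 6 parcs adj_Q in \<open>auto intro!: path_elem_closed\<close>)
next
  case (7 c d)
  then show ?case using adj_nb adj_symm by (cases c; cases d) (auto simp: quiver_co_path_elem simp del: quiver_co.simps)
next
  case (11 i f g)
  \<comment> \<open>The three positions at which \<open>[i, j, i]\<close> can be cut give the three
    kinds of terms in the \<open>Xv\<close> coordinate of a product.\<close>
  have 3: "(f \<otimes>\<^bsub>PA\<^esub> g) [i, j, i] = f [i] \<otimes>\<^bsub>K\<^esub> g [i, j, i] \<oplus>\<^bsub>K\<^esub> f [i, j, i] \<otimes>\<^bsub>K\<^esub> g [i] \<oplus>\<^bsub>K\<^esub> f [i, j] \<otimes>\<^bsub>K\<^esub> g [j, i]" for j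
    using 11 by (simp add: PA_mult lessThan_Suc K.a_ac)
  have "(\<Oplus>\<^bsub>K\<^esub>j\<in>{j. adj i j}. (f \<otimes>\<^bsub>PA\<^esub> g) [i, j, i])
    = (\<Oplus>\<^bsub>K\<^esub>j\<in>{j. adj i j}. f [i] \<otimes>\<^bsub>K\<^esub> g [i, j, i]) \<oplus>\<^bsub>K\<^esub> (\<Oplus>\<^bsub>K\<^esub>j\<in>{j. adj i j}. f [i, j, i] \<otimes>\<^bsub>K\<^esub> g [i])
      \<oplus>\<^bsub>K\<^esub> (\<Oplus>\<^bsub>K\<^esub>j\<in>{j. adj i j}. f [i, j] \<otimes>\<^bsub>K\<^esub> g [j, i])"
    unfolding 3 using 11 by (simp add: K.finsum_addf)
  also have "(\<Oplus>\<^bsub>K\<^esub>j\<in>{j. adj i j}. f [i] \<otimes>\<^bsub>K\<^esub> g [i, j, i]) = f [i] \<otimes>\<^bsub>K\<^esub> (\<Oplus>\<^bsub>K\<^esub>j\<in>{j. adj i j}. g [i, j, i])"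
    using 11 finite_nbs by (intro K.finsum_rdistr[symmetric]) auto
  also have "(\<Oplus>\<^bsub>K\<^esub>j\<in>{j. adj i j}. f [i, j, i] \<otimes>\<^bsub>K\<^esub> g [i]) = (\<Oplus>\<^bsub>K\<^esub>j\<in>{j. adj i j}. f [i, j, i]) \<otimes>\<^bsub>K\<^esub> g [i]"
    using 11 finite_nbs by (intro K.finsum_ldistr[symmetric]) auto
  finally show ?case by simp
qed (use finite_pverts adj_Q adj_symm adj_irr in \<open>auto simp: PA_one PA_mult lessThan_Suc K.a_comm\<close>)

sublocale Z: zigzag_forms K PA "pverts Q" adj quiver_co "\<lambda>d. path_elem K (quiver_path d)"
  by (rule zigzag_forms_quiver)

text \<open>Paths with one or two vertices are basis elements; those with three reduce to zero or to
  the chosen representative of x_i; longer ones have a prefix with four vertices.\<close>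

lemma kernel_by_short_paths:
  assumes "ideal I PA" "I \<subseteq> Z.kernel"
    and three: "\<And>i j k. vwalk [i, j, k] Q \<Longrightarrow> i \<noteq> k \<Longrightarrow> path_elem K [i, j, k] \<in> I"
    and closed_walk: "\<And>i j. adj i j \<Longrightarrow> path_elem K [i, j, i] \<ominus>\<^bsub>PA\<^esub> path_elem K [i, nb i, i] \<in> I"
    and four: "\<And>i j k l. vwalk [i, j, k, l] Q \<Longrightarrow> path_elem K [i, j, k, l] \<in> I"
  shows "I = Z.kernel"
proof (rule Z.kernel_eqI[OF assms(1,2) _ span_path_elem])
  show "path_elem K ` {p. vwalk p Q} \<subseteq> carrier PA" using path_elem_closed by auto
  fix s assume "s \<in> path_elem K ` {p. vwalk p Q}"
  then obtain p where p: "vwalk p Q" "s = path_elem K p" by blast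
  have ne: "p \<noteq> []" using p(1) by (auto simp: vwalk_def)
  note sc = path_elem_closed[OF p(1)]
  from ne consider i where "p = [i]" | i j where "p = [i, j]" | i j k where "p = [i, j, k]"
    | i j k l q where "p = i # j # k # l # q"
    by (metis neq_Nil_conv)
  then show "s \<in> I \<or> (\<exists>d\<in>zz_index (pverts Q) adj. s \<ominus>\<^bsub>PA\<^esub> path_elem K (quiver_path d) \<in> I)"
  proof cases
    case (1 i)
    then have "Ev i \<in> zz_index (pverts Q) adj" "s \<ominus>\<^bsub>PA\<^esub> path_elem K (quiver_path (Ev i)) \<in> I"
      using p minus_self_ideal[OF assms(1) sc] by auto
    then show ?thesis by blast
  next
    case (2 i j)
    then have "Ar i j \<in> zz_index (pverts Q) adj" "s \<ominus>\<^bsub>PA\<^esub> path_elem K (quiver_path (Ar i j)) \<in> I"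
      using p minus_self_ideal[OF assms(1) sc] parcs by auto
    then show ?thesis by blast
  next
    case (3 i j k)
    show ?thesis
    proof (cases "i = k")
      case True
      then have "Xv i \<in> zz_index (pverts Q) adj" "s \<ominus>\<^bsub>PA\<^esub> path_elem K (quiver_path (Xv i)) \<in> I"
        using p 3 closed_walk[of i j] parcs by auto
      then show ?thesis by blast
    qed (use 3 p three in auto)
  next
    case (4 i j k l q)
    have "vwalk [i, j, k, l] Q" using p(1) 4 by (cases q) auto
    then have "path_elem K (take (Suc 3) p) \<in> I"
      using four 4 by (auto simp: numeral_3_eq_3)
    then show ?thesis using path_elem_prefix_ideal[OF assms(1) p(1), of 3] 4 p by auto
  qed
qed

lemma long_path_kernel:
  assumes "vwalk p Q" "\<And>i. p \<noteq> [i]" "\<And>i j. p \<noteq> [i, j]" "\<And>i j. p \<noteq> [i, j, i]"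
  shows "path_elem K p \<in> Z.kernel"
proof -
  have "quiver_co c (path_elem K p) = \<zero>\<^bsub>K\<^esub>" for c
    using assms(2-4) by (cases c) (auto simp: quiver_co_path_elem simp del: quiver_co.simps)
  then show ?thesis using path_elem_closed[OF assms(1)] by (simp add: Z.kernel_def)
qed

text \<open>Here every path of length two returns to its start through the only neighbour, so what
  remains to be imposed is that paths of length three, with four vertices, vanish.\<close>

lemma zigzag_two:
  assumes "\<And>i j k. adj i j \<Longrightarrow> adj j k \<Longrightarrow> k = i"
  shows "zigzag_coordinates K (quiver_algebra_mod K Q {path_elem K p | p. vwalk p Q \<and> length p = 4})
    (pverts Q) adj (\<lambda>c B. quiver_co c (SOME x. x \<in> B))
    (\<lambda>d. Z.kernel +>\<^bsub>PA\<^esub> path_elem K (quiver_path d))"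
proof -
  let ?rels = "{path_elem K p | p. vwalk p Q \<and> length p = 4}"
  have sub: "?rels \<subseteq> carrier PA" using path_elem_closed by auto
  have I: "ideal (Idl\<^bsub>PA\<^esub> ?rels) PA" by (rule P.genideal_ideal[OF sub])
  have "Idl\<^bsub>PA\<^esub> ?rels = Z.kernel"
  proof (rule kernel_by_short_paths[OF I])
    show "Idl\<^bsub>PA\<^esub> ?rels \<subseteq> Z.kernel"
      by (rule P.genideal_minimal[OF Z.kernel_ideal]) (auto intro!: long_path_kernel)
    show "path_elem K [i, j, k] \<in> Idl\<^bsub>PA\<^esub> ?rels" if "vwalk [i, j, k] Q" "i \<noteq> k" for i j k
      using that assms[of i j k] parcs by auto
    show "path_elem K [i, j, i] \<ominus>\<^bsub>PA\<^esub> path_elem K [i, nb i, i] \<in> Idl\<^bsub>PA\<^esub> ?rels" if "adj i j" for i j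
    proof -
      have i: "i \<in> pverts Q" using that adj_Q by blast
      have "j = nb i" using assms[of "nb i" i j] that adj_symm adj_nb[OF i] by blast
      moreover have "path_elem K [i, j, i] \<in> carrier PA"
        using that adj_symm adj_Q parcs by (intro path_elem_closed) auto
      ultimately show ?thesis using minus_self_ideal[OF I] by simp
    qed
    show "path_elem K [i, j, k, l] \<in> Idl\<^bsub>PA\<^esub> ?rels" if "vwalk [i, j, k, l] Q" for i j k l
    proof -
      have "path_elem K [i, j, k, l] \<in> ?rels" using that by (intro CollectI exI[of _ "[i, j, k, l]"]) simp
      then show ?thesis using P.genideal_self[OF sub] by blast
    qed
  qed
  then show ?thesis using Z.zigzag_coordinates_quotient unfolding quiver_algebra_mod_def by simp
qed

text \<open>Paths of length three are not among the generating relations and must be shown to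
  vanish. The critical one is i \<rightarrow> j \<rightarrow> i \<rightarrow> j: the assumption
  supplies a further neighbour m of i or j, and rerouting a closed part through m creates a path of
  length two with distinct endpoints.\<close>

lemma zigzag_many:
  assumes "\<And>i j. adj i j \<Longrightarrow> (\<exists>k. adj i k \<and> k \<noteq> j) \<or> (\<exists>k. adj j k \<and> k \<noteq> i)"
  shows "zigzag_coordinates K (quiver_algebra_mod K Q
      ({path_elem K [i, j, k] | i j k. vwalk [i, j, k] Q \<and> i \<noteq> k} \<union>
       {path_elem K [i, j, i] \<ominus>\<^bsub>PA\<^esub> path_elem K [i, k, i] | i j k. vwalk [i, j, i] Q \<and> vwalk [i, k, i] Q}))
    (pverts Q) adj (\<lambda>c B. quiver_co c (SOME x. x \<in> B))
    (\<lambda>d. Z.kernel +>\<^bsub>PA\<^esub> path_elem K (quiver_path d))"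
proof -
  let ?rels = "{path_elem K [i, j, k] | i j k. vwalk [i, j, k] Q \<and> i \<noteq> k} \<union>
       {path_elem K [i, j, i] \<ominus>\<^bsub>PA\<^esub> path_elem K [i, k, i] | i j k. vwalk [i, j, i] Q \<and> vwalk [i, k, i] Q}"
  let ?I = "Idl\<^bsub>PA\<^esub> ?rels"
  have sub: "?rels \<subseteq> carrier PA" using path_elem_closed by auto
  have I: "ideal ?I PA" by (rule P.genideal_ideal[OF sub])
  have three: "path_elem K [i, j, k] \<in> ?I" if "vwalk [i, j, k] Q" "i \<noteq> k" for i j k
    using P.genideal_self[OF sub] that by blast
  have walk3: "vwalk [i, j, i] Q" if "adj i j" for i j using that adj_symm adj_Q parcs by auto
  have closed_walk: "path_elem K [i, j, i] \<ominus>\<^bsub>PA\<^esub> path_elem K [i, k, i] \<in> ?I" if "adj i j" "adj i k" for i j k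
    using P.genideal_self[OF sub] walk3 that by blast
  have transfer: "y \<in> ?I" if "x \<in> carrier PA" "y \<in> carrier PA" "y \<ominus>\<^bsub>PA\<^esub> x \<in> ?I" "x \<in> ?I" for x y
  proof -
    have "(y \<ominus>\<^bsub>PA\<^esub> x) \<oplus>\<^bsub>PA\<^esub> x = y" using that by (simp add: P.minus_eq P.a_assoc P.l_neg)
    then show ?thesis using additive_subgroup.a_closed[OF ideal.axioms(1)[OF I] that(3,4)] by simp
  qed
  have "?I = Z.kernel"
  proof (rule kernel_by_short_paths[OF I _ three])
    show "?I \<subseteq> Z.kernel"
    proof (rule P.genideal_minimal[OF Z.kernel_ideal], rule subsetI)
      fix x assume "x \<in> ?rels"
      then consider i j k where "x = path_elem K [i, j, k]" "vwalk [i, j, k] Q" "i \<noteq> k"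
        | i j k where "x = path_elem K [i, j, i] \<ominus>\<^bsub>PA\<^esub> path_elem K [i, k, i]" "vwalk [i, j, i] Q" "vwalk [i, k, i] Q"
        by blast
      then show "x \<in> Z.kernel"
      proof cases
        case (1 i j k)
        then show ?thesis using long_path_kernel[OF 1(2)] by auto
      next
        case (2 i j k)
        have a: "adj i j" "adj i k" using 2 parcs by auto
        have cl: "path_elem K [i, j, i] \<in> carrier PA" "path_elem K [i, k, i] \<in> carrier PA"
          using 2 path_elem_closed by auto
        have "quiver_co c x = \<zero>\<^bsub>K\<^esub>" if c: "c \<in> zz_index (pverts Q) adj" for c
        proof -
          have "quiver_co c (path_elem K [i, j, i]) = quiver_co c (path_elem K [i, k, i])"
            using a by (cases c) (auto simp: quiver_co_path_elem simp del: quiver_co.simps)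
          moreover have "quiver_co c (path_elem K [i, k, i]) \<in> carrier K" using Z.co_closed[OF c cl(2)] .
          ultimately show ?thesis unfolding 2(1) using Z.co_minus[OF c cl] by (simp add: K.minus_eq K.r_neg)
        qed
        then show ?thesis using cl 2(1) by (simp add: Z.kernel_def)
      qed
    qed
    show "path_elem K [i, j, i] \<ominus>\<^bsub>PA\<^esub> path_elem K [i, nb i, i] \<in> ?I" if "adj i j" for i j
      using closed_walk[OF that] adj_nb that adj_Q by blast
    show "path_elem K [i, j, k, l] \<in> ?I" if w: "vwalk [i, j, k, l] Q" for i j k l
    proof -
      consider "i \<noteq> k" | "j \<noteq> l" | "k = i" "l = j" by blast
      then show ?thesis
      proof cases
        case 1
        then show ?thesis
          using path_elem_prefix_ideal[OF I w, of 2] three[of i j k] w by (auto simp: numeral_2_eq_2)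
      next
        case 2
        then show ?thesis using path_elem_suffix_ideal[OF I w, of 1] three[of j k l] w by auto
      next
        case 3
        have ij: "adj i j" "adj j i" using w parcs adj_symm by auto
        have split: "path_elem K [i, j, i, j] = path_elem K [i, j, i] \<otimes>\<^bsub>PA\<^esub> path_elem K [i, j]"
          "path_elem K [i, j, i, j] = path_elem K [i, j] \<otimes>\<^bsub>PA\<^esub> path_elem K [j, i, j]"
          using path_elem_split[of "[i, j, i, j]" 2] path_elem_split[of "[i, j, i, j]" 1] w 3
          by (auto simp: numeral_2_eq_2)
        have c: "path_elem K [i, j] \<in> carrier PA" "path_elem K [i, j, i, j] \<in> carrier PA"
          using w 3 by (auto intro!: path_elem_closed)
        show ?thesis
          using assms[OF ij(1)]
        proof
          \<comment> \<open>The closed part at \<open>i\<close> is rerouted through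
            \<open>m\<close>, after which \<open>[m, i, j]\<close> is a relation.\<close>
          assume "\<exists>k. adj i k \<and> k \<noteq> j"
          then obtain m where m: "adj i m" "m \<noteq> j" by blast
          have wm: "vwalk [i, m, i, j] Q" using m ij adj_symm adj_Q parcs by auto
          have "path_elem K [m, i, j] \<in> ?I" using three[of m i j] wm m by auto
          then have in_I: "path_elem K [i, m, i, j] \<in> ?I" using path_elem_suffix_ideal[OF I wm, of 1] by simp
          have split': "path_elem K [i, m, i, j] = path_elem K [i, m, i] \<otimes>\<^bsub>PA\<^esub> path_elem K [i, j]"
            using path_elem_split[OF wm, of 2] by (simp add: numeral_2_eq_2)
          have cl: "path_elem K [i, j, i] \<in> carrier PA" "path_elem K [i, m, i] \<in> carrier PA"
            using path_elem_closed walk3 ij m by auto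
          have "(path_elem K [i, j, i] \<ominus>\<^bsub>PA\<^esub> path_elem K [i, m, i]) \<otimes>\<^bsub>PA\<^esub> path_elem K [i, j] \<in> ?I"
            using ideal.I_r_closed[OF I closed_walk[OF ij(1) m(1)] c(1)] .
          then have "path_elem K [i, j, i, j] \<ominus>\<^bsub>PA\<^esub> path_elem K [i, m, i, j] \<in> ?I"
            unfolding split(1) split' using cl c(1) by (simp add: P.minus_eq P.l_distr P.l_minus)
          then show ?thesis using transfer[OF path_elem_closed[OF wm] c(2) _ in_I] 3 by simp
        next
          \<comment> \<open>Now the closed part at \<open>j\<close> is rerouted, and the relation is
            \<open>[i, j, m]\<close>.\<close>
          assume "\<exists>k. adj j k \<and> k \<noteq> i"
          then obtain m where m: "adj j m" "m \<noteq> i" by blast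
          have wm: "vwalk [i, j, m, j] Q" using m ij adj_symm adj_Q parcs by auto
          have "path_elem K [i, j, m] \<in> ?I" using three[of i j m] wm m by auto
          then have in_I: "path_elem K [i, j, m, j] \<in> ?I"
            using path_elem_prefix_ideal[OF I wm, of 2] by (simp add: numeral_2_eq_2)
          have split': "path_elem K [i, j, m, j] = path_elem K [i, j] \<otimes>\<^bsub>PA\<^esub> path_elem K [j, m, j]"
            using path_elem_split[OF wm, of 1] by simp
          have cl: "path_elem K [j, i, j] \<in> carrier PA" "path_elem K [j, m, j] \<in> carrier PA"
            using path_elem_closed walk3 ij m by auto
          have "path_elem K [i, j] \<otimes>\<^bsub>PA\<^esub> (path_elem K [j, i, j] \<ominus>\<^bsub>PA\<^esub> path_elem K [j, m, j]) \<in> ?I"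
            using ideal.I_l_closed[OF I closed_walk[OF ij(2) m(1)] c(1)] .
          then have "path_elem K [i, j, i, j] \<ominus>\<^bsub>PA\<^esub> path_elem K [i, j, m, j] \<in> ?I"
            unfolding split(2) split' using cl c(1) by (simp add: P.minus_eq P.r_distr P.r_minus)
          then show ?thesis using transfer[OF path_elem_closed[OF wm] c(2) _ in_I] 3 by simp
        qed
      qed
    qed
  qed
  then show ?thesis using Z.zigzag_coordinates_quotient unfolding quiver_algebra_mod_def by simp
qed

end

text \<open>Connectedness enters through closed vertex sets: a vertex without neighbours, or an edge
  without further neighbours, would be all of \<Gamma>, which is the case of one or of two
  vertices.\<close>

theorem zigzag_algebra_coordinates:
  fixes G :: "('v, 'b) pre_digraph"
  assumes "field K" "graph G"
    and conn: "\<And>S. \<lbrakk>S \<subseteq> verts G; S \<noteq> {}; \<And>u v. u \<in> S \<Longrightarrow> (u, v) \<in> arcs_ends G \<Longrightarrow> v \<in> S\<rbrakk> \<Longrightarrow> S = verts G"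
    and "verts G \<noteq> {}"
  shows "\<exists>co bas. zigzag_coordinates K (zigzag_algebra K G) (verts G) (\<lambda>u v. (u, v) \<in> arcs_ends G) co bas"
proof -
  interpret graph G by fact
  let ?adj = "\<lambda>u v. (u, v) \<in> arcs_ends G"
  have adj_V: "?adj u v \<Longrightarrow> u \<in> verts G \<and> v \<in> verts G" for u v by auto
  have sym: "?adj u v \<Longrightarrow> ?adj v u" for u v using arcs_ends_symmetric[OF sym_arcs] by blast
  have irr: "\<not> ?adj u u" for u using adj_not_same by blast
  show ?thesis
  proof (cases "card (verts G) = 1")
    case True
    then obtain v where v: "verts G = {v}" using card_1_singletonE by blast
    interpret quiver_field K "loop_quiver G"
      using assms(1) v by (auto simp: quiver_field_def quiver_field_axioms_def loop_quiver_def)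
    have "(u, w) \<notin> arcs_ends G" for u w using adj_V[of u w] irr[of v] v by auto
    then have "?adj = (\<lambda>_ _. False)" by auto
    moreover have "zigzag_algebra K G = quiver_algebra_mod K (loop_quiver G) {path_elem K [i, i, i] | i. i \<in> {v}}"
      using v by (simp add: zigzag_algebra_def Let_def)
    moreover have "pverts (loop_quiver G) = {v}" "parcs (loop_quiver G) = {(v, v)}"
      using v by (auto simp: loop_quiver_def)
    note loop_zigzag[OF this]
    ultimately show ?thesis using v by simp
  next
    case False
    have noniso: "\<exists>w. ?adj v w" if "v \<in> verts G" for v
    proof (rule ccontr)
      assume "\<nexists>w. ?adj v w"
      then have "{v} = verts G" using that by (intro conn) auto
      then show False using False by (metis is_singletonI is_singleton_altdef)
    qed
    interpret zigzag_quiver K "double_quiver G" ?adj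
      using assms(1) adj_V sym irr noniso
      by (intro zigzag_quiver.intro quiver_field.intro zigzag_quiver_axioms.intro quiver_field_axioms.intro)
         (auto simp: double_quiver_def)
    have pv: "pverts (double_quiver G) = verts G" by (simp add: double_quiver_def)
    show ?thesis
    proof (cases "card (verts G) = 2")
      case True
      then obtain a b where ab: "verts G = {a, b}" "a \<noteq> b" by (meson card_2_iff)
      have "k = i" if "?adj i j" "?adj j k" for i j k
        using adj_V[OF that(1)] adj_V[OF that(2)] irr that ab by auto
      then show ?thesis
        using zigzag_two True False unfolding pv by (fastforce simp: zigzag_algebra_def Let_def)
    next
      case two: False
      have "(\<exists>k. ?adj i k \<and> k \<noteq> j) \<or> (\<exists>k. ?adj j k \<and> k \<noteq> i)" if "?adj i j" for i j
      proof (rule ccontr)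
        assume "\<not> ?thesis"
        then have "{i, j} = verts G" using adj_V[OF that] by (intro conn) auto
        then show False using two irr that by (metis card_2_iff)
      qed
      then show ?thesis
        using zigzag_many False two unfolding pv zigzag_algebra_def Let_def by auto
    qed
  qed
qed


section \<open>Graphs oriented by a partial injection\<close>

lemma finite_downward_closed_nat:
  fixes A :: "nat set"
  assumes "finite A" "\<And>k. Suc k \<in> A \<Longrightarrow> k \<in> A"
  shows "A = {..<card A}"
proof -
  have down: "k \<in> A" if "l \<in> A" "k \<le> l" for k l
    using that(2,1) by (induction rule: inc_induct) (use assms(2) in auto)
  have "A = {..<n}" if "\<forall>k\<in>A. k < n" "\<forall>m<n. \<exists>k\<in>A. m \<le> k" for n
    using that down by (auto simp: subset_iff)
  moreover have "\<exists>n. (\<forall>k\<in>A. k < n) \<and> (\<forall>m<n. \<exists>k\<in>A. m \<le> k)"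
  proof (cases "A = {}")
    case False
    then have "Max A \<in> A" "\<forall>k\<in>A. k \<le> Max A" using assms(1) by auto
    then show ?thesis by (intro exI[of _ "Suc (Max A)"]) (auto intro!: bexI[of _ "Max A"])
  qed auto
  ultimately obtain n where "A = {..<n}" by blast
  then show ?thesis by simp
qed

locale partial_injection_graph =
  fixes V :: "'v set" and N :: "'v \<Rightarrow> 'v \<Rightarrow> bool"
  assumes finite_V: "finite V" and V_nonempty: "V \<noteq> {}"
    and N_V: "N u v \<Longrightarrow> u \<in> V \<and> v \<in> V"
    and N_irrefl: "\<not> N u u"
    and N_fun: "N u v \<Longrightarrow> N u w \<Longrightarrow> v = w"
    and N_inj: "N u w \<Longrightarrow> N v w \<Longrightarrow> u = v"
    and conn: "\<lbrakk>S \<subseteq> V; S \<noteq> {}; \<And>u v. u \<in> S \<Longrightarrow> N u v \<or> N v u \<Longrightarrow> v \<in> S\<rbrakk> \<Longrightarrow> S = V"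
begin

text \<open>Vertices are numbered by the number of \<open>N\<close>-steps from the source.
  Predecessors of reached vertices are reached as well, so by connectedness every vertex is
  reached.\<close>

lemma path_numbering:
  assumes "v0 \<in> V" and source: "\<And>u. \<not> N u v0"
  shows "\<exists>\<phi> n. n \<ge> 1 \<and> bij_betw \<phi> V {1..n} \<and>
    (\<forall>u\<in>V. \<forall>v\<in>V. N u v \<or> N v u \<longleftrightarrow> \<phi> v = \<phi> u + 1 \<or> \<phi> u = \<phi> v + (1::nat))"
proof -
  define r where "r = {(u, v). N u v}"
  have r: "(u, v) \<in> r \<longleftrightarrow> N u v" for u v by (simp add: r_def)
  have single: "v = w" if "(v0, v) \<in> r ^^ k" "(v0, w) \<in> r ^^ k" for v w k
    using that
  proof (induction k arbitrary: v w)
    case (Suc k)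
    then show ?case using N_fun unfolding relpow.simps relcomp_unfold by (auto simp: r) metis
  qed auto
  \<comment> \<open>The number of steps is well defined: \<open>N_inj\<close> cancels last steps,
    and no step leads back to the source.\<close>
  have level: "k = l" if "(v0, v) \<in> r ^^ k" "(v0, v) \<in> r ^^ l" for v k l
    using that
  proof (induction k arbitrary: v l)
    case 0
    then show ?case using source by (cases l) (auto simp: r)
  next
    case (Suc k)
    then obtain u where u: "(v0, u) \<in> r ^^ k" "N u v" by (auto simp: r)
    then obtain l' where l: "l = Suc l'" using Suc.prems(2) source by (cases l) auto
    then obtain w where "(v0, w) \<in> r ^^ l'" "N w v" using Suc.prems(2) by (auto simp: r)
    then show ?case using Suc.IH[OF u(1)] N_inj[OF u(2)] l by blast
  qed
  have all: "{v. \<exists>k. (v0, v) \<in> r ^^ k} = V"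
  proof (rule conn)
    show "{v. \<exists>k. (v0, v) \<in> r ^^ k} \<subseteq> V"
    proof safe
      fix v k assume "(v0, v) \<in> r ^^ k"
      then show "v \<in> V" using assms(1) N_V by (cases k) (auto simp: r)
    qed
    have "(v0, v0) \<in> r ^^ 0" by simp
    then show "{v. \<exists>k. (v0, v) \<in> r ^^ k} \<noteq> {}" by blast
    fix u v assume "u \<in> {v. \<exists>k. (v0, v) \<in> r ^^ k}" "N u v \<or> N v u"
    then obtain k where k: "(v0, u) \<in> r ^^ k" by blast
    show "v \<in> {v. \<exists>k. (v0, v) \<in> r ^^ k}"
    proof (cases "N u v")
      case True
      then have "(v0, v) \<in> r ^^ Suc k" using k by (auto simp: r)
      then show ?thesis by blast
    next
      case False
      then have vu: "N v u" using \<open>N u v \<or> N v u\<close> by blast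
      \<comment> \<open>The vertex \<open>u\<close> has a predecessor, so it is not the source; by
        injectivity its last step comes from \<open>v\<close>.\<close>
      then obtain k' where k': "k = Suc k'" using k source by (cases k) auto
      then obtain w where "(v0, w) \<in> r ^^ k'" "N w u" using k by (auto simp: r)
      then show ?thesis using N_inj[OF vu] by blast
    qed
  qed
  define \<psi> where "\<psi> v = (THE k. (v0, v) \<in> r ^^ k)" for v
  have \<psi>: "(v0, v) \<in> r ^^ k \<longleftrightarrow> \<psi> v = k" if vV: "v \<in> V" for v k
  proof -
    obtain l where l: "(v0, v) \<in> r ^^ l" using vV all by auto
    then have "\<psi> v = l" unfolding \<psi>_def using level by blast
    then show ?thesis using l level by blast
  qed
  have step: "N u v \<longleftrightarrow> \<psi> v = Suc (\<psi> u)" if "u \<in> V" "v \<in> V" for u v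
  proof
    assume "N u v"
    moreover have "(v0, u) \<in> r ^^ \<psi> u" using \<psi> that by blast
    ultimately have "(v0, v) \<in> r ^^ Suc (\<psi> u)" by (auto simp: r)
    then show "\<psi> v = Suc (\<psi> u)" using \<psi> that by blast
  next
    assume "\<psi> v = Suc (\<psi> u)"
    then have "(v0, v) \<in> r ^^ Suc (\<psi> u)" using \<psi> that by blast
    then obtain w where w: "(v0, w) \<in> r ^^ \<psi> u" "N w v" by (auto simp: r)
    moreover have "(v0, u) \<in> r ^^ \<psi> u" using \<psi> that by blast
    ultimately show "N u v" using single by blast
  qed
  have inj: "inj_on \<psi> V"
  proof (rule inj_onI)
    fix u v assume "u \<in> V" "v \<in> V" "\<psi> u = \<psi> v"
    then show "u = v" using \<psi>[of u "\<psi> v"] \<psi>[of v "\<psi> v"] single by blast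
  qed
  have "\<psi> ` V = {..<card (\<psi> ` V)}"
  proof (rule finite_downward_closed_nat)
    show "finite (\<psi> ` V)" using finite_V by simp
    fix k assume "Suc k \<in> \<psi> ` V"
    then obtain v where "v \<in> V" "\<psi> v = Suc k" by (metis imageE)
    then have "(v0, v) \<in> r ^^ Suc k" using \<psi> by blast
    then obtain w where "(v0, w) \<in> r ^^ k" by auto
    moreover from this have "w \<in> V" using all by blast
    ultimately show "k \<in> \<psi> ` V" using \<psi>[of w k] by (metis imageI)
  qed
  then have img: "\<psi> ` V = {..<card V}" using card_image[OF inj] by simp
  have "bij_betw (\<lambda>v. Suc (\<psi> v)) V {1..card V}"
  proof (rule bij_betw_imageI)
    show "inj_on (\<lambda>v. Suc (\<psi> v)) V" using inj by (simp add: inj_on_def)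
    have "(\<lambda>v. Suc (\<psi> v)) ` V = Suc ` {..<card V}" using img by (metis image_image)
    also have "\<dots> = {1..card V}" by (simp add: image_Suc_lessThan)
    finally show "(\<lambda>v. Suc (\<psi> v)) ` V = {1..card V}" .
  qed
  moreover have "card V \<ge> 1" using finite_V V_nonempty by (simp add: Suc_leI card_gt_0_iff)
  moreover have "\<forall>u\<in>V. \<forall>v\<in>V. N u v \<or> N v u \<longleftrightarrow> Suc (\<psi> v) = Suc (\<psi> u) + 1 \<or> Suc (\<psi> u) = Suc (\<psi> v) + 1"
    using step by auto
  ultimately show ?thesis by blast
qed

text \<open>Choosing predecessors gives an injective map of a finite set into itself, which is then
  surjective, so successors exist too. The orbit of a vertex under the successor map closes up at
  its least return time and exhausts the connected graph.\<close>

lemma cycle_numbering: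
  assumes no_source: "\<And>v. v \<in> V \<Longrightarrow> \<exists>u. N u v"
  shows "\<exists>\<phi> m. (m::nat) \<ge> 2 \<and> bij_betw \<phi> V {..<m} \<and> (\<forall>u\<in>V. \<forall>v\<in>V. N u v \<longleftrightarrow> \<phi> v = (\<phi> u + 1) mod m)"
    and "\<not> acyclic {(u, v). N u v}"
proof -
  define p where "p v = (SOME u. N u v)" for v
  have p: "N (p v) v" if "v \<in> V" for v unfolding p_def using no_source[OF that] by (rule someI_ex)
  have "inj_on p V" using p N_fun by (metis inj_onI)
  moreover have "p ` V \<subseteq> V" using p N_V by blast
  ultimately have surj: "p ` V = V" using finite_V by (simp add: endo_inj_surj)
  have total: "\<exists>w. N v w" if vV: "v \<in> V" for v
  proof -
    have "v \<in> p ` V" using vV surj by simp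
    then obtain w where "w \<in> V" "v = p w" by blast
    then show ?thesis using p by blast
  qed
  define s where "s v = (SOME w. N v w)" for v
  have s: "N v (s v)" if "v \<in> V" for v unfolding s_def using total[OF that] by (rule someI_ex)
  have Ns: "N u v \<longleftrightarrow> v = s u" if "u \<in> V" for u v using s[OF that] N_fun by blast
  have sV: "s v \<in> V" if "v \<in> V" for v using s[OF that] N_V by blast
  have s_inj: "u = v" if "s u = s v" "u \<in> V" "v \<in> V" for u v using s that N_inj by metis
  obtain v0 where v0: "v0 \<in> V" using V_nonempty by blast
  define g where "g k = (s ^^ k) v0" for k :: nat
  have gV: "g k \<in> V" for k by (induction k) (use v0 sV in \<open>auto simp: g_def\<close>)
  have gS: "g (Suc k) = s (g k)" for k by (simp add: g_def)
  \<comment> \<open>Injectivity of \<open>s\<close> cancels common steps, so any repetition in the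
    orbit gives a return to \<open>v0\<close> itself.\<close>
  have shift: "g (l - k) = v0" if "g k = g l" "k \<le> l" for k l
    using that
  proof (induction k arbitrary: l)
    case 0
    then show ?case by (simp add: g_def)
  next
    case (Suc k)
    then obtain l' where l: "l = Suc l'" by (cases l) auto
    then have "s (g k) = s (g l')" using Suc.prems by (simp add: gS)
    then have "g k = g l'" using s_inj gV by blast
    then show ?case using Suc.IH Suc.prems(2) l by simp
  qed
  have "\<exists>k l. k < l \<and> g k = g l"
  proof (rule ccontr)
    assume neg: "\<nexists>k l. k < l \<and> g k = g l"
    have "inj g"
    proof (rule linorder_injI, rule notI)
      fix x y assume "x < y" "g x = g y"
      then have "\<exists>k l. k < l \<and> g k = g l" by (intro exI conjI)
      with neg show False by (rule notE)
    qed
    moreover have "range g \<subseteq> V" using gV by (rule image_subsetI)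
    then have "finite (range g)" using finite_V by (rule finite_subset)
    ultimately have "finite (UNIV :: nat set)" by (rule finite_imageD[rotated])
    with infinite_UNIV_nat show False by (rule notE)
  qed
  then obtain k l where kl: "k < l" "g k = g l" by blast
  have "g (l - k) = v0" using kl(2) less_imp_le[OF kl(1)] by (rule shift)
  moreover have "0 < l - k" using kl(1) by simp
  ultimately have "\<exists>m. m > 0 \<and> g m = v0" by (intro exI[of _ "l - k"] conjI)
  define m where "m = (LEAST m. m > 0 \<and> g m = v0)"
  have m: "m > 0" "g m = v0" "\<And>j. 0 < j \<Longrightarrow> j < m \<Longrightarrow> g j \<noteq> v0"
    using LeastI_ex[OF \<open>\<exists>m. m > 0 \<and> g m = v0\<close>, folded m_def]
      not_less_Least[of _ "\<lambda>m. m > 0 \<and> g m = v0", folded m_def] by blast+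
  have inj: "inj_on g {..<m}"
  proof (rule inj_onI)
    fix i j assume ij: "i \<in> {..<m}" "j \<in> {..<m}" "g i = g j"
    have False if "a < b" "b < m" "g a = g b" for a b
    proof -
      have "g (b - a) = v0" using that(3) less_imp_le[OF that(1)] by (rule shift)
      moreover have "0 < b - a" "b - a < m" using that by auto
      ultimately show False using m(3) by blast
    qed
    from this[of i j] this[of j i] show "i = j" using ij by (cases i j rule: linorder_cases) auto
  qed
  have gmod: "g (Suc k mod m) = s (g k)" if "k < m" for k
  proof (cases "Suc k = m")
    case True
    then have "s (g k) = v0" using m(2) gS by metis
    moreover have "g 0 = v0" by (simp add: g_def)
    ultimately show ?thesis using True by simp
  next
    case False
    then show ?thesis using that by (simp add: gS)
  qed
  have img: "g ` {..<m} = V"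
  proof (rule conn)
    show "g ` {..<m} \<subseteq> V" using gV by blast
    show "g ` {..<m} \<noteq> {}" using m(1) by auto
    fix u v assume "u \<in> g ` {..<m}" "N u v \<or> N v u"
    then obtain k where k: "k < m" "u = g k" by blast
    show "v \<in> g ` {..<m}"
    proof (cases "N u v")
      case True
      then have "v = g (Suc k mod m)" using Ns k gV gmod by simp
      then show ?thesis using m(1) by auto
    next
      case False
      then have vu: "N v u" using \<open>N u v \<or> N v u\<close> by blast
      \<comment> \<open>The index before \<open>k\<close> modulo \<open>m\<close>: the predecessor
        of \<open>g 0\<close> is \<open>g (m - 1)\<close>.\<close>
      define l where "l = (if k = 0 then m - 1 else k - 1)"
      have l: "l < m" "Suc l mod m = k" using k m(1) by (auto simp: l_def)
      then have "s (g l) = u" using gmod[of l] k by simp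
      then have "N (g l) u" using s[OF gV] by blast
      then show ?thesis using N_inj[OF vu] l by blast
    qed
  qed
  define \<phi> where "\<phi> = inv_into {..<m} g"
  have bij: "bij_betw \<phi> V {..<m}"
    unfolding \<phi>_def using inj img by (intro bij_betw_inv_into) (simp add: bij_betw_def)
  have \<phi>g: "\<phi> (g k) = k" if "k < m" for k unfolding \<phi>_def using inj that by simp
  have "N u v \<longleftrightarrow> \<phi> v = (\<phi> u + 1) mod m" if "u \<in> V" "v \<in> V" for u v
  proof -
    have "u \<in> g ` {..<m}" "v \<in> g ` {..<m}" using that img by simp_all
    then obtain k l where k: "k < m" "u = g k" "l < m" "v = g l" by blast
    have "N u v \<longleftrightarrow> v = g (Suc k mod m)" using Ns[OF that(1)] gmod[OF k(1)] k by simp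
    also have "\<dots> \<longleftrightarrow> l = Suc k mod m" using k inj m(1) by (auto simp: inj_on_eq_iff)
    finally show ?thesis using k \<phi>g by simp
  qed
  moreover have "m \<ge> 2"
  proof (rule ccontr)
    assume "\<not> m \<ge> 2"
    then have "m = 1" using m(1) by simp
    then have "s v0 = v0" using m(2) by (simp add: g_def)
    then show False using s[OF v0] N_irrefl by metis
  qed
  ultimately show "\<exists>\<phi> m. (m::nat) \<ge> 2 \<and> bij_betw \<phi> V {..<m} \<and> (\<forall>u\<in>V. \<forall>v\<in>V. N u v \<longleftrightarrow> \<phi> v = (\<phi> u + 1) mod m)"
    using bij by blast
  have "(v0, g k) \<in> {(u, v). N u v}\<^sup>*" for k
  proof (induction k)
    case (Suc k)
    moreover have "N (g k) (g (Suc k))" using s[OF gV] by (simp add: gS)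
    ultimately show ?case by (auto intro: rtrancl_into_rtrancl)
  qed (simp add: g_def)
  moreover have "N (g (m - 1)) v0" using s[OF gV[of "m - 1"]] m(1,2) by (simp add: gS[symmetric])
  ultimately have "(v0, v0) \<in> {(u, v). N u v}\<^sup>+" by (auto intro: rtrancl_into_trancl1)
  then show "\<not> acyclic {(u, v). N u v}" by (auto simp: acyclic_def)
qed

text \<open>Two vertices that are successors of each other form a cycle for \<open>N\<close> but a
  single edge of the graph, hence a path. Cycles with m = n + 1 \<ge> 3 vertices remain for the
  second alternative.\<close>

lemma numbering:
  "(\<exists>\<phi> n. n \<ge> 1 \<and> bij_betw \<phi> V {1..n} \<and>
      (\<forall>u\<in>V. \<forall>v\<in>V. N u v \<or> N v u \<longleftrightarrow> \<phi> v = \<phi> u + 1 \<or> \<phi> u = \<phi> v + (1::nat))) \<or>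
   (\<not> acyclic {(u, v). N u v} \<and> (\<exists>\<phi> n. n \<ge> 2 \<and> bij_betw \<phi> V {0..n} \<and>
      (\<forall>u\<in>V. \<forall>v\<in>V. N u v \<or> N v u \<longleftrightarrow> \<phi> v = (\<phi> u + 1) mod (n + 1) \<or> \<phi> u = (\<phi> v + 1) mod (n + (1::nat)))))"
proof (cases "\<exists>v0\<in>V. \<forall>u. \<not> N u v0")
  case True
  then show ?thesis using path_numbering by blast
next
  case False
  then obtain \<phi> and m :: nat where \<phi>: "m \<ge> 2" "bij_betw \<phi> V {..<m}"
      "\<And>u v. u \<in> V \<Longrightarrow> v \<in> V \<Longrightarrow> N u v \<longleftrightarrow> \<phi> v = (\<phi> u + 1) mod m"
    and cyc: "\<not> acyclic {(u, v). N u v}"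
    using cycle_numbering by blast
  show ?thesis
  proof (cases "m = 2")
    case True
    have lt: "\<phi> v < 2" if "v \<in> V" for v using \<phi>(2) True that by (auto simp: bij_betw_def)
    have "bij_betw (\<lambda>v. Suc (\<phi> v)) V {1..2}"
    proof (rule bij_betw_imageI)
      show "inj_on (\<lambda>v. Suc (\<phi> v)) V" using \<phi>(2) by (simp add: bij_betw_def inj_on_def)
      have "\<phi> ` V = {..<2}" using \<phi>(2) True by (simp add: bij_betw_def)
      then have "(\<lambda>v. Suc (\<phi> v)) ` V = Suc ` {..<2}" by (metis image_image)
      then show "(\<lambda>v. Suc (\<phi> v)) ` V = {1..2}" by (simp add: image_Suc_lessThan)
    qed
    moreover have "N u v \<or> N v u \<longleftrightarrow> Suc (\<phi> v) = Suc (\<phi> u) + 1 \<or> Suc (\<phi> u) = Suc (\<phi> v) + 1"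
      if uv: "u \<in> V" "v \<in> V" for u v
    proof -
      have "\<phi> u = 0 \<or> \<phi> u = 1" "\<phi> v = 0 \<or> \<phi> v = 1" using lt[OF uv(1)] lt[OF uv(2)] by linarith+
      then show ?thesis
        unfolding \<phi>(3)[OF uv] \<phi>(3)[OF uv(2,1)] True by (elim disjE) simp_all
    qed
    ultimately have "2 \<ge> (1::nat) \<and> bij_betw (\<lambda>v. Suc (\<phi> v)) V {1..2} \<and> (\<forall>u\<in>V. \<forall>v\<in>V.
        N u v \<or> N v u \<longleftrightarrow> Suc (\<phi> v) = Suc (\<phi> u) + 1 \<or> Suc (\<phi> u) = Suc (\<phi> v) + 1)" by simp
    then show ?thesis by (intro disjI1 exI[of _ "\<lambda>v. Suc (\<phi> v)"] exI[of _ "2 :: nat"])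
  next
    case False
    then have m: "m - 1 \<ge> 2" "m - 1 + 1 = m" "{..<m} = {0..m - 1}" using \<phi>(1) by auto
    have "m - 1 \<ge> 2 \<and> bij_betw \<phi> V {0..m - 1} \<and> (\<forall>u\<in>V. \<forall>v\<in>V. N u v \<or> N v u \<longleftrightarrow>
        \<phi> v = (\<phi> u + 1) mod (m - 1 + 1) \<or> \<phi> u = (\<phi> v + 1) mod (m - 1 + 1))"
      using m \<phi>(2,3) unfolding m(2) by simp
    then show ?thesis by (intro disjI2 conjI[OF cyc] exI[of _ \<phi>] exI[of _ "m - 1"])
  qed
qed

end

section \<open>Isomorphisms with standard graphs\<close>

text \<open>Arcs of the target are pairs, so the vertex map of an isomorphism determines its arc
  map. Conversely a vertex map induces an injective arc map because there are no parallel
  arcs.\<close>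

lemma (in graph) digraph_iso_numbering:
  "digraph_iso G (with_proj H) \<longleftrightarrow> (\<exists>\<phi>. bij_betw \<phi> (verts G) (pverts H) \<and> parcs H \<subseteq> pverts H \<times> pverts H \<and>
     (\<forall>u\<in>verts G. \<forall>v\<in>verts G. (u, v) \<in> arcs_ends G \<longleftrightarrow> (\<phi> u, \<phi> v) \<in> parcs H))" (is "?L \<longleftrightarrow> ?R")
proof
  assume ?L
  then obtain f where f: "digraph_isomorphism f" "with_proj H = app_iso f G" by (auto simp: digraph_iso_def)
  let ?\<phi> = "iso_verts f"
  have inj: "inj_on ?\<phi> (verts G)"
    and th: "\<And>a. a \<in> arcs G \<Longrightarrow> ?\<phi> (tail G a) = iso_tail f (iso_arcs f a) \<and> ?\<phi> (head G a) = iso_head f (iso_arcs f a)"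
    using f(1) by (auto simp: digraph_isomorphism_def)
  have eq: "pverts H = ?\<phi> ` verts G" "parcs H = iso_arcs f ` arcs G" "iso_tail f = fst" "iso_head f = snd"
    using arg_cong[OF f(2), of verts] arg_cong[OF f(2), of arcs] arg_cong[OF f(2), of tail] arg_cong[OF f(2), of head]
    by (simp_all add: verts_app_iso arcs_app_iso tail_app_iso head_app_iso)
  have "iso_arcs f a = (?\<phi> (tail G a), ?\<phi> (head G a))" if "a \<in> arcs G" for a
    using th[OF that] eq by (simp add: prod_eq_iff)
  then have pH: "parcs H = map_prod ?\<phi> ?\<phi> ` arcs_ends G"
    unfolding eq(2) arcs_ends_conv image_image by (intro image_cong) auto
  have "(u, v) \<in> arcs_ends G \<longleftrightarrow> (?\<phi> u, ?\<phi> v) \<in> parcs H" if "u \<in> verts G" "v \<in> verts G" for u v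
  proof
    assume "(?\<phi> u, ?\<phi> v) \<in> parcs H"
    then obtain u' v' where uv: "(u', v') \<in> arcs_ends G" "?\<phi> u = ?\<phi> u'" "?\<phi> v = ?\<phi> v'" using pH by auto
    then have "u' \<in> verts G" "v' \<in> verts G" by auto
    then have "u = u'" "v = v'" using uv that inj by (auto dest: inj_onD)
    then show "(u, v) \<in> arcs_ends G" using uv(1) by simp
  qed (auto simp: pH)
  moreover have "parcs H \<subseteq> pverts H \<times> pverts H" unfolding pH eq(1) by auto
  ultimately show ?R using inj eq(1) by (intro exI[of _ ?\<phi>]) (auto simp: bij_betw_def)
next
  assume ?R
  then obtain \<phi> where \<phi>: "bij_betw \<phi> (verts G) (pverts H)" "parcs H \<subseteq> pverts H \<times> pverts H"
    "\<And>u v. u \<in> verts G \<Longrightarrow> v \<in> verts G \<Longrightarrow> (u, v) \<in> arcs_ends G \<longleftrightarrow> (\<phi> u, \<phi> v) \<in> parcs H" by blast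
  have inj: "inj_on \<phi> (verts G)" and img: "\<phi> ` verts G = pverts H" using \<phi>(1) by (auto simp: bij_betw_def)
  define f where "f = \<lparr> iso_verts = \<phi>, iso_arcs = (\<lambda>a. (\<phi> (tail G a), \<phi> (head G a))), iso_head = snd, iso_tail = fst \<rparr>"
  have "inj_on (\<lambda>a. (\<phi> (tail G a), \<phi> (head G a))) (arcs G)"
  proof (rule inj_onI)
    fix a b assume ab: "a \<in> arcs G" "b \<in> arcs G" "(\<phi> (tail G a), \<phi> (head G a)) = (\<phi> (tail G b), \<phi> (head G b))"
    then have "tail G a = tail G b" "head G a = head G b" using inj by (auto dest: inj_onD)
    then show "a = b" using ab no_multi_arcs by (simp add: arc_to_ends_def)
  qed
  then have "digraph_isomorphism f"
    using inj wf_digraph by (simp add: digraph_isomorphism_def f_def)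
  moreover have "parcs H = (\<lambda>a. (\<phi> (tail G a), \<phi> (head G a))) ` arcs G"
  proof (intro equalityI subsetI)
    fix e assume e: "e \<in> parcs H"
    then obtain u v where uv: "e = (\<phi> u, \<phi> v)" "u \<in> verts G" "v \<in> verts G" using \<phi>(2) img by blast
    then have "(u, v) \<in> arcs_ends G" using \<phi>(3) e by blast
    then show "e \<in> (\<lambda>a. (\<phi> (tail G a), \<phi> (head G a))) ` arcs G" using uv(1) by (auto simp: arcs_ends_conv)
  next
    fix e assume "e \<in> (\<lambda>a. (\<phi> (tail G a), \<phi> (head G a))) ` arcs G"
    then obtain a where a: "a \<in> arcs G" "e = (\<phi> (tail G a), \<phi> (head G a))" by blast
    then have "(tail G a, head G a) \<in> arcs_ends G" by (auto simp: arcs_ends_conv)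
    then show "e \<in> parcs H" using \<phi>(3)[of "tail G a" "head G a"] a by simp
  qed
  then have "with_proj H = app_iso f G"
    using img by (simp add: with_proj_def app_iso_def f_def)
  ultimately show ?L by (auto simp: digraph_iso_def)
qed

text \<open>Arcs of a \<open>graph\<close> come in opposite pairs, so \<open>mk_symmetric\<close>
  adds no adjacency and reachability can be followed inside \<open>S\<close>.\<close>

lemma (in graph) connected_closed_set:
  assumes "connected G" "S \<subseteq> verts G" "S \<noteq> {}" "\<And>u v. u \<in> S \<Longrightarrow> (u, v) \<in> arcs_ends G \<Longrightarrow> v \<in> S"
  shows "S = verts G"
proof -
  obtain u where u: "u \<in> S" using assms(3) by blast
  have "v \<in> S" if v: "v \<in> verts G" for v
  proof -
    have "u \<rightarrow>\<^sup>*\<^bsub>with_proj (mk_symmetric G)\<^esub> v"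
      using assms(1,2) u v unfolding connected_def strongly_connected_def by auto
    then have "(u, v) \<in> rtrancl_on (verts (with_proj (mk_symmetric G))) (arcs_ends (with_proj (mk_symmetric G)))"
      by (simp add: reachable_def)
    then show ?thesis
    proof (induction rule: rtrancl_on_induct)
      case (step v w)
      then have "(v, w) \<in> arcs_ends G" using adj_mk_symmetric_eq[OF sym_arcs] by simp
      then show ?case using step assms(4) by blast
    qed (rule u)
  qed
  then show ?thesis using assms(2) by blast
qed


section \<open>Cells of an oriented graph\<close>

lemma exists_inj_on_finite:
  assumes "finite (A :: 'a set)"
  shows "\<exists>f :: 'a \<Rightarrow> 'b::infinite. inj_on f A"
proof -
  obtain B :: "'b set" where B: "finite B" "card B = card A"
    using infinite_arbitrarily_large[OF infinite_UNIV, of "card A"] by blast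
  then show ?thesis using finite_same_card_bij[OF assms B(1)] by (auto simp: bij_betw_def)
qed

text \<open>
  The cell \<open>(v, True)\<close> has top \<open>v\<close> and the successor of \<open>v\<close>, if any, as its bottom; a vertex \<open>v\<close>
  without predecessor is moreover the bottom of a cell \<open>(v, False)\<close> without top.
\<close>

locale oriented_zigzag = zigzag_coordinates K R V adj co bas
  for K :: "('k, 'm) ring_scheme" and R :: "('k, 'a, 'n) module_scheme" (structure)
    and V :: "'v set" and adj :: "'v \<Rightarrow> 'v \<Rightarrow> bool"
    and co :: "'v zz \<Rightarrow> 'a \<Rightarrow> 'k" and bas :: "'v zz \<Rightarrow> 'a" +
  fixes N :: "'v \<Rightarrow> 'v \<Rightarrow> bool" and \<kappa> :: "'v \<times> bool \<Rightarrow> 'x" and \<iota> :: "'v \<Rightarrow> 's"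
  assumes adj_N: "adj u v \<longleftrightarrow> N u v \<or> N v u"
    and N_fun: "N u v \<Longrightarrow> N u w \<Longrightarrow> v = w" and N_inj: "N u w \<Longrightarrow> N v w \<Longrightarrow> u = v"
    and N_asym: "N u v \<Longrightarrow> N v u \<Longrightarrow> False"
    and inj_\<kappa>: "inj_on \<kappa> (V \<times> UNIV)" and inj_\<iota>: "inj_on \<iota> V"
begin

definition cells :: "'x set" where
  "cells = \<kappa> ` (V \<times> {True} \<union> {v \<in> V. \<forall>u. \<not> N u v} \<times> {False})"

definition top :: "'x \<Rightarrow> 'v \<Rightarrow> bool" where
  "top k v \<longleftrightarrow> v \<in> V \<and> k = \<kappa> (v, True)"

definition bot :: "'x \<Rightarrow> 'v \<Rightarrow> bool" where
  "bot k v \<longleftrightarrow> v \<in> V \<and> ((\<exists>u. N u v \<and> k = \<kappa> (u, True)) \<or> (\<forall>u. \<not> N u v) \<and> k = \<kappa> (v, False))"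

lemma N_V: "N u v \<Longrightarrow> u \<in> V \<and> v \<in> V"
  using adj_N adj_V by blast

lemma \<kappa>_eq: "u \<in> V \<Longrightarrow> v \<in> V \<Longrightarrow> \<kappa> (u, a) = \<kappa> (v, b) \<longleftrightarrow> u = v \<and> a = b"
  using inj_on_eq_iff[OF inj_\<kappa>, of "(u, a)" "(v, b)"] by auto

lemma top_bot: "top k u \<Longrightarrow> bot k v \<longleftrightarrow> N u v"
  unfolding top_def bot_def using \<kappa>_eq N_V by metis

lemma cell_pattern_cells:
  assumes "(\<forall>v\<in>V. ev v = \<one>) \<or> (\<forall>v\<in>V. ev v = bas (Ev v))"
    and "\<And>v. v \<in> V \<Longrightarrow> partial_order_on cells (leq (ev v))"
    and "\<And>k l v. top k v \<Longrightarrow> bot l v \<Longrightarrow> (l, k) \<in> leq (ev v)"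
  shows "cell_pattern K R V adj co bas cells \<iota> top bot ev leq"
proof (unfold_locales, goal_cases)
  case (5 k v w)
  then show ?case unfolding bot_def using \<kappa>_eq N_V N_fun by metis
next
  case (7 k v l)
  then show ?case unfolding bot_def using N_inj by blast
next
  case (9 v)
  then show ?case by (cases "\<exists>u. N u v") (auto simp: bot_def)
next
  case (10 u v)
  have "\<exists>k. top k u" if "u \<in> V" for u using that by (auto simp: top_def)
  then show ?case using adj_N top_bot N_V by metis
next
  case (11 k u v l)
  then show ?case using top_bot N_asym by blast
next
  case (3 k v)
  then show ?case by (auto simp: bot_def cells_def dest: N_V)
qed (use assms inj_\<iota> \<kappa>_eq in \<open>auto simp: top_def bot_def cells_def\<close>)

text \<open>In the order of e_v, the cell with bottom v lies below the cell with top v, and no other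
  distinct cells are compared. There are no chains of three cells, so antisymmetry and transitivity
  hold even when the cells are arranged in a cycle.\<close>

theorem relative_cellular:
  "relative_cellular_algebra TYPE('x) TYPE('s) K R"
proof -
  define leq where "leq \<epsilon> = Id_on cells \<union> {(l, k). \<exists>v. \<epsilon> = bas (Ev v) \<and> top k v \<and> bot l v}" for \<epsilon>
  have tV: "v \<in> V \<and> k \<in> cells" if "top k v" for k v using that by (auto simp: top_def cells_def)
  have bV: "v \<in> V \<and> k \<in> cells" if "bot k v" for k v using that by (auto simp: bot_def cells_def dest: N_V)
  have nb: "\<not> bot k v" if "top k v" for k v using that top_bot N_asym by blast
  have not_chain: False if "bas (Ev v) = bas (Ev w)" "top k v" "bot k w" for v w k
  proof -
    have "v = w" using inj_onD[OF inj_bas that(1)] tV[OF that(2)] bV[OF that(3)] by simp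
    then show False using nb that by blast
  qed
  have strict: "\<exists>v. \<epsilon> = bas (Ev v) \<and> top k v \<and> bot l v" if "(l, k) \<in> leq \<epsilon>" "l \<noteq> k" for l k \<epsilon>
    using that by (auto simp: leq_def)
  have no_chain: "l = k \<or> k = m" if lk: "(l, k) \<in> leq \<epsilon>" and km: "(k, m) \<in> leq \<epsilon>" for l k m \<epsilon>
  proof (rule ccontr)
    assume neg: "\<not> (l = k \<or> k = m)"
    then obtain v where "\<epsilon> = bas (Ev v)" "top k v" using strict[OF lk] by blast
    moreover obtain w where "\<epsilon> = bas (Ev w)" "bot k w" using strict[OF km] neg by blast
    ultimately show False using not_chain[of v w k] by simp
  qed
  have "partial_order_on cells (leq \<epsilon>)" for \<epsilon>
    unfolding partial_order_on_def preorder_on_def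
  proof (intro conjI)
    show "refl_on cells (leq \<epsilon>)" using tV bV by (auto simp: refl_on_def leq_def)
    show "leq \<epsilon> \<subseteq> cells \<times> cells" using tV bV by (auto simp: leq_def)
    show "trans (leq \<epsilon>)" using no_chain by (intro transI) metis
    show "antisym (leq \<epsilon>)" using no_chain by (intro antisymI) metis
  qed
  then interpret cell_pattern K R V adj co bas cells \<iota> top bot "\<lambda>v. bas (Ev v)" leq
    by (intro cell_pattern_cells) (auto simp: leq_def)
  show ?thesis using relative_cell_datum_pattern unfolding relative_cellular_algebra_def by blast
qed

text \<open>Numbers that increase along \<open>N\<close> order all cells at once, so that a single
  order serves every vertex.\<close>

theorem cellular:
  assumes "\<And>u v. N u v \<Longrightarrow> \<phi> u < (\<phi> v :: nat)" "V \<noteq> {}"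
  shows "cellular_algebra TYPE('x) TYPE('s) K R"
proof -
  \<comment> \<open>The cell without a top gets rank 0, and \<open>Suc\<close> keeps all others
    above it even where \<open>\<phi>\<close> is 0.\<close>
  define rank where "rank k = (THE n. \<exists>v\<in>V. (k = \<kappa> (v, True) \<and> n = Suc (\<phi> v)) \<or> (k = \<kappa> (v, False) \<and> n = 0))" for k
  have rank: "rank (\<kappa> (v, b)) = (if b then Suc (\<phi> v) else 0)" if "v \<in> V" for v b
    unfolding rank_def using that \<kappa>_eq by (intro the_equality) auto
  define leq :: "'a \<Rightarrow> ('x \<times> 'x) set" where
    "leq = (\<lambda>_. {(l, k). l \<in> cells \<and> k \<in> cells \<and> (l = k \<or> rank l < rank k)})"
  have "partial_order_on cells (leq \<epsilon>)" for \<epsilon>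
    unfolding partial_order_on_def preorder_on_def
    by (auto simp: refl_on_def trans_def antisym_def leq_def)
  moreover have "(l, k) \<in> leq \<epsilon>" if "top k v" "bot l v" for k l v \<epsilon>
  proof -
    have c: "k \<in> cells" "l \<in> cells" using that by (auto simp: top_def bot_def cells_def dest: N_V)
    have "rank k = Suc (\<phi> v)" using that(1) rank by (auto simp: top_def)
    moreover have "rank l < Suc (\<phi> v)"
      using that(2) rank assms(1) N_V by (auto simp: bot_def)
    ultimately show ?thesis using c by (simp add: leq_def)
  qed
  ultimately interpret cell_pattern K R V adj co bas cells \<iota> top bot "\<lambda>_. \<one>" leq
    by (intro cell_pattern_cells) auto
  have "(\<lambda>_. \<one>) ` V = {\<one>}" using assms(2) by auto
  then show ?thesis using relative_cell_datum_pattern unfolding cellular_algebra_def by metis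
qed

end

lemma cellular_imp_relative_cellular:
  "cellular_algebra TYPE('x) TYPE('s) K R \<Longrightarrow> relative_cellular_algebra TYPE('x) TYPE('s) K R"
  unfolding cellular_algebra_def relative_cellular_algebra_def by blast

theorem theorem1:
  fixes K :: "('k, 'm) ring_scheme" and G :: "('v, 'b) pre_digraph"
  assumes "field K" and "graph G" and "connected G"
  shows "(cellular_algebra TYPE('x::infinite) TYPE('s::infinite) K (zigzag_algebra K G) \<longleftrightarrow>
            (\<exists>n\<ge>1. digraph_iso G (type_A n))) \<and>
         (relative_cellular_algebra TYPE('x) TYPE('s) K (zigzag_algebra K G) \<longleftrightarrow>
            (\<exists>n\<ge>1. digraph_iso G (type_A n)) \<or> (\<exists>n\<ge>2. digraph_iso G (type_affine_A n)))"
proof -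
  interpret graph G by fact
  let ?V = "verts G" and ?adj = "\<lambda>u v. (u, v) \<in> arcs_ends G" and ?Z = "zigzag_algebra K G"
  have V0: "?V \<noteq> {}" using assms(3) by (simp add: connected_def strongly_connected_def)
  note closed = connected_closed_set[OF assms(3)]
  obtain co bas where coords: "zigzag_coordinates K ?Z ?V ?adj co bas"
    using zigzag_algebra_coordinates[OF assms(1,2) closed V0] by blast
  interpret Z: zigzag_coordinates K ?Z ?V ?adj co bas by (rule coords)
  \<comment> \<open>A source labels two cells and any other vertex one, so pairs with a Boolean are
    embedded into the index type.\<close>
  obtain \<kappa> :: "'v \<times> bool \<Rightarrow> 'x" where \<kappa>: "inj_on \<kappa> (?V \<times> UNIV)"
    using exists_inj_on_finite[of "?V \<times> (UNIV :: bool set)"] by auto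
  obtain \<iota> :: "'v \<Rightarrow> 's" where \<iota>: "inj_on \<iota> ?V" using exists_inj_on_finite[of ?V] by auto
  \<comment> \<open>One statement serves both necessity proofs: for \<open>E = {1}\<close> the
    cyclic alternative drops out.\<close>
  have shape: "(\<exists>n\<ge>1. digraph_iso G (type_A n)) \<or>
      E \<noteq> {\<one>\<^bsub>?Z\<^esub>} \<and> (\<exists>n\<ge>2. digraph_iso G (type_affine_A n))"
    if datum: "relative_cell_datum K ?Z X M C star E leq eps"
    for X :: "'x set" and M :: "'x \<Rightarrow> 's set" and C star E leq eps
  proof -
    interpret zigzag_cell_datum K ?Z X M C star E leq eps ?V ?adj co bas
      using datum coords by (rule zigzag_cell_datum.intro)
    obtain N where N: "\<And>u v. ?adj u v \<longleftrightarrow> N u v \<or> N v u"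
      "\<And>u v w. N u v \<Longrightarrow> N u w \<Longrightarrow> v = w" "\<And>u v w. N u w \<Longrightarrow> N v w \<Longrightarrow> u = v"
      "E = {\<one>\<^bsub>?Z\<^esub>} \<Longrightarrow> acyclic {(u, v). N u v}"
      using adjacency_is_partial_injection by blast
    interpret P: partial_injection_graph ?V N
    proof (unfold_locales, goal_cases)
      case (3 u v)
      then show ?case using N(1) Z.adj_V by blast
    next
      case (4 u)
      then show ?case using N(1) Z.adj_irrefl by blast
    next
      case (7 S)
      then show ?case using closed[OF 7(1,2)] N(1) by blast
    qed (use V0 N in auto)
    show ?thesis
      using P.numbering
    proof (elim disjE conjE exE)
      fix \<phi> :: "'v \<Rightarrow> nat" and n
      assume n: "n \<ge> 1" and \<phi>: "bij_betw \<phi> ?V {1..n}"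
        "\<forall>u\<in>?V. \<forall>v\<in>?V. N u v \<or> N v u \<longleftrightarrow> \<phi> v = \<phi> u + 1 \<or> \<phi> u = \<phi> v + 1"
      have "\<phi> v \<in> {1..n}" if "v \<in> ?V" for v using \<phi>(1) that by (auto simp: bij_betw_def)
      then have "digraph_iso G (type_A n)"
        unfolding digraph_iso_numbering using \<phi> N(1) by (intro exI[of _ \<phi>]) (auto simp: type_A_def)
      then show ?thesis using n by blast
    next
      fix \<phi> :: "'v \<Rightarrow> nat" and n
      assume n: "n \<ge> 2" "\<not> acyclic {(u, v). N u v}" and \<phi>: "bij_betw \<phi> ?V {0..n}"
        "\<forall>u\<in>?V. \<forall>v\<in>?V. N u v \<or> N v u \<longleftrightarrow> \<phi> v = (\<phi> u + 1) mod (n + 1) \<or> \<phi> u = (\<phi> v + 1) mod (n + 1)"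
      have "\<phi> v \<in> {0..n}" if "v \<in> ?V" for v using \<phi>(1) that by (auto simp: bij_betw_def)
      then have "digraph_iso G (type_affine_A n)"
        unfolding digraph_iso_numbering using \<phi> N(1) by (intro exI[of _ \<phi>]) (auto simp: type_affine_A_def)
      then show ?thesis using n N(4) by blast
    qed
  qed
  have A: "cellular_algebra TYPE('x) TYPE('s) K ?Z" if iso: "digraph_iso G (type_A n)" for n
  proof -
    obtain \<phi> where \<phi>: "bij_betw \<phi> ?V {1..n}"
      "\<And>u v. u \<in> ?V \<Longrightarrow> v \<in> ?V \<Longrightarrow> ?adj u v \<longleftrightarrow> (\<phi> u, \<phi> v) \<in> parcs (type_A n)"
      using iso unfolding digraph_iso_numbering by (auto simp: type_A_def)
    have inj: "u = v" if "\<phi> u = \<phi> v" "u \<in> ?V" "v \<in> ?V" for u v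
      using \<phi>(1) that by (auto simp: bij_betw_def dest: inj_onD)
    have in_n: "\<phi> v \<in> {1..n}" if "v \<in> ?V" for v using \<phi>(1) that by (auto simp: bij_betw_def)
    \<comment> \<open>The path is oriented by increasing numbers, with the vertex numbered 1 as its
      source.\<close>
    define N where "N u v \<longleftrightarrow> u \<in> ?V \<and> v \<in> ?V \<and> \<phi> v = \<phi> u + 1" for u v
    interpret oriented_zigzag K ?Z ?V ?adj co bas N \<kappa> \<iota>
    proof (unfold_locales, goal_cases)
      case (1 u v)
      show ?case
      proof (cases "u \<in> ?V \<and> v \<in> ?V")
        case True
        then show ?thesis using \<phi>(2)[of u v] in_n by (auto simp: N_def type_A_def)
      next
        case False
        then show ?thesis using Z.adj_V by (auto simp: N_def)
      qed
    qed (use inj \<kappa> \<iota> in \<open>auto simp: N_def\<close>)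
    show ?thesis by (rule cellular[of \<phi>, OF _ V0]) (simp add: N_def)
  qed
  have B: "relative_cellular_algebra TYPE('x) TYPE('s) K ?Z"
    if iso: "digraph_iso G (type_affine_A n)" and n: "n \<ge> 2" for n
  proof -
    obtain \<phi> where \<phi>: "bij_betw \<phi> ?V {0..n}"
      "\<And>u v. u \<in> ?V \<Longrightarrow> v \<in> ?V \<Longrightarrow> ?adj u v \<longleftrightarrow> (\<phi> u, \<phi> v) \<in> parcs (type_affine_A n)"
      using iso unfolding digraph_iso_numbering by (auto simp: type_affine_A_def)
    have inj: "u = v" if "\<phi> u = \<phi> v" "u \<in> ?V" "v \<in> ?V" for u v
      using \<phi>(1) that by (auto simp: bij_betw_def dest: inj_onD)
    have in_n: "\<phi> v \<le> n" if "v \<in> ?V" for v using \<phi>(1) that by (auto simp: bij_betw_def)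
    have succ: "(\<phi> v + 1) mod (n + 1) = (if \<phi> v = n then 0 else \<phi> v + 1)" if "v \<in> ?V" for v
      using in_n[OF that] by auto
    define N where "N u v \<longleftrightarrow> u \<in> ?V \<and> v \<in> ?V \<and> \<phi> v = (if \<phi> u = n then 0 else \<phi> u + 1)" for u v
    interpret oriented_zigzag K ?Z ?V ?adj co bas N \<kappa> \<iota>
    proof (unfold_locales, goal_cases)
      case (1 u v)
      show ?case
      proof (cases "u \<in> ?V \<and> v \<in> ?V")
        case True
        then show ?thesis using \<phi>(2)[of u v] in_n succ by (simp add: N_def type_affine_A_def)
      next
        case False
        then show ?thesis using Z.adj_V by (auto simp: N_def)
      qed
    next
      case (3 u w v)
      then have "\<phi> u = \<phi> v" by (auto simp: N_def split: if_splits)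
      then show ?case using 3 inj by (auto simp: N_def)
    next
      case (4 u v)
      then have "\<phi> v = (if \<phi> u = n then 0 else \<phi> u + 1)" "\<phi> u = (if \<phi> v = n then 0 else \<phi> v + 1)"
        by (simp_all add: N_def)
      \<comment> \<open>If each were the successor of the other, the cycle would have at most two
        vertices.\<close>
      then show ?case using n by presburger
    qed (use inj \<kappa> \<iota> in \<open>auto simp: N_def\<close>)
    show ?thesis by (rule relative_cellular)
  qed
  show ?thesis
  proof (intro conjI iffI)
    assume "cellular_algebra TYPE('x) TYPE('s) K ?Z"
    then obtain X :: "'x set" and M :: "'x \<Rightarrow> 's set" and C star leq eps
      where "relative_cell_datum K ?Z X M C star {\<one>\<^bsub>?Z\<^esub>} leq eps"
      unfolding cellular_algebra_def by blast
    from shape[OF this] show "\<exists>n\<ge>1. digraph_iso G (type_A n)" by simp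
  next
    assume "relative_cellular_algebra TYPE('x) TYPE('s) K ?Z"
    then obtain X :: "'x set" and M :: "'x \<Rightarrow> 's set" and C star E leq eps
      where "relative_cell_datum K ?Z X M C star E leq eps"
      unfolding relative_cellular_algebra_def by blast
    from shape[OF this]
    show "(\<exists>n\<ge>1. digraph_iso G (type_A n)) \<or> (\<exists>n\<ge>2. digraph_iso G (type_affine_A n))" by blast
  qed (use A B cellular_imp_relative_cellular in blast)+
qed

end
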